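(* Let $n\ge 2$ be an integer, let $\varphi\in C(\overline{\mathbb{D}^{n-1}})$ and $\chi\in C(\overline{\mathbb{D}})$, and let $\psi(z',z_n)=\varphi(z')\chi(z_n)$ for $z'\in\overline{\mathbb{D}^{n-1}}$ and $z_n\in\overline{\mathbb{D}}$. Then the essential spectrum of $H_\psi^*H_\psi$ on $A^2(\mathbb{D}^n)$ contains the set $$\left\{|\chi(q)|^2\mu : q\in b\mathbb{D},\ \mu\in\sigma\left((H^{\mathbb{D}^{n-1}}_{\varphi})^*H^{\mathbb{D}^{n-1}}_{\varphi}\right)\right\}.$$
   Context: $\mathbb{D}$ is the open unit disc in $\mathbb{C}$ and $b\mathbb{D}$ is its boundary, the unit circle. For a bounded domain $\Omega\subset\mathbb{C}^d$, $A^2(\Omega)$ is the Bergman space of holomorphic functions on $\Omega$ that are square integrable with respect to Lebesgue measure, and $P^\Omega:L^2(\Omega)\to A^2(\Omega)$ is the orthogonal (Bergman) projection. For a bounded measurable function $\psi$ on $\Omega$ the Hankel operator $H_\psi^\Omega:A^2(\Omega)\to L^2(\Omega)$ is $H_\psi^\Omega f=(I-P^\Omega)(\psi f)$; $(H_\psi^\Omega)^*$ is its Hilbert space adjoint, so $(H_\psi^\Omega)^*H_\psi^\Omega$ is a bounded self-adjoint operator on $A^2(\Omega)$. Here $H_\psi$ means $H_\psi^{\mathbb{D}^n}$. $\sigma(T)$ denotes the spectrum of $T$; the discrete spectrum $\sigma_d(T)$ is the set of eigenvalues of finite (algebraic) multiplicity that are isolated points of $\sigma(T)$; the essential spectrum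 is $\sigma_e(T)=\sigma(T)\setminus\sigma_d(T)$. *)

theory Defs
  imports "HOL-Analysis.Analysis"
begin

section \<open>Holomorphic functions, \<open>L\<^sup>2\<close> and the Bergman space\<close>

definition holomorphic_several ::
    "(complex ^ 'n \<Rightarrow> complex) \<Rightarrow> (complex ^ 'n) set \<Rightarrow> bool" where
  "holomorphic_several f \<Omega> \<longleftrightarrow>
     (\<forall>z\<in>\<Omega>. \<exists>D. (f has_derivative D) (at z) \<and> (\<forall>c h. D (c *s h) = c * D h))"

definition L2_space :: "'a::euclidean_space set \<Rightarrow> ('a \<Rightarrow> complex) set" where
  "L2_space \<Omega> = {f \<in> borel_measurable (lebesgue_on \<Omega>).
                   integrable (lebesgue_on \<Omega>) (\<lambda>z. (cmod (f z))\<^sup>2)}"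

definition L2_inner ::
    "'a::euclidean_space set \<Rightarrow> ('a \<Rightarrow> complex) \<Rightarrow> ('a \<Rightarrow> complex) \<Rightarrow> complex" where
  "L2_inner \<Omega> f g = (LINT z|lebesgue_on \<Omega>. f z * cnj (g z))"

definition L2_norm :: "'a::euclidean_space set \<Rightarrow> ('a \<Rightarrow> complex) \<Rightarrow> real" where
  "L2_norm \<Omega> f = sqrt (LINT z|lebesgue_on \<Omega>. (cmod (f z))\<^sup>2)"

text \<open>
  Elements of the Bergman space of \<open>\<Omega>\<close> are extended by \<open>0\<close> to total functions, so that HOL
  equality of two elements is equality on \<open>\<Omega>\<close>. Elements of \<open>L\<^sup>2\<close> are represented by
  functions, not by almost-everywhere classes; they enter only through their integrals.
\<close>

definition bergman_space :: "(complex ^ 'n) set \<Rightarrow> (complex ^ 'n \<Rightarrow> complex) set" where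
  "bergman_space \<Omega> =
     {f. holomorphic_several f \<Omega> \<and> f \<in> L2_space \<Omega> \<and> (\<forall>z. z \<notin> \<Omega> \<longrightarrow> f z = 0)}"

text \<open>The orthogonal projection of \<open>L\<^sup>2\<close> onto the Bergman space, a closed subspace for open \<open>\<Omega>\<close>.\<close>

definition bergman_projection ::
    "(complex ^ 'n) set \<Rightarrow> (complex ^ 'n \<Rightarrow> complex) \<Rightarrow> (complex ^ 'n \<Rightarrow> complex)" where
  "bergman_projection \<Omega> u =
     (THE g. g \<in> bergman_space \<Omega> \<and>
             (\<forall>h\<in>bergman_space \<Omega>. L2_inner \<Omega> (\<lambda>z. u z - g z) h = 0))"

section \<open>Hankel operators\<close>

definition hankel ::
    "(complex ^ 'n) set \<Rightarrow> (complex ^ 'n \<Rightarrow> complex) \<Rightarrow>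
     (complex ^ 'n \<Rightarrow> complex) \<Rightarrow> (complex ^ 'n \<Rightarrow> complex)" where
  "hankel \<Omega> \<psi> f = (\<lambda>z. \<psi> z * f z - bergman_projection \<Omega> (\<lambda>w. \<psi> w * f w) z)"

text \<open>The Hilbert space adjoint of an operator from the Bergman space to \<open>L\<^sup>2\<close>.\<close>

definition bergman_adjoint ::
    "(complex ^ 'n) set \<Rightarrow> ((complex ^ 'n \<Rightarrow> complex) \<Rightarrow> (complex ^ 'n \<Rightarrow> complex)) \<Rightarrow>
     (complex ^ 'n \<Rightarrow> complex) \<Rightarrow> (complex ^ 'n \<Rightarrow> complex)" where
  "bergman_adjoint \<Omega> T u =
     (THE g. g \<in> bergman_space \<Omega> \<and>
             (\<forall>f\<in>bergman_space \<Omega>. L2_inner \<Omega> (T f) u = L2_inner \<Omega> f g))"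

definition hankel_star_hankel ::
    "(complex ^ 'n) set \<Rightarrow> (complex ^ 'n \<Rightarrow> complex) \<Rightarrow>
     (complex ^ 'n \<Rightarrow> complex) \<Rightarrow> (complex ^ 'n \<Rightarrow> complex)" where
  "hankel_star_hankel \<Omega> \<psi> = bergman_adjoint \<Omega> (hankel \<Omega> \<psi>) \<circ> hankel \<Omega> \<psi>"

section \<open>Spectra of operators on a space of functions\<close>

text \<open>
  Here \<open>V\<close> is a linear space of complex-valued functions, \<open>N\<close> a norm on \<open>V\<close>, and
  \<open>T\<close> an operator on \<open>V\<close>; values of operators outside \<open>V\<close> are irrelevant.
\<close>

definition bounded_operator_on ::
    "('a \<Rightarrow> complex) set \<Rightarrow> (('a \<Rightarrow> complex) \<Rightarrow> real) \<Rightarrow>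
     (('a \<Rightarrow> complex) \<Rightarrow> ('a \<Rightarrow> complex)) \<Rightarrow> bool" where
  "bounded_operator_on V N T \<longleftrightarrow>
     (\<forall>f\<in>V. T f \<in> V) \<and>
     (\<forall>f\<in>V. \<forall>g\<in>V. T (\<lambda>z. f z + g z) = (\<lambda>z. T f z + T g z)) \<and>
     (\<forall>c. \<forall>f\<in>V. T (\<lambda>z. c * f z) = (\<lambda>z. c * T f z)) \<and>
     (\<exists>K. \<forall>f\<in>V. N (T f) \<le> K * N f)"

definition shifted_operator ::
    "(('a \<Rightarrow> complex) \<Rightarrow> ('a \<Rightarrow> complex)) \<Rightarrow> complex \<Rightarrow>
     ('a \<Rightarrow> complex) \<Rightarrow> ('a \<Rightarrow> complex)" where
  "shifted_operator T \<zeta> f = (\<lambda>z. T f z - \<zeta> * f z)"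

definition spectrum_on ::
    "('a \<Rightarrow> complex) set \<Rightarrow> (('a \<Rightarrow> complex) \<Rightarrow> real) \<Rightarrow>
     (('a \<Rightarrow> complex) \<Rightarrow> ('a \<Rightarrow> complex)) \<Rightarrow> complex set" where
  "spectrum_on V N T =
     {\<zeta>. \<not> (\<exists>S. bounded_operator_on V N S \<and>
               (\<forall>f\<in>V. S (shifted_operator T \<zeta> f) = f \<and> shifted_operator T \<zeta> (S f) = f))}"

definition eigenvalue_on ::
    "('a \<Rightarrow> complex) set \<Rightarrow> (('a \<Rightarrow> complex) \<Rightarrow> ('a \<Rightarrow> complex)) \<Rightarrow> complex \<Rightarrow> bool" where
  "eigenvalue_on V T \<zeta> \<longleftrightarrow> (\<exists>f\<in>V. f \<noteq> (\<lambda>_. 0) \<and> T f = (\<lambda>z. \<zeta> * f z))"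

definition generalized_eigenspace_on ::
    "('a \<Rightarrow> complex) set \<Rightarrow> (('a \<Rightarrow> complex) \<Rightarrow> ('a \<Rightarrow> complex)) \<Rightarrow> complex \<Rightarrow>
     ('a \<Rightarrow> complex) set" where
  "generalized_eigenspace_on V T \<zeta> = {f\<in>V. \<exists>k. (shifted_operator T \<zeta> ^^ k) f = (\<lambda>_. 0)}"

definition finite_dimensional_functions :: "('a \<Rightarrow> complex) set \<Rightarrow> bool" where
  "finite_dimensional_functions E \<longleftrightarrow>
     (\<exists>B. finite B \<and> B \<subseteq> E \<and> (\<forall>f\<in>E. \<exists>c. f = (\<lambda>z. \<Sum>b\<in>B. c b * b z)))"

text \<open>The algebraic multiplicity of an eigenvalue is the dimension of its generalized eigenspace.\<close>

definition discrete_spectrum_on ::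
    "('a \<Rightarrow> complex) set \<Rightarrow> (('a \<Rightarrow> complex) \<Rightarrow> real) \<Rightarrow>
     (('a \<Rightarrow> complex) \<Rightarrow> ('a \<Rightarrow> complex)) \<Rightarrow> complex set" where
  "discrete_spectrum_on V N T =
     {\<zeta>. eigenvalue_on V T \<zeta> \<and>
          finite_dimensional_functions (generalized_eigenspace_on V T \<zeta>) \<and>
          \<zeta> isolated_in spectrum_on V N T}"

definition essential_spectrum_on ::
    "('a \<Rightarrow> complex) set \<Rightarrow> (('a \<Rightarrow> complex) \<Rightarrow> real) \<Rightarrow>
     (('a \<Rightarrow> complex) \<Rightarrow> ('a \<Rightarrow> complex)) \<Rightarrow> complex set" where
  "essential_spectrum_on V N T = spectrum_on V N T - discrete_spectrum_on V N T"

section \<open>Polydiscs\<close>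

definition polydisc :: "(complex ^ 'n) set" where
  "polydisc = {z. \<forall>i. z $ i \<in> ball 0 1}"

text \<open>
  If \<open>CARD('m) = n - 1\<close> then \<open>CARD('m option) = n\<close>, so \<open>\<complex>\<^sup>n\<close> is
  \<open>complex ^ 'm option\<close>: the coordinates \<open>Some j\<close> are those of \<open>z'\<close>, and \<open>None\<close> is the
  last coordinate. Since \<open>'m\<close> is nonempty, exactly the values \<open>n \<ge> 2\<close> arise.
\<close>

definition vec_snoc :: "complex ^ 'm \<Rightarrow> complex \<Rightarrow> complex ^ ('m option)" where
  "vec_snoc z w = (\<chi> i. case i of None \<Rightarrow> w | Some j \<Rightarrow> z $ j)"

end

theory Submission imports Defs "HOL-Complex_Analysis.Complex_Analysis" begin

text \<open>
Write \<open>T\<^sub>\<phi>\<close> for \<open>H\<^sub>\<phi>\<^sup>* H\<^sub>\<phi>\<close>. A point \<open>\<mu>\<close> of the spectrum of the self-adjoint operator \<open>T\<^sub>\<phi>\<close> is real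
and has approximate eigenvectors: unit vectors \<open>f\<close> with \<open>T\<^sub>\<phi> f - \<mu> f\<close> small. Multiply such an \<open>f\<close> by
a normalised peak function \<open>g\<close> in the last variable, a power of \<open>(1 + cnj q * w) / 2\<close>, whose mass
concentrates at the boundary point \<open>q\<close>. On such products multiplication by \<open>chi\<close> is almost
multiplication by the number \<open>chi q\<close>, and since \<open>g\<close> is holomorphic, the Bergman projection acts on
the factor \<open>f\<close> alone (\<open>proj_tensor\<close>). Hence \<open>T\<^sub>\<psi> (f g)\<close> is close to \<open>\<bar>chi q\<bar>\<^sup>2 (T\<^sub>\<phi> f) g\<close>
(\<open>hank_sq_tensor_peak\<close>), so \<open>\<lambda> = \<bar>chi q\<bar>\<^sup>2 \<mu>\<close> has approximate eigenvectors \<open>f g\<close> and lies in the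
spectrum of \<open>T\<^sub>\<psi>\<close>. The concentration also makes \<open>f g\<close> nearly orthogonal to any given finite set
of functions (\<open>peak_weakly_null\<close>).

The second half is the Weyl criterion. If \<open>\<lambda>\<close> were an isolated point of the spectrum of a
self-adjoint operator \<open>T\<close> with a finite-dimensional kernel of \<open>T - \<lambda>\<close>, then \<open>\<parallel>x\<parallel>\<^sup>2\<close> would be
bounded by a multiple of \<open>\<parallel>(T - \<lambda>) x\<parallel>\<^sup>2\<close> plus the squares of finitely many inner products
(\<open>fredholm_estimate\<close>), which the vectors \<open>f g\<close> contradict. The estimate is obtained without
functional calculus from an elementary lemma on spectral gaps (\<open>gap\<close>).

All functions that occur are continuous on the polydisc, so the argument takes place in the inner
product space \<open>disc_fun\<close> of continuous square integrable functions. It is not complete, but its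
subspace \<open>hol\<close> of holomorphic functions is (\<open>complete_hol\<close>), and this suffices for orthogonal
projections onto \<open>hol\<close>. Completeness rests on the bound of point evaluations by the \<open>L\<^sup>2\<close> norm,
which needs the invariance of Lebesgue measure under multiplication by unit complex numbers.
\<close>

section \<open>Orthogonal projections and symmetric operators\<close>

lemma norm_diff_scaleR_squared:
  fixes x y :: "'a::real_inner"
  shows "(norm (x - t *\<^sub>R y))\<^sup>2 = (norm x)\<^sup>2 - 2 * t * inner x y + t\<^sup>2 * (norm y)\<^sup>2"
  by (simp add: power2_norm_eq_inner inner_diff_left inner_diff_right inner_commute[of y x]
      power2_eq_square[of t] right_diff_distrib)

text \<open>A sequence in \<open>V\<close> that minimises the distance to \<open>x\<close> is Cauchy by the parallelogram identity, so
  completeness is needed of the subspace only, not of the ambient space.\<close>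

lemma exists_orthogonal_projection:
  fixes V :: "'a::real_inner set"
  assumes V: "subspace V" "complete V"
  shows "\<exists>v\<in>V. \<forall>h\<in>V. inner (x - v) h = 0"
proof -
  have ne: "V \<noteq> {}" using subspace_0[OF V(1)] by auto
  define D where "D = infdist x V"
  have D: "D \<le> norm (x - u)" if "u \<in> V" for u
    using infdist_le[OF that, of x] by (simp add: D_def dist_norm)
  have D0: "0 \<le> D" by (simp add: D_def infdist_nonneg)
  have "\<exists>v\<in>V. norm (x - v) < D + 1 / real (Suc k)" for k
  proof -
    have "infdist x V < D + 1 / real (Suc k)" by (simp add: D_def)
    then have "(INF a\<in>V. dist x a) < D + 1 / real (Suc k)" using ne by (simp add: infdist_def)
    then obtain a where "a \<in> V" "dist x a < D + 1 / real (Suc k)"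
      by (subst (asm) cINF_less_iff) (use ne in auto)
    then show ?thesis by (auto simp: dist_norm)
  qed
  then obtain v where v: "\<And>k. v k \<in> V" "\<And>k. norm (x - v k) < D + 1 / real (Suc k)" by metis
  have par: "(norm (v k - v l))\<^sup>2 \<le> 2 * (norm (x - v k))\<^sup>2 + 2 * (norm (x - v l))\<^sup>2 - 4 * D\<^sup>2" for k l
  proof -
    have "(1/2) *\<^sub>R (v k + v l) \<in> V"
      using V(1) v(1) by (simp add: subspace_add subspace_scale)
    then have "D \<le> norm (x - (1/2) *\<^sub>R (v k + v l))" by (rule D)
    then have "D\<^sup>2 \<le> (norm (x - (1/2) *\<^sub>R (v k + v l)))\<^sup>2" using D0 by (simp add: power_mono)
    moreover have "(norm (v k - v l))\<^sup>2 =
      2 * (norm (x - v k))\<^sup>2 + 2 * (norm (x - v l))\<^sup>2 - 4 * (norm (x - (1/2) *\<^sub>R (v k + v l)))\<^sup>2"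
      by (simp add: power2_norm_eq_inner inner_diff_left inner_diff_right inner_add_left
          inner_add_right inner_commute algebra_simps)
    ultimately show ?thesis by simp
  qed
  have "(\<lambda>k. 4 * (D + 1 / real (Suc k))\<^sup>2 - 4 * D\<^sup>2) \<longlonglongrightarrow> 4 * (D + 0)\<^sup>2 - 4 * D\<^sup>2"
    by (intro tendsto_intros LIMSEQ_inverse_real_of_nat[unfolded inverse_eq_divide])
  then have lim0: "(\<lambda>k. 4 * (D + 1 / real (Suc k))\<^sup>2 - 4 * D\<^sup>2) \<longlonglongrightarrow> 0" by simp
  have "Cauchy v"
  proof (rule CauchyI)
    fix e :: real assume "0 < e"
    then have "\<forall>\<^sub>F k in sequentially. 4 * (D + 1 / real (Suc k))\<^sup>2 - 4 * D\<^sup>2 < e\<^sup>2"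
      using order_tendstoD(2)[OF lim0] by simp
    then obtain N where N: "4 * (D + 1 / real (Suc N))\<^sup>2 - 4 * D\<^sup>2 < e\<^sup>2"
      by (auto simp: eventually_sequentially)
    have b: "(norm (x - v k))\<^sup>2 \<le> (D + 1 / real (Suc N))\<^sup>2" if "N \<le> k" for k
    proof -
      have "1 / real (Suc k) \<le> 1 / real (Suc N)" using that by (simp add: field_simps)
      then show ?thesis using v(2)[of k] by (intro power_mono) auto
    qed
    show "\<exists>M. \<forall>m\<ge>M. \<forall>n\<ge>M. norm (v m - v n) < e"
    proof (intro exI allI impI)
      fix m n assume "N \<le> m" "N \<le> n"
      then have "(norm (v m - v n))\<^sup>2 < e\<^sup>2" using par[of m n] b[of m] b[of n] N by linarith
      then show "norm (v m - v n) < e" using \<open>0 < e\<close> by (simp add: power2_less_imp_less)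
    qed
  qed
  then obtain w where w: "w \<in> V" "v \<longlonglongrightarrow> w" using V(2) v(1) by (auto simp: complete_def)
  have lim_v: "(\<lambda>k. norm (x - v k)) \<longlonglongrightarrow> norm (x - w)" by (intro tendsto_intros w)
  have lim_D: "(\<lambda>k. D + 1 / real (Suc k)) \<longlonglongrightarrow> D + 0"
    by (intro tendsto_intros LIMSEQ_inverse_real_of_nat[unfolded inverse_eq_divide])
  have wD: "norm (x - w) \<le> D"
    using LIMSEQ_le[OF lim_v lim_D] less_imp_le[OF v(2)] by auto
  have "inner (x - w) h = 0" if h: "h \<in> V" for h
  proof (cases "h = 0")
    case False
    \<comment> \<open>the step along \<open>h\<close> that minimises the distance to \<open>x\<close>\<close>
    define t where "t = inner (x - w) h / inner h h"
    have fraction: "N - 2 * (a / b) * a + (a / b)\<^sup>2 * b = N - a\<^sup>2 / b" if "b \<noteq> 0" for N a b :: real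
      using that by (simp add: power2_eq_square)
    have "w + t *\<^sub>R h \<in> V" using V(1) w h by (simp add: subspace_add subspace_scale)
    then have "norm (x - w) \<le> norm (x - (w + t *\<^sub>R h))" using D wD by force
    then have "(norm (x - w))\<^sup>2 \<le> (norm (x - w - t *\<^sub>R h))\<^sup>2"
      by (simp add: power_mono diff_diff_eq)
    also have "\<dots> = (norm (x - w))\<^sup>2 - 2 * t * inner (x - w) h + t\<^sup>2 * inner h h"
      unfolding norm_diff_scaleR_squared by (simp only: power2_norm_eq_inner)
    also have "\<dots> = (norm (x - w))\<^sup>2 - (inner (x - w) h)\<^sup>2 / inner h h"
      unfolding t_def by (rule fraction) (use False in simp)
    finally have "(inner (x - w) h)\<^sup>2 / inner h h \<le> 0" by simp
    from mult_right_mono[OF this, of "inner h h"]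
    have "(inner (x - w) h)\<^sup>2 \<le> 0" using False by simp
    then show ?thesis by simp
  qed simp
  with w show ?thesis by blast
qed

definition proj :: "'a::real_inner set \<Rightarrow> 'a \<Rightarrow> 'a" where
  "proj V x = (SOME v. v \<in> V \<and> (\<forall>h\<in>V. inner (x - v) h = 0))"

context
  fixes V :: "'a::real_inner set"
  assumes V: "subspace V" "complete V"
begin

lemma proj_in: "proj V x \<in> V"
  and proj_orthogonal: "h \<in> V \<Longrightarrow> inner (x - proj V x) h = 0"
  using someI_ex[of "\<lambda>v. v \<in> V \<and> (\<forall>h\<in>V. inner (x - v) h = 0)"]
    exists_orthogonal_projection[OF V, of x] unfolding proj_def by blast+

lemma inner_proj: "h \<in> V \<Longrightarrow> inner (proj V x) h = inner x h"
  using proj_orthogonal[of h x] by (simp add: inner_diff_left)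

lemma proj_eqI:
  assumes "v \<in> V" "\<And>h. h \<in> V \<Longrightarrow> inner (x - v) h = 0"
  shows "proj V x = v"
proof -
  have m: "proj V x - v \<in> V" using V(1) assms(1) proj_in subspace_diff by blast
  have "inner (proj V x - v) (proj V x - v) = inner (x - v) (proj V x - v) - inner (x - proj V x) (proj V x - v)"
    by (simp add: inner_diff_left)
  also have "\<dots> = 0" using assms(2) proj_orthogonal m by simp
  finally show ?thesis by simp
qed

lemma norm_pythagoras_proj: "(norm x)\<^sup>2 = (norm (proj V x))\<^sup>2 + (norm (x - proj V x))\<^sup>2"
  using proj_orthogonal[OF proj_in, of x x]
  by (simp add: power2_norm_eq_inner inner_diff_left inner_diff_right inner_commute)

lemma norm_proj_le: "norm (proj V x) \<le> norm x"
  by (rule power2_le_imp_le)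
    (use norm_pythagoras_proj[of x] zero_le_power2[of "norm (x - proj V x)"] in linarith, simp)
    
lemma bounded_linear_proj: "bounded_linear (proj V)"
proof (rule bounded_linear_intro[where K = 1])
  show "proj V (x + y) = proj V x + proj V y" for x y
    by (rule proj_eqI) (use V(1) proj_in proj_orthogonal in
        \<open>auto simp: subspace_add inner_diff_left inner_add_left inner_proj\<close>)
  show "proj V (r *\<^sub>R x) = r *\<^sub>R proj V x" for r x
    by (rule proj_eqI) (use V(1) proj_in in \<open>auto simp: subspace_scale inner_diff_left inner_proj\<close>)
qed (use norm_proj_le in auto)

end

lemma subspace_closure:
  fixes S :: "'a::real_normed_vector set"
  assumes S: "subspace S"
  shows "subspace (closure S)"
proof (rule subspaceI)
  show "0 \<in> closure S" using subspace_0[OF S] closure_subset by blast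
  fix x assume "x \<in> closure S"
  then obtain f where f: "\<And>n. f n \<in> S" "f \<longlonglongrightarrow> x" by (auto simp: closure_sequential)
  show "c *\<^sub>R x \<in> closure S" for c
    unfolding closure_sequential
    by (rule exI[of _ "\<lambda>n. c *\<^sub>R f n"]) (use f S in \<open>auto intro: subspace_scale tendsto_intros\<close>)
  fix y assume "y \<in> closure S"
  then obtain g where g: "\<And>n. g n \<in> S" "g \<longlonglongrightarrow> y" by (auto simp: closure_sequential)
  show "x + y \<in> closure S"
    unfolding closure_sequential
    by (rule exI[of _ "\<lambda>n. f n + g n"]) (use f g S in \<open>auto intro: subspace_add tendsto_intros\<close>)
qed

text \<open>A lower bound makes the range complete, and a vector of \<open>V\<close> orthogonal to the range is in the
  kernel of the adjoint \<open>B\<close>.\<close>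

lemma surjective_of_bounded_below:
  fixes V :: "'a::real_inner set"
  assumes V: "subspace V" "complete V"
    and A: "bounded_linear A" "A ` V \<subseteq> V"
    and adj: "\<And>x y. x \<in> V \<Longrightarrow> y \<in> V \<Longrightarrow> inner (A x) y = inner x (B y)"
    and c: "0 < c" "\<And>x. x \<in> V \<Longrightarrow> c * norm x \<le> norm (A x)"
    and B: "B ` V \<subseteq> V" "\<And>y. y \<in> V \<Longrightarrow> B y = 0 \<Longrightarrow> y = 0"
    and y: "y \<in> V"
  shows "\<exists>x\<in>V. A x = y"
proof -
  interpret A: bounded_linear A by fact
  have sub: "subspace (A ` V)" by (rule linear_subspace_image[OF A.linear V(1)])
  have comp: "complete (A ` V)"
    by (rule complete_isometric_image[OF c(1) V(1) A(1) _ V(2)]) (use c in auto)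
  define v where "v = y - proj (A ` V) y"
  have vV: "v \<in> V" unfolding v_def
    using y A(2) proj_in[OF sub comp] subspace_diff[OF V(1)] by blast
  have "inner (A x) v = 0" if "x \<in> V" for x
    using proj_orthogonal[OF sub comp, of "A x" y] that by (simp add: v_def inner_commute)
  then have "inner (B v) (B v) = 0" using adj[of "B v" v] B(1) vV by auto
  then have "v = 0" using B(2)[OF vV] by simp
  then have "y \<in> A ` V" using proj_in[OF sub comp, of y] by (simp add: v_def)
  then show ?thesis by blast
qed

text \<open>The operator acts on the whole ambient space, so that it can be a bounded linear map in the usual
  sense; symmetry and all estimates concern its restriction to the complete subspace \<open>V\<close>.\<close>

locale symmetric_operator =
  fixes V :: "'a::real_inner set" and T :: "'a \<Rightarrow> 'a"
  assumes subspace_V: "subspace V" and complete_V: "complete V"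
    and bounded_linear_T: "bounded_linear T"
    and T_in: "x \<in> V \<Longrightarrow> T x \<in> V"
    and symmetric: "x \<in> V \<Longrightarrow> y \<in> V \<Longrightarrow> inner (T x) y = inner x (T y)"
begin

lemma shift: "symmetric_operator V (\<lambda>x. T x - t *\<^sub>R x)"
proof (rule symmetric_operator.intro)
  show "bounded_linear (\<lambda>x. T x - t *\<^sub>R x)"
    by (intro bounded_linear_sub bounded_linear_T bounded_linear_scaleR_right)
qed (use subspace_V complete_V T_in symmetric in
      \<open>auto simp: subspace_diff subspace_scale inner_diff_left inner_diff_right\<close>)

lemma square: "symmetric_operator V (\<lambda>x. T (T x))"
proof (rule symmetric_operator.intro)
  show "bounded_linear (\<lambda>x. T (T x))"
    by (intro bounded_linear_compose[OF bounded_linear_T] bounded_linear_T)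
qed (use subspace_V complete_V T_in symmetric in auto)

definition bounded_below :: "real \<Rightarrow> bool" where
  "bounded_below t \<longleftrightarrow> (\<exists>c>0. \<forall>x\<in>V. c * norm x \<le> norm (T x - t *\<^sub>R x))"

text \<open>This is the Cauchy--Schwarz inequality for the semi-definite form \<open>(x, y) \<mapsto> inner (T x) y\<close>, applied
  to \<open>x\<close> and \<open>T x\<close>. It is proved by evaluating the form on \<open>x - s T x\<close> with \<open>s = 1 / K\<close>.\<close>

lemma positive_norm_le:
  assumes pos: "\<And>x. x \<in> V \<Longrightarrow> 0 \<le> inner (T x) x"
    and K: "\<And>x. norm (T x) \<le> K * norm x" and x: "x \<in> V"
  shows "(norm (T x))\<^sup>2 \<le> K * inner (T x) x"
proof -
  define a b where "a = inner (T x) x" and "b = (norm (T x))\<^sup>2"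
  have Tb: "inner (T (T x)) (T x) \<le> K * b"
  proof -
    have "inner (T (T x)) (T x) \<le> norm (T (T x)) * norm (T x)" by (rule norm_cauchy_schwarz)
    also have "\<dots> \<le> K * norm (T x) * norm (T x)" by (intro mult_right_mono K) auto
    finally show ?thesis by (simp add: b_def power2_eq_square)
  qed
  have q: "0 \<le> a - 2 * s * b + s\<^sup>2 * (K * b)" for s
  proof -
    interpret T: bounded_linear T by (rule bounded_linear_T)
    have "x - s *\<^sub>R T x \<in> V" using subspace_V T_in x by (simp add: subspace_diff subspace_scale)
    then have "0 \<le> inner (T (x - s *\<^sub>R T x)) (x - s *\<^sub>R T x)" by (rule pos)
    also have "\<dots> = a - 2 * s * b + s\<^sup>2 * inner (T (T x)) (T x)"
      using symmetric[OF T_in[OF x] x]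
      by (simp add: T.diff T.scaleR a_def b_def inner_diff_left inner_diff_right
          inner_commute[of x "T x"] power2_norm_eq_inner power2_eq_square[of s] right_diff_distrib)
    also have "\<dots> \<le> a - 2 * s * b + s\<^sup>2 * (K * b)" using Tb by (intro add_left_mono mult_left_mono) auto
    finally show ?thesis .
  qed
  show ?thesis
  proof (cases "K \<le> 0")
    case True
    then have "T x = 0" using K[of x] by (smt (verit) norm_ge_zero norm_le_zero_iff mult_nonneg_nonpos2)
    then show ?thesis by simp
  next
    case False
    then have "0 \<le> a - 2 * (1/K) * b + (1/K)\<^sup>2 * (K * b)" using q by blast
    also have "\<dots> = a - b / K" using False by (simp add: power2_eq_square field_simps)
    finally show ?thesis using False by (simp add: a_def b_def field_simps)
  qed
qed

text \<open>If \<open>r\<close> is the best lower bound of \<open>S = T - m\<close>, then \<open>S\<^sup>2 - r\<^sup>2\<close> is semi-definite, and on suitable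
  unit vectors its quadratic form is arbitrarily small; by the previous lemma it almost annihilates
  them. As \<open>S\<^sup>2 - r\<^sup>2 = (S - r) (S + r)\<close>, one of \<open>m + r\<close> and \<open>m - r\<close> is a point where \<open>T\<close> has no lower
  bound, which forces \<open>r \<ge> d\<close>.\<close>

lemma gap:
  assumes bb: "\<And>t. \<bar>t - m\<bar> < d \<Longrightarrow> bounded_below t" and d: "0 < d" and x: "x \<in> V"
  shows "d * norm x \<le> norm (T x - m *\<^sub>R x)"
proof -
  interpret S: symmetric_operator V "\<lambda>x. T x - m *\<^sub>R x" by (rule shift)
  interpret L: bounded_linear "\<lambda>x. T x - m *\<^sub>R x" by (rule S.bounded_linear_T)
  define S where "S = (\<lambda>x. T x - m *\<^sub>R x)"
  define U where "U = {u \<in> V. norm u = 1}"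
  have S_scale: "S (s *\<^sub>R x) = s *\<^sub>R S x" for s x unfolding S_def by (rule L.scaleR)
  show ?thesis
  proof (cases "x = 0")
    case True then show ?thesis by (simp add: bounded_linear.linear[OF bounded_linear_T, THEN linear_0])
  next
    case x0: False
    define r where "r = (INF u\<in>U. norm (S u))"
    have U: "x /\<^sub>R norm x \<in> U" using x x0 subspace_V by (simp add: U_def subspace_scale)
    then have Une: "U \<noteq> {}" by blast
    have bdd: "bdd_below ((\<lambda>u. norm (S u)) ` U)" by (rule bdd_belowI[of _ 0]) auto
    have rU: "r \<le> norm (S u)" if "u \<in> U" for u unfolding r_def by (rule cINF_lower[OF bdd that])
    have r0: "0 \<le> r" unfolding r_def by (rule cINF_greatest[OF Une]) auto
    have rV: "r * norm v \<le> norm (S v)" if "v \<in> V" for v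
    proof (cases "v = 0")
      case False
      then have "v /\<^sub>R norm v \<in> U" using that subspace_V by (simp add: U_def subspace_scale)
      from rU[OF this] False show ?thesis by (simp add: S_scale field_simps)
    qed simp
    have "d \<le> r"
    proof (rule ccontr)
      assume "\<not> d \<le> r"
      then have "\<bar>(m + r) - m\<bar> < d" "\<bar>(m - r) - m\<bar> < d" using r0 by auto
      from this[THEN bb] obtain c1 c2 where
        c: "c1 > 0" "\<And>u. u \<in> V \<Longrightarrow> c1 * norm u \<le> norm (S u - r *\<^sub>R u)"
          "c2 > 0" "\<And>u. u \<in> V \<Longrightarrow> c2 * norm u \<le> norm (S u + r *\<^sub>R u)"
        unfolding bounded_below_def S_def by (auto simp: algebra_simps)
      define A where "A = (\<lambda>x. S (S x) - r\<^sup>2 *\<^sub>R x)"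
      interpret A: symmetric_operator V A
        unfolding A_def S_def by (intro symmetric_operator.shift S.square)
      have Aeq: "inner (A v) v = (norm (S v))\<^sup>2 - r\<^sup>2 * (norm v)\<^sup>2" if "v \<in> V" for v
      proof -
        have "inner (S (S v)) v = inner (S v) (S v)"
          unfolding S_def by (rule S.symmetric[OF S.T_in[OF that] that])
        then show ?thesis by (simp add: A_def inner_diff_left power2_norm_eq_inner)
      qed
      have Apos: "0 \<le> inner (A v) v" if "v \<in> V" for v
        using power_mono[OF rV[OF that], of 2] r0 by (simp add: Aeq[OF that] power_mult_distrib)
      obtain K where K: "K > 0" "\<And>x. norm (A x) \<le> norm x * K"
        using bounded_linear.pos_bounded[OF A.bounded_linear_T] by blast
      have Alow: "(c1 * c2)\<^sup>2 \<le> K * ((norm (S u))\<^sup>2 - r\<^sup>2)" if "u \<in> U" for u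
      proof -
        have u: "u \<in> V" "norm u = 1" using that by (auto simp: U_def)
        have w: "S u + r *\<^sub>R u \<in> V" using u S.T_in subspace_V unfolding S_def
          by (simp add: subspace_add subspace_scale)
        have "c1 * c2 \<le> c1 * norm (S u + r *\<^sub>R u)" using c(1) c(4)[OF u(1)] u(2) by simp
        also have "\<dots> \<le> norm (S (S u + r *\<^sub>R u) - r *\<^sub>R (S u + r *\<^sub>R u))" by (rule c(2)[OF w])
        also have "S (S u + r *\<^sub>R u) - r *\<^sub>R (S u + r *\<^sub>R u) = A u"
        proof -
          have "S (S u + r *\<^sub>R u) = S (S u) + r *\<^sub>R S u"
            using L.add[of "S u" "r *\<^sub>R u"] S_scale[of r u] unfolding S_def by simp
          then show ?thesis by (simp add: A_def power2_eq_square algebra_simps)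
        qed
        finally have "(c1 * c2)\<^sup>2 \<le> (norm (A u))\<^sup>2" using c by (intro power_mono) auto
        also have "\<dots> \<le> K * inner (A u) u"
          by (rule A.positive_norm_le) (use Apos K u in \<open>auto simp: mult.commute\<close>)
        finally show ?thesis using Aeq u by simp
      qed
      define e where "e = (c1 * c2)\<^sup>2 / K"
      have e: "0 < e" using c K by (simp add: e_def)
      have "sqrt (r\<^sup>2 + e) > r" using e r0 by (simp add: real_less_rsqrt)
      then obtain u where u: "u \<in> U" "norm (S u) < sqrt (r\<^sup>2 + e)"
        unfolding r_def using cINF_less_iff[OF Une bdd] by blast
      have "(norm (S u))\<^sup>2 < (sqrt (r\<^sup>2 + e))\<^sup>2" using u(2) by (intro power_strict_mono) auto
      then have "(norm (S u))\<^sup>2 - r\<^sup>2 < e" using e by simp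
      then have "K * ((norm (S u))\<^sup>2 - r\<^sup>2) < (c1 * c2)\<^sup>2"
        using K by (simp add: e_def field_simps)
      then show False using Alow[OF u(1)] by simp
    qed
    then show ?thesis using rV[OF x] norm_ge_zero[of x] unfolding S_def
      by (meson mult_right_mono order_trans)
  qed
qed

text \<open>The spectrum of \<open>T\<^sup>2\<close> avoids the interval \<open>(0, \<delta>\<^sup>2)\<close>, because \<open>T\<^sup>2 - t\<^sup>2 = (T - t) (T + t)\<close>. The gap
  lemma with midpoint \<open>m = \<delta>\<^sup>2 / 2\<close> reads \<open>\<parallel>(T\<^sup>2 - m) v\<parallel> \<ge> m \<parallel>v\<parallel>\<close>; squaring it cancels the terms in
  \<open>\<parallel>v\<parallel>\<^sup>2\<close> and leaves \<open>\<parallel>T (T v)\<parallel> \<ge> \<delta> \<parallel>T v\<parallel>\<close>. So \<open>T\<close> is bounded below on the closure of its range.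
  The orthogonal complement of that closure is the kernel, whose component of \<open>x\<close> is read off from
  the inner products with an orthogonal basis.\<close>

lemma fredholm_estimate:
  assumes bb: "\<And>t. t \<noteq> 0 \<Longrightarrow> \<bar>t\<bar> < \<delta> \<Longrightarrow> bounded_below t" and \<delta>: "0 < \<delta>"
    and B: "finite B" "\<And>x. x \<in> V \<Longrightarrow> T x = 0 \<Longrightarrow> x \<in> span B" "B \<subseteq> V" "\<And>b. b \<in> B \<Longrightarrow> T b = 0"
  shows "\<exists>C K. finite C \<and> C \<subseteq> V \<and>
    (\<forall>x\<in>V. (norm x)\<^sup>2 \<le> K * (norm (T x))\<^sup>2 + (\<Sum>c\<in>C. K * (inner x c)\<^sup>2))"
proof -
  interpret L: bounded_linear T by (rule bounded_linear_T)
  interpret Q: symmetric_operator V "\<lambda>x. T (T x)" by (rule square)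
  have bbQ: "Q.bounded_below s" if "\<bar>s - \<delta>\<^sup>2/2\<bar> < \<delta>\<^sup>2/2" for s
  proof -
    define t where "t = sqrt s"
    have s: "0 < s" "s < \<delta>\<^sup>2" using that unfolding abs_less_iff by (simp_all add: field_simps)
    then have t: "0 < t" "t < \<delta>" "s = t\<^sup>2" using \<delta> by (auto simp: t_def real_less_lsqrt)
    have "bounded_below t" "bounded_below (-t)" using bb t by auto
    then obtain c1 c2 where
        c: "c1 > 0" "\<And>u. u \<in> V \<Longrightarrow> c1 * norm u \<le> norm (T u - t *\<^sub>R u)"
          "c2 > 0" "\<And>u. u \<in> V \<Longrightarrow> c2 * norm u \<le> norm (T u + t *\<^sub>R u)"
        unfolding bounded_below_def by auto
    have "c1 * c2 * norm u \<le> norm (T (T u) - s *\<^sub>R u)" if u: "u \<in> V" for u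
    proof -
      have w: "T u + t *\<^sub>R u \<in> V" using u T_in subspace_V by (simp add: subspace_add subspace_scale)
      have "c1 * (c2 * norm u) \<le> c1 * norm (T u + t *\<^sub>R u)" using c(1) c(4)[OF u(1)] by simp
      also have "\<dots> \<le> norm (T (T u + t *\<^sub>R u) - t *\<^sub>R (T u + t *\<^sub>R u))" by (rule c(2)[OF w])
      also have "T (T u + t *\<^sub>R u) - t *\<^sub>R (T u + t *\<^sub>R u) = T (T u) - s *\<^sub>R u"
        by (simp add: L.add L.scaleR t(3) power2_eq_square algebra_simps)
      finally show ?thesis by simp
    qed
    then show ?thesis unfolding Q.bounded_below_def using c(1,3) by (metis mult_pos_pos)
  qed
  have rng: "\<delta> * norm (T v) \<le> norm (T (T v))" if v: "v \<in> V" for v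
  proof -
    have "\<delta>\<^sup>2/2 * norm v \<le> norm (T (T v) - (\<delta>\<^sup>2/2) *\<^sub>R v)"
      by (rule Q.gap[OF bbQ _ v]) (use \<delta> in auto)
    then have "(\<delta>\<^sup>2/2 * norm v)\<^sup>2 \<le> (norm (T (T v) - (\<delta>\<^sup>2/2) *\<^sub>R v))\<^sup>2"
      by (intro power_mono) auto
    also have "\<dots> = (norm (T (T v)))\<^sup>2 - \<delta>\<^sup>2 * (norm (T v))\<^sup>2 + (\<delta>\<^sup>2/2 * norm v)\<^sup>2"
      using symmetric[OF T_in[OF v] v]
      by (simp only: norm_diff_scaleR_squared flip: power2_norm_eq_inner) (simp add: power2_norm_eq_inner power_mult_distrib power_divide)
    finally have "(\<delta> * norm (T v))\<^sup>2 \<le> (norm (T (T v)))\<^sup>2" by (simp add: power_mult_distrib)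
    then show ?thesis by (rule power2_le_imp_le) simp
  qed
  define R where "R = closure (T ` V)"
  have clV: "closed V" using complete_V complete_imp_closed by blast
  have RV: "R \<subseteq> V" unfolding R_def by (rule closure_minimal) (use T_in clV in auto)
  have Rsub: "subspace R" unfolding R_def
    by (intro subspace_closure linear_subspace_image[OF L.linear subspace_V])
  have Rcomp: "complete R"
    by (rule complete_closed_subset[OF _ RV complete_V]) (auto simp: R_def)
  have R: "\<delta> * norm r \<le> norm (T r)" if "r \<in> R" for r
  proof -
    have "R \<subseteq> {r. 0 \<le> norm (T r) - \<delta> * norm r}" unfolding R_def
    proof (rule closure_minimal)
      show "closed {r. 0 \<le> norm (T r) - \<delta> * norm r}"
        by (intro closed_Collect_le continuous_intros L.continuous_on)
    qed (use rng in auto)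
    then show ?thesis using that by auto
  qed
  obtain C where C: "finite C" "span C = span B" "pairwise orthogonal C"
    using basis_orthogonal[OF B(1)] by blast
  have CV: "C \<subseteq> V" and TC: "\<And>c. c \<in> C \<Longrightarrow> T c = 0"
  proof -
    have "span B \<subseteq> V" using B(3) subspace_V by (simp add: span_minimal)
    then show "C \<subseteq> V" using C(2) span_superset by blast
    have "subspace {x. T x = 0}" by (simp add: subspace_def L.add L.scaleR)
    then have "span B \<subseteq> {x. T x = 0}" using B(4) by (intro span_minimal) auto
    then show "\<And>c. c \<in> C \<Longrightarrow> T c = 0" using C(2) span_superset by blast
  qed
  define K where "K = 1/\<delta>\<^sup>2 + (\<Sum>c\<in>C. 1 / inner c c)"
  have K1: "1/\<delta>\<^sup>2 \<le> K" unfolding K_def by (simp add: sum_nonneg)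
  have K2: "1 / inner c c \<le> K" if "c \<in> C" for c
    unfolding K_def using member_le_sum[OF that, of "\<lambda>c. 1 / inner c c"] C(1)
    by (smt (verit) inner_ge_zero zero_le_divide_1_iff zero_le_power2)
  have "(norm x)\<^sup>2 \<le> K * (norm (T x))\<^sup>2 + (\<Sum>c\<in>C. K * (inner x c)\<^sup>2)" if x: "x \<in> V" for x
  proof -
    define r where "r = proj R x"
    define s where "s = x - r"
    have rR: "r \<in> R" unfolding r_def by (rule proj_in[OF Rsub Rcomp])
    have sV: "s \<in> V" unfolding s_def using x rR RV subspace_V by (simp add: subspace_diff subset_iff)
    have sR: "inner s h = 0" if "h \<in> R" for h
      unfolding s_def r_def by (rule proj_orthogonal[OF Rsub Rcomp that])
    have "T s = 0"
    proof -
      have "T (T s) \<in> R" unfolding R_def by (rule subsetD[OF closure_subset imageI[OF T_in[OF sV]]])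
      then have "inner (T s) (T s) = 0" by (simp only: symmetric[OF sV T_in[OF sV]] sR)
      then show ?thesis by simp
    qed
    then have sC: "s \<in> span C" using B(2)[OF sV] C(2) by simp
    have xr: "inner x c = inner s c" if "c \<in> C" for c
    proof -
      have "T ` V \<subseteq> {h. inner h c = 0}" using symmetric TC[OF that] CV that by auto
      moreover have "closed {h. inner h c = 0}" by (intro closed_Collect_eq continuous_intros)
      ultimately have "R \<subseteq> {h. inner h c = 0}" unfolding R_def by (intro closure_minimal) auto
      then have "inner r c = 0" using rR by auto
      then show ?thesis by (simp add: s_def inner_diff_left)
    qed
    obtain u where u: "s = (\<Sum>c\<in>C. u c *\<^sub>R c)" using sC C(1) by (auto simp: span_finite)
    have sc: "inner s c = u c * inner c c" if "c \<in> C" for c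
    proof -
      have "inner s c = (\<Sum>d\<in>C. if d = c then u c * inner c c else 0)"
        unfolding u inner_sum_left
        by (rule sum.cong) (use C(3) that in \<open>auto simp: pairwise_def orthogonal_def\<close>)
      then show ?thesis using C(1) that by simp
    qed
    have "(norm s)\<^sup>2 = (\<Sum>c\<in>C. u c * inner s c)"
      using arg_cong[OF u, of "inner s"] by (simp add: power2_norm_eq_inner inner_sum_right)
    also have "\<dots> \<le> (\<Sum>c\<in>C. K * (inner x c)\<^sup>2)"
    proof (rule sum_mono)
      fix c assume c: "c \<in> C"
      have "u c * inner s c = 1 / inner c c * (inner s c)\<^sup>2"
        using sc[OF c] by (cases "c = 0") (auto simp: power2_eq_square)
      also have "\<dots> \<le> K * (inner s c)\<^sup>2" using K2[OF c] by (intro mult_right_mono) auto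
      finally show "u c * inner s c \<le> K * (inner x c)\<^sup>2" using xr[OF c] by simp
    qed
    finally have "(norm s)\<^sup>2 \<le> (\<Sum>c\<in>C. K * (inner x c)\<^sup>2)" .
    moreover have "(norm r)\<^sup>2 \<le> K * (norm (T x))\<^sup>2"
    proof -
      have "T r = T x" using \<open>T s = 0\<close> by (simp add: s_def L.diff)
      then have "(\<delta> * norm r)\<^sup>2 \<le> (norm (T x))\<^sup>2" using R[OF rR] \<delta> by (intro power_mono) auto
      then have "(norm r)\<^sup>2 \<le> 1/\<delta>\<^sup>2 * (norm (T x))\<^sup>2" using \<delta> by (simp add: power_mult_distrib field_simps)
      also have "\<dots> \<le> K * (norm (T x))\<^sup>2" using K1 by (intro mult_right_mono) auto
      finally show ?thesis .
    qed
    ultimately show ?thesis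
      using norm_pythagoras_proj[OF Rsub Rcomp, of x] by (simp add: r_def s_def)
  qed
  then show ?thesis using C(1) CV by blast
qed

end

section \<open>Isometries preserve Lebesgue measure\<close>

text \<open>The image measure \<open>\<nu>\<close> is translation invariant, hence proportional to Lebesgue measure \<open>\<lambda>\<close>:
  computing the integral of \<open>1\<^sub>A (x) 1\<^sub>B (x + y)\<close> in both orders gives
  \<open>\<nu> A * \<lambda> B = \<nu> B * \<lambda> A\<close>, since \<open>\<lambda>\<close> is also invariant under reflection. The factor is 1 since an isometry preserves balls about the origin, and
  these have the same volume in spaces of equal dimension. Allowing two different spaces covers
  both rotations and the identification of a product with a space of vectors.\<close>

lemma distr_lborel_isometry:
  fixes R :: "'a::euclidean_space \<Rightarrow> 'b::euclidean_space"
  assumes R: "linear R" "\<And>x. norm (R x) = norm x" "surj R" and dim: "DIM('a) = DIM('b)"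
  shows "distr lborel borel R = lborel"
proof -
  define \<nu> where "\<nu> = distr lborel borel R"
  have Rm[measurable]: "R \<in> borel \<rightarrow>\<^sub>M borel"
    using linear_continuous_on[OF linear_conv_bounded_linear[THEN iffD1, OF R(1)], of UNIV]
    by (rule borel_measurable_continuous_onI)
  have sets[measurable_cong, simp]: "sets \<nu> = sets borel" by (simp add: \<nu>_def)
  have space[simp]: "space \<nu> = UNIV" by (simp add: \<nu>_def)
  have ball: "emeasure \<nu> (ball 0 r) = emeasure lborel (ball (0::'b) r)" for r :: real
  proof -
    have "R -` ball 0 r = ball 0 r" using R(2) by auto
    then have "emeasure \<nu> (ball 0 r) = emeasure lborel (ball (0::'a) r)"
      by (simp add: \<nu>_def emeasure_distr)
    also have "\<dots> = emeasure lborel (ball (0::'b) r)"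
      by (cases "r \<ge> 0") (simp_all add: emeasure_ball dim ball_empty)
    finally show ?thesis .
  qed
  interpret \<nu>: sigma_finite_measure \<nu>
  proof (unfold_locales, intro exI conjI ballI)
    show "countable (range (\<lambda>n::nat. ball (0::'b) (real n)))" by simp
    show "range (\<lambda>n::nat. ball (0::'b) (real n)) \<subseteq> sets \<nu>" by auto
    show "\<Union> (range (\<lambda>n::nat. ball (0::'b) (real n))) = space \<nu>"
      by (auto intro: reals_Archimedean2)
    show "emeasure \<nu> a \<noteq> \<infinity>" if "a \<in> range (\<lambda>n::nat. ball (0::'b) (real n))" for a
      using that by (auto simp: ball emeasure_ball)
  qed
  interpret pair_sigma_finite \<nu> lborel ..
  have inv: "distr \<nu> borel (\<lambda>x. x + a) = \<nu>" for a
  proof -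
    obtain b where b: "R b = a" using R(3) by (metis surjD)
    have "distr \<nu> borel (\<lambda>x. x + a) = distr lborel borel ((\<lambda>x. x + a) \<circ> R)"
      unfolding \<nu>_def by (subst distr_distr) auto
    also have "(\<lambda>x. x + a) \<circ> R = R \<circ> (\<lambda>x. b + x)" by (auto simp: linear_add[OF R(1)] b add.commute)
    also have "distr lborel borel (R \<circ> (\<lambda>x. b + x)) = distr (distr lborel borel (\<lambda>x. b + x)) borel R"
      by (subst distr_distr) auto
    also have "\<dots> = \<nu>" by (simp add: \<nu>_def lborel_distr_plus)
    finally show ?thesis .
  qed
  have shift\<nu>: "(\<integral>\<^sup>+x. f (x + a) \<partial>\<nu>) = (\<integral>\<^sup>+x. f x \<partial>\<nu>)" if [measurable]: "f \<in> borel_measurable borel" for f a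
    by (subst (2) inv[of a, symmetric]) (simp add: nn_integral_distr)
  have shiftL: "(\<integral>\<^sup>+x. f (a + x) \<partial>lborel) = (\<integral>\<^sup>+x. f x \<partial>lborel)"
    if [measurable]: "f \<in> borel_measurable borel" for f :: "'b \<Rightarrow> ennreal" and a
    by (subst (2) lborel_distr_plus[of a, symmetric]) (simp add: nn_integral_distr)
  have key: "emeasure \<nu> A * emeasure lborel B = emeasure \<nu> B * emeasure lborel A"
    if [measurable]: "A \<in> sets borel" "B \<in> sets borel" for A B
  proof -
    have refl: "(\<integral>\<^sup>+y. indicator A (x - y) \<partial>lborel) = emeasure lborel A" for x
    proof -
      have "(\<integral>\<^sup>+y. indicator A (x - y) \<partial>lborel) = (\<integral>\<^sup>+y. indicator A y \<partial>(distr lborel borel (\<lambda>y. x + (-1) *\<^sub>R y)))"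
        by (subst nn_integral_distr) simp_all
      also have "distr lborel borel (\<lambda>y. x + (-1) *\<^sub>R y) = (lborel :: 'b measure)"
        using lborel_affine[of "-1" x] by (simp add: density_1)
      finally show ?thesis by simp
    qed
    have "emeasure \<nu> A * emeasure lborel B = (\<integral>\<^sup>+x. indicator A x * (\<integral>\<^sup>+y. indicator B (x + y) \<partial>lborel) \<partial>\<nu>)"
      by (subst shiftL) (simp_all add: nn_integral_multc)
    also have "\<dots> = (\<integral>\<^sup>+x. \<integral>\<^sup>+y. indicator A x * indicator B (x + y) \<partial>lborel \<partial>\<nu>)"
      by (intro nn_integral_cong nn_integral_cmult[symmetric]) simp
    also have "\<dots> = (\<integral>\<^sup>+y. \<integral>\<^sup>+x. indicator A x * indicator B (x + y) \<partial>\<nu> \<partial>lborel)"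
      by (rule Fubini'[symmetric]) simp
    also have "\<dots> = (\<integral>\<^sup>+y. \<integral>\<^sup>+x. indicator A (x - y) * indicator B x \<partial>\<nu> \<partial>lborel)"
    proof (rule nn_integral_cong)
      fix y
      show "(\<integral>\<^sup>+x. indicator A x * indicator B (x + y) \<partial>\<nu>) = (\<integral>\<^sup>+x. indicator A (x - y) * indicator B x \<partial>\<nu>)"
        using shift\<nu>[of "\<lambda>x. indicator A (x - y) * indicator B x" y] by simp
    qed
    also have "\<dots> = (\<integral>\<^sup>+x. \<integral>\<^sup>+y. indicator A (x - y) * indicator B x \<partial>lborel \<partial>\<nu>)"
      by (rule Fubini') simp
    also have "\<dots> = (\<integral>\<^sup>+x. emeasure lborel A * indicator B x \<partial>\<nu>)"
      by (intro nn_integral_cong) (subst nn_integral_multc, simp_all add: refl)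
    also have "\<dots> = emeasure \<nu> B * emeasure lborel A"
      by (subst nn_integral_cmult) (simp_all add: mult.commute)
    finally show ?thesis .
  qed
  have "\<nu> = lborel"
  proof (rule measure_eqI)
    fix A assume "A \<in> sets \<nu>"
    then have "emeasure \<nu> A * emeasure lborel (ball (0::'b) 1) = emeasure lborel A * emeasure lborel (ball (0::'b) 1)"
      using key[of A "ball 0 1"] by (simp add: ball mult.commute)
    moreover have "unit_ball_vol (real DIM('b)) \<noteq> 0"
      using unit_ball_vol_pos[of "real DIM('b)"] by linarith
    then have "emeasure lborel (ball (0::'b) 1) \<noteq> 0" "emeasure lborel (ball (0::'b) 1) \<noteq> top"
      by (auto simp: emeasure_ball)
    ultimately show "emeasure \<nu> A = emeasure lborel A"
      by (metis mult_divide_eq_ennreal)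
  qed simp
  then show ?thesis by (simp add: \<nu>_def)
qed


section \<open>Holomorphic functions of several variables\<close>

lemma norm_vector_smult: "norm (c *s (h :: complex ^ 'n)) = cmod c * norm h"
  by (simp add: norm_vec_def norm_mult L2_set_right_distrib)

lemma continuous_on_vector_smult [continuous_intros]:
  assumes "continuous_on S f" "continuous_on S g"
  shows "continuous_on S (\<lambda>x. f x *s (g x :: complex ^ 'n))"
  unfolding vector_scalar_mult_def using assms by (intro continuous_intros continuous_on_vec_lambda)

lemma linear_vector_smult_right: "linear (\<lambda>h. c *s (h :: complex ^ 'n))"
  by (rule linearI) (simp_all add: vec_eq_iff algebra_simps)

lemma linear_vector_smult_left: "linear (\<lambda>c. c *s (h :: complex ^ 'n))"
  by (rule linearI) (simp_all add: vec_eq_iff algebra_simps)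

lemma holomorphic_several_subset:
  "holomorphic_several f A \<Longrightarrow> B \<subseteq> A \<Longrightarrow> holomorphic_several f B"
  by (auto simp: holomorphic_several_def)

lemma holomorphic_several_continuous_on: "holomorphic_several f A \<Longrightarrow> continuous_on A f"
  unfolding holomorphic_several_def
  by (meson continuous_at_imp_continuous_on has_derivative_continuous)

lemma holomorphic_several_diff:
  assumes "holomorphic_several f A" "holomorphic_several g A"
  shows "holomorphic_several (\<lambda>z. f z - g z) A"
  unfolding holomorphic_several_def
proof
  fix z assume "z \<in> A"
  then obtain D E where "(f has_derivative D) (at z)" "\<forall>c h. D (c *s h) = c * D h"
    "(g has_derivative E) (at z)" "\<forall>c h. E (c *s h) = c * E h"
    using assms unfolding holomorphic_several_def by meson
  then show "\<exists>D. ((\<lambda>z. f z - g z) has_derivative D) (at z) \<and> (\<forall>c h. D (c *s h) = c * D h)"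
    by (intro exI[of _ "\<lambda>h. D h - E h"]) (auto intro: has_derivative_diff simp: algebra_simps)
qed

lemma has_field_derivative_along_line:
  fixes F :: "complex ^ 'n \<Rightarrow> complex"
  assumes "(F has_derivative D) (at (z + t *s h))" "\<And>c h. D (c *s h) = c * D h"
  shows "((\<lambda>t. F (z + t *s h)) has_field_derivative D h) (at t)"
proof -
  have "((\<lambda>t. z + t *s h) has_derivative (\<lambda>t. t *s h)) (at t)"
  proof -
    have "((\<lambda>t. z + t *s h) has_derivative (\<lambda>t. 0 + t *s h)) (at t)"
      by (rule has_derivative_add[OF has_derivative_const
            linear_imp_has_derivative[OF linear_vector_smult_left]])
    then show ?thesis by simp
  qed
  from has_derivative_compose[OF this assms(1)] show ?thesis
    by (simp add: has_field_derivative_def assms(2) mult_commute_abs)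
qed

lemma holomorphic_on_line:
  assumes "holomorphic_several F \<Omega>" "\<And>t. t \<in> S \<Longrightarrow> z + t *s h \<in> \<Omega>"
  shows "(\<lambda>t. F (z + t *s h)) holomorphic_on S"
  unfolding holomorphic_on_def
proof
  fix t assume "t \<in> S"
  then obtain D where "(F has_derivative D) (at (z + t *s h))" "\<And>c h. D (c *s h) = c * D h"
    using assms unfolding holomorphic_several_def by meson
  from has_field_derivative_along_line[OF this]
  show "(\<lambda>t. F (z + t *s h)) field_differentiable at t within S"
    using field_differentiable_at_within field_differentiable_def by blast
qed

text \<open>This is Cauchy's formula at the centre of the circle, stated with the nonnegative integral so that
  Tonelli's theorem applies to it without integrability conditions.\<close>

lemma circle_mean_bound:
  assumes "G holomorphic_on cball 0 1"
  shows "ennreal (cmod (G 0)) \<le> (\<integral>\<^sup>+x. indicator {0..1} x * ennreal (cmod (G (cis (2 * pi * x)))) \<partial>lborel)"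
proof -
  define g where "g = (\<lambda>x. G (cis (2 * pi * x)))"
  have cont: "continuous_on {0..1} g"
  proof -
    have "continuous_on {0..1} (G \<circ> (\<lambda>x. cis (2 * pi * x)))"
      by (rule continuous_on_compose[OF _ continuous_on_subset[OF holomorphic_on_imp_continuous_on[OF assms]]])
        (auto intro!: continuous_intros simp: cis_conv_exp)
    then show ?thesis by (simp add: g_def o_def)
  qed
  have "((\<lambda>u. G u / (u - 0)) has_contour_integral (2 * of_real pi * \<i> * G 0)) (circlepath 0 1)"
    by (rule Cauchy_integral_circlepath_simple[OF assms]) simp
  then have "((\<lambda>x. (2 * of_real pi * \<i>) * g x) has_integral ((2 * of_real pi * \<i>) * G 0)) {0..1}"
    unfolding has_contour_integral_def
  proof (rule has_integral_eq[rotated])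
    fix x :: real assume "x \<in> {0..1}"
    then have "vector_derivative (circlepath 0 1) (at x within {0..1}) = 2 * of_real pi * \<i> * circlepath 0 1 x"
      using vector_derivative_circlepath01[of x 0 1] by (simp add: circlepath)
    moreover have "circlepath 0 1 x = cis (2 * pi * x)"
      by (simp add: circlepath cis_conv_exp mult_ac)
    ultimately show "G (circlepath 0 1 x) / (circlepath 0 1 x - 0) * vector_derivative (circlepath 0 1) (at x within {0..1})
      = 2 * of_real pi * \<i> * g x"
      by (simp add: g_def)
  qed
  then have "((\<lambda>x. g x) has_integral G 0) {0..1}"
    by (subst (asm) has_integral_mult_right_iff) (auto)
  moreover have int: "set_integrable lborel {0..1} g"
    by (rule borel_integrable_atLeastAtMost'[OF cont])
  ultimately have eq: "(LINT x:{0..1}|lborel. g x) = G 0"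
    using set_borel_integral_eq_integral(2)[OF int] by (simp add: integral_unique)
  have "ennreal (cmod (G 0)) \<le> (\<integral>\<^sup>+x. ennreal (norm (indicator {0..1} x *\<^sub>R g x)) \<partial>lborel)"
    using integral_norm_bound_ennreal[OF int[unfolded set_integrable_def]] eq
    by (simp add: set_lebesgue_integral_def)
  also have "\<dots> = (\<integral>\<^sup>+x. indicator {0..1} x * ennreal (cmod (G (cis (2 * pi * x)))) \<partial>lborel)"
    by (intro nn_integral_cong) (auto simp: g_def indicator_def)
  finally show ?thesis .
qed

lemma distr_lborel_unit_smult:
  assumes "cmod c = 1"
  shows "distr lborel borel (\<lambda>h. c *s (h :: complex ^ 'n)) = lborel"
proof (rule distr_lborel_isometry[OF linear_vector_smult_right])
  have c: "c \<noteq> 0" using assms by auto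
  show "surj (\<lambda>h. c *s (h :: complex ^ 'n))"
    by (rule surjI[of _ "\<lambda>h. inverse c *s h"]) (use assms in \<open>auto simp: vector_smult_assoc right_inverse[OF c]\<close>)
qed (simp_all add: norm_vector_smult assms)

lemma borel_measurable_vector_smult [measurable]:
  assumes [measurable]: "f \<in> M \<rightarrow>\<^sub>M borel" "g \<in> M \<rightarrow>\<^sub>M borel"
  shows "(\<lambda>x. f x *s (g x :: complex ^ 'n)) \<in> M \<rightarrow>\<^sub>M borel"
proof -
  have "(\<lambda>p. fst p *s (snd p :: complex ^ 'n)) \<in> borel \<rightarrow>\<^sub>M borel"
    by (intro borel_measurable_continuous_onI continuous_intros)
  then have "(\<lambda>p. fst p *s (snd p :: complex ^ 'n)) \<in> borel \<Otimes>\<^sub>M borel \<rightarrow>\<^sub>M borel"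
    by (simp add: borel_prod)
  then have "(\<lambda>x. fst (f x, g x) *s (snd (f x, g x) :: complex ^ 'n)) \<in> M \<rightarrow>\<^sub>M borel"
    by (rule measurable_compose[rotated]) measurable
  then show ?thesis by simp
qed

text \<open>On each circle \<open>\<theta> \<mapsto> z + e\<^sup>i\<^sup>\<theta> h\<close> the holomorphic function \<open>F\<^sup>2\<close> has the mean value property, whence
  \<open>\<bar>F z\<bar>\<^sup>2\<close> is at most the mean of \<open>\<bar>F\<bar>\<^sup>2\<close>. Integrate over all \<open>h\<close> in a ball and exchange the integrals:
  for fixed \<open>\<theta>\<close> the rotation drops out, as it preserves the ball and Lebesgue measure.\<close>

lemma point_evaluation_bound:
  fixes F :: "complex ^ 'n \<Rightarrow> complex"
  assumes F: "holomorphic_several F (ball z r)" and [measurable]: "F \<in> borel_measurable borel"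
  shows "ennreal ((cmod (F z))\<^sup>2) * emeasure lborel (ball (0 :: complex ^ 'n) r)
    \<le> (\<integral>\<^sup>+y. ennreal ((cmod (F y))\<^sup>2) \<partial>lborel)"
proof -
  define \<Phi> where "\<Phi> y = ennreal ((cmod (F y))\<^sup>2)" for y
  have [measurable]: "\<Phi> \<in> borel_measurable borel" unfolding \<Phi>_def by measurable
  define B where "B = ball (0 :: complex ^ 'n) r"
  have [measurable]: "B \<in> sets borel" by (simp add: B_def)
  define R where "R \<theta> h = cis (2 * pi * \<theta>) *s (h :: complex ^ 'n)" for \<theta> h
  have [measurable]: "(\<lambda>\<theta>. cis (2 * pi * \<theta>)) \<in> borel_measurable borel"
    by (auto intro!: borel_measurable_continuous_onI continuous_intros simp: cis_conv_exp)
  have [measurable]: "case_prod R \<in> borel \<Otimes>\<^sub>M borel \<rightarrow>\<^sub>M borel" unfolding R_def by measurable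
  have RB: "R \<theta> h \<in> B \<longleftrightarrow> h \<in> B" for \<theta> h by (simp add: R_def B_def norm_vector_smult)
  have mean: "\<Phi> z \<le> (\<integral>\<^sup>+\<theta>. indicator {0..1} \<theta> * \<Phi> (z + R \<theta> h) \<partial>lborel)" if "h \<in> B" for h
  proof -
    have "(\<lambda>t. (F (z + t *s h))\<^sup>2) holomorphic_on cball 0 1"
    proof (intro holomorphic_intros holomorphic_on_line[OF F])
      fix t :: complex assume "t \<in> cball 0 1"
      then have "cmod t * norm h \<le> 1 * norm h" by (intro mult_right_mono) auto
      then show "z + t *s h \<in> ball z r" using that by (simp add: B_def dist_norm norm_vector_smult)
    qed
    from circle_mean_bound[OF this] show ?thesis by (simp add: \<Phi>_def R_def norm_power)
  qed
  have "\<Phi> z * emeasure lborel B = (\<integral>\<^sup>+h. indicator B h * \<Phi> z \<partial>lborel)"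
    by (subst nn_integral_multc) (simp_all add: mult.commute)
  also have "\<dots> \<le> (\<integral>\<^sup>+h. \<integral>\<^sup>+\<theta>. indicator B h * (indicator {0..1} \<theta> * \<Phi> (z + R \<theta> h)) \<partial>lborel \<partial>lborel)"
  proof (rule nn_integral_mono)
    fix h
    show "indicator B h * \<Phi> z \<le> (\<integral>\<^sup>+\<theta>. indicator B h * (indicator {0..1} \<theta> * \<Phi> (z + R \<theta> h)) \<partial>lborel)"
      using mean[of h] by (cases "h \<in> B") simp_all
  qed
  also have "\<dots> = (\<integral>\<^sup>+\<theta>. \<integral>\<^sup>+h. indicator B h * (indicator {0..1} \<theta> * \<Phi> (z + R \<theta> h)) \<partial>lborel \<partial>lborel)"
    by (rule lborel_pair.Fubini') measurable
  also have "\<dots> \<le> (\<integral>\<^sup>+\<theta>. indicator {0..1} \<theta> * (\<integral>\<^sup>+y. \<Phi> y \<partial>lborel) \<partial>(lborel :: real measure))"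
  proof (rule nn_integral_mono)
    fix \<theta> :: real
    have "(\<integral>\<^sup>+h. indicator B h * (indicator {0..1} \<theta> * \<Phi> (z + R \<theta> h)) \<partial>lborel) =
      indicator {0..1} \<theta> * (\<integral>\<^sup>+h. indicator B (R \<theta> h) * \<Phi> (z + R \<theta> h) \<partial>lborel)"
      by (subst nn_integral_cmult[symmetric])
        (auto intro!: nn_integral_cong simp: RB indicator_def)
    also have "(\<integral>\<^sup>+h. indicator B (R \<theta> h) * \<Phi> (z + R \<theta> h) \<partial>lborel) =
      (\<integral>\<^sup>+y. indicator B y * \<Phi> (z + y) \<partial>(distr lborel borel (R \<theta>)))"
      by (subst nn_integral_distr) simp_all
    also have "distr lborel borel (R \<theta>) = lborel"
      unfolding R_def by (rule distr_lborel_unit_smult) simp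
    also have "(\<integral>\<^sup>+y. indicator B y * \<Phi> (z + y) \<partial>lborel) \<le> (\<integral>\<^sup>+y. \<Phi> (z + y) \<partial>lborel)"
      by (intro nn_integral_mono) (auto simp: indicator_def)
    also have "\<dots> = (\<integral>\<^sup>+y. \<Phi> y \<partial>(distr lborel borel (\<lambda>y. z + y)))"
      by (subst nn_integral_distr) simp_all
    also have "\<dots> = (\<integral>\<^sup>+y. \<Phi> y \<partial>lborel)" by (simp only: lborel_distr_plus)
    finally show "(\<integral>\<^sup>+h. indicator B h * (indicator {0..1} \<theta> * \<Phi> (z + R \<theta> h)) \<partial>lborel)
        \<le> indicator {0..1} \<theta> * (\<integral>\<^sup>+y. \<Phi> y \<partial>lborel)"
      by (simp add: mult_left_mono)
  qed
  also have "\<dots> = (\<integral>\<^sup>+y. \<Phi> y \<partial>lborel)" by (subst nn_integral_multc) simp_all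
  finally show ?thesis by (simp add: \<Phi>_def B_def)
qed

text \<open>Cauchy's estimate for the restriction of \<open>F\<close> to the complex line through \<open>z\<close> in direction \<open>h\<close>, on the
  circle of radius \<open>s / 2\<close>.\<close>

lemma holomorphic_derivative_bound:
  fixes F :: "complex ^ 'n \<Rightarrow> complex"
  assumes F: "holomorphic_several F (ball z s)" and s: "0 < s"
    and M: "\<And>y. y \<in> ball z s \<Longrightarrow> cmod (F y) \<le> M"
    and D: "(F has_derivative D) (at z)"
  shows "cmod (D h) \<le> 2 * M / s * norm h"
proof (cases "h = 0")
  case True
  then show ?thesis using linear_0[OF has_derivative_linear[OF D]] by simp
next
  case False
  obtain E where E: "(F has_derivative E) (at z)" "\<And>c h. E (c *s h) = c * E h"
    using F s unfolding holomorphic_several_def by (meson centre_in_ball)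
  then have DE: "D = E" using D has_derivative_unique by blast
  define u where "u = h /\<^sub>R norm h"
  have u: "norm u = 1" using False by (simp add: u_def)
  have inb: "z + t *s u \<in> ball z s" if "cmod t < s" for t
    using that u by (simp add: dist_norm norm_vector_smult)
  have hol: "(\<lambda>t. F (z + t *s u)) holomorphic_on cball 0 (s/2)"
    by (rule holomorphic_on_line[OF F inb]) (use s in auto)
  have "((\<lambda>t. F (z + t *s u)) has_field_derivative D u) (at 0)"
    by (rule has_field_derivative_along_line) (use E DE in auto)
  then have "deriv (\<lambda>t. F (z + t *s u)) 0 = D u" by (rule DERIV_imp_deriv)
  moreover have "cmod ((deriv ^^ 1) (\<lambda>t. F (z + t *s u)) 0) \<le> fact 1 * M / (s/2) ^ 1"
    by (rule Cauchy_inequality)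
      (use hol s M inb in \<open>auto intro!: holomorphic_on_imp_continuous_on elim: holomorphic_on_subset\<close>)
  ultimately have "cmod (D u) \<le> 2 * M / s" by (simp add: mult.commute)
  moreover have "D u = D h /\<^sub>R norm h"
    unfolding u_def by (rule linear_cmul[OF has_derivative_linear[OF D]])
  ultimately show ?thesis using False by (simp add: field_simps)
qed

text \<open>Applied to the differences \<open>F m - F n\<close>, the previous bound makes the derivatives converge uniformly
  on a smaller ball, so the limit may be differentiated term by term.\<close>

lemma holomorphic_limit:
  fixes F :: "nat \<Rightarrow> complex ^ 'n \<Rightarrow> complex"
  assumes F: "\<And>k. holomorphic_several (F k) \<Omega>"
    and loc: "\<And>z. z \<in> \<Omega> \<Longrightarrow> \<exists>r>0. ball z r \<subseteq> \<Omega> \<and>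
      (\<forall>e>0. \<exists>N. \<forall>m\<ge>N. \<forall>n\<ge>N. \<forall>y\<in>ball z r. cmod (F m y - F n y) \<le> e)"
  shows "\<exists>f. holomorphic_several f \<Omega> \<and> (\<forall>z\<in>\<Omega>. (\<lambda>k. F k z) \<longlonglongrightarrow> f z)"
proof -
  have "\<exists>F'. \<forall>k. \<forall>x\<in>\<Omega>. (F k has_derivative F' k x) (at x) \<and> (\<forall>c h. F' k x (c *s h) = c * F' k x h)"
    using F unfolding holomorphic_several_def by metis
  then obtain F' where F': "\<And>k x. x \<in> \<Omega> \<Longrightarrow> (F k has_derivative F' k x) (at x)"
    "\<And>k x c h. x \<in> \<Omega> \<Longrightarrow> F' k x (c *s h) = c * F' k x h" by blast
  define f where "f x = lim (\<lambda>k. F k x)" for x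
  have limit: "(\<lambda>k. F k z) \<longlonglongrightarrow> f z \<and> (\<exists>D. (f has_derivative D) (at z) \<and> (\<forall>c h. D (c *s h) = c * D h))"
    if z: "z \<in> \<Omega>" for z
  proof -
    obtain r where r: "r > 0" "ball z r \<subseteq> \<Omega>"
      and cau: "\<And>e. e > 0 \<Longrightarrow> \<exists>N. \<forall>m\<ge>N. \<forall>n\<ge>N. \<forall>y\<in>ball z r. cmod (F m y - F n y) \<le> e"
      using loc[OF z] by blast
    define S where "S = ball z (r/2)"
    have Sr: "ball x (r/2) \<subseteq> ball z r" if "x \<in> S" for x
      using that by (auto simp: S_def dist_commute) (smt (verit) dist_commute dist_triangle field_sum_of_halves)
    have S\<Omega>: "x \<in> \<Omega>" if "x \<in> S" for x using that r by (force simp: S_def)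
    have cau': "\<exists>N. \<forall>m\<ge>N. \<forall>n\<ge>N. \<forall>x\<in>S. \<forall>h. cmod (F' m x h - F' n x h) \<le> e * norm h" if e: "e > 0" for e
    proof -
      obtain N where N: "\<And>m n y. m \<ge> N \<Longrightarrow> n \<ge> N \<Longrightarrow> y \<in> ball z r \<Longrightarrow> cmod (F m y - F n y) \<le> e * r / 4"
      proof -
        have "0 < e * r / 4" using e r by simp
        from cau[OF this] that show thesis by blast
      qed
      have "cmod (F' m x h - F' n x h) \<le> e * norm h" if "m \<ge> N" "n \<ge> N" "x \<in> S" for m n x h
      proof -
        have "cmod (F' m x h - F' n x h) \<le> 2 * (e * r / 4) / (r/2) * norm h"
        proof (rule holomorphic_derivative_bound[where F = "\<lambda>y. F m y - F n y" and z = x])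
          show "holomorphic_several (\<lambda>y. F m y - F n y) (ball x (r/2))"
            by (rule holomorphic_several_subset[OF holomorphic_several_diff[OF F F]])
              (use Sr[OF that(3)] r in auto)
          show "((\<lambda>y. F m y - F n y) has_derivative (\<lambda>h. F' m x h - F' n x h)) (at x)"
            by (intro has_derivative_diff F' S\<Omega> that)
          fix y assume "y \<in> ball x (r/2)"
          then show "cmod (F m y - F n y) \<le> e * r / 4" using N Sr that by blast
        qed (use r in auto)
        then show ?thesis using r by simp
      qed
      then show ?thesis by blast
    qed
    define g' where "g' x h = lim (\<lambda>k. F' k x h)" for x h
    have g': "(\<lambda>k. F' k x h) \<longlonglongrightarrow> g' x h" if x: "x \<in> S" for x h
    proof -
      have "Cauchy (\<lambda>k. F' k x h)"
      proof (rule CauchyI)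
        fix e :: real assume e: "0 < e"
        obtain N where N: "\<And>m n. m \<ge> N \<Longrightarrow> n \<ge> N \<Longrightarrow> cmod (F' m x h - F' n x h) \<le> e / (norm h + 1) * norm h"
        proof -
          have "0 < e / (norm h + 1)" using e by (simp add: add_nonneg_pos)
          from cau'[OF this] x that show thesis by blast
        qed
        have "e / (norm h + 1) * norm h < e / (norm h + 1) * (norm h + 1)"
          using e by (intro mult_strict_left_mono) (auto simp: add_nonneg_pos)
        also have "\<dots> = e" by (simp add: add_nonneg_eq_0_iff)
        finally have "e / (norm h + 1) * norm h < e" .
        then show "\<exists>M. \<forall>m\<ge>M. \<forall>n\<ge>M. norm (F' m x h - F' n x h) < e" using N by fastforce
      qed
      then show ?thesis unfolding g'_def by (simp add: Cauchy_convergent_iff convergent_LIMSEQ_iff)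
    qed
    have unif: "\<forall>\<^sub>F n in sequentially. \<forall>x\<in>S. \<forall>h. cmod (F' n x h - g' x h) \<le> e * norm h" if "e > 0" for e
    proof -
      obtain N where N: "\<forall>m\<ge>N. \<forall>n\<ge>N. \<forall>x\<in>S. \<forall>h. cmod (F' m x h - F' n x h) \<le> e * norm h"
        using cau' \<open>e > 0\<close> by blast
      have "cmod (F' n x h - g' x h) \<le> e * norm h" if "n \<ge> N" "x \<in> S" for n x h
      proof (rule LIMSEQ_le_const2)
        show "(\<lambda>m. cmod (F' n x h - F' m x h)) \<longlonglongrightarrow> cmod (F' n x h - g' x h)"
          by (intro tendsto_intros g' that)
      qed (use N that in blast)
      then show ?thesis unfolding eventually_sequentially by blast
    qed
    have openS: "open S" by (simp add: S_def)
    have zS: "z \<in> S" using r by (simp add: S_def)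
    have conv: "(\<lambda>k. F k x) \<longlonglongrightarrow> f x" if "x \<in> S" for x
    proof -
      have "Cauchy (\<lambda>k. F k x)"
      proof (rule CauchyI)
        fix e :: real assume "0 < e"
        have "x \<in> ball z r" using that r by (auto simp: S_def)
        moreover obtain N where "\<forall>m\<ge>N. \<forall>n\<ge>N. \<forall>y\<in>ball z r. cmod (F m y - F n y) \<le> e/2"
          using cau[of "e/2"] \<open>0 < e\<close> by auto
        ultimately show "\<exists>M. \<forall>m\<ge>M. \<forall>n\<ge>M. norm (F m x - F n x) < e"
          using \<open>0 < e\<close> by (intro exI[of _ N]) fastforce
      qed
      then show ?thesis unfolding f_def by (simp add: Cauchy_convergent_iff convergent_LIMSEQ_iff)
    qed
    have "\<exists>g. \<forall>x\<in>S. (\<lambda>n. F n x) \<longlonglongrightarrow> g x \<and> (g has_derivative g' x) (at x within S)"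
    proof (rule has_derivative_sequence[where ?x0.0 = z and l = "f z"])
      show "convex S" by (simp add: S_def)
      fix n x assume "x \<in> S"
      then show "(F n has_derivative F' n x) (at x within S)"
        by (rule has_derivative_at_withinI[OF F'(1)[OF S\<Omega>]])
    qed (use unif zS conv[OF zS] in auto)
    then obtain g where g: "\<And>x. x \<in> S \<Longrightarrow> (\<lambda>n. F n x) \<longlonglongrightarrow> g x"
      "\<And>x. x \<in> S \<Longrightarrow> (g has_derivative g' x) (at x within S)" by blast
    have dg: "(g has_derivative g' z) (at z)"
      using g(2)[OF zS] by (simp only: at_within_open[OF zS openS])
    have gf: "g x = f x" if "x \<in> S" for x by (rule LIMSEQ_unique[OF g(1)[OF that] conv[OF that]])
    have "(f has_derivative g' z) (at z)"
      by (rule has_derivative_transform_within_open[OF dg openS zS gf])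
    moreover have "g' z (c *s h) = c * g' z h" for c h
    proof (rule LIMSEQ_unique)
      show "(\<lambda>k. F' k z (c *s h)) \<longlonglongrightarrow> g' z (c *s h)" by (rule g'[OF zS])
      show "(\<lambda>k. F' k z (c *s h)) \<longlonglongrightarrow> c * g' z h"
        unfolding F'(2)[OF z] by (intro tendsto_intros g'[OF zS])
    qed
    ultimately show ?thesis using conv[OF zS] by blast
  qed
  show ?thesis unfolding holomorphic_several_def using limit by blast
qed


section \<open>An inner product space of continuous square integrable functions\<close>

lemma open_polydisc: "open (polydisc :: (complex ^ 'n) set)"
proof -
  have "polydisc = (\<Inter>i. (\<lambda>z :: complex ^ 'n. z $ i) -` ball 0 1)" by (auto simp: polydisc_def)
  also have "open \<dots>"
    by (intro open_INT ballI open_vimage continuous_intros) auto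
  finally show ?thesis .
qed

lemma polydisc_borel [measurable]: "polydisc \<in> sets borel"
  by (rule borel_open[OF open_polydisc])

lemma cnj_borel_measurable [measurable]: "cnj \<in> borel_measurable borel"
  by (intro borel_measurable_continuous_onI continuous_intros)

lemma zero_outside_borel_measurable:
  fixes f :: "complex ^ 'n \<Rightarrow> complex"
  assumes "continuous_on polydisc f" "\<And>z. z \<notin> polydisc \<Longrightarrow> f z = 0"
  shows "f \<in> borel_measurable borel"
proof -
  have "(\<lambda>z. indicator polydisc z *\<^sub>R f z) \<in> borel_measurable borel"
    by (rule borel_measurable_continuous_on_indicator[OF polydisc_borel assms(1)])
  moreover have "(\<lambda>z. indicator polydisc z *\<^sub>R f z) = f" using assms(2) by (auto simp: indicator_def)
  ultimately show ?thesis by simp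
qed

definition disc_L2 :: "(complex ^ 'n \<Rightarrow> complex) \<Rightarrow> bool" where
  "disc_L2 f \<longleftrightarrow> continuous_on polydisc f \<and> (\<forall>z. z \<notin> polydisc \<longrightarrow> f z = 0) \<and>
     integrable lborel (\<lambda>z. (cmod (f z))\<^sup>2)"

lemma disc_L2_borel: "disc_L2 f \<Longrightarrow> f \<in> borel_measurable borel"
  unfolding disc_L2_def by (blast intro: zero_outside_borel_measurable)

lemma disc_L2_integrable_product:
  assumes f: "disc_L2 f" and g: "disc_L2 g"
  shows "integrable lborel (\<lambda>z. f z * cnj (g z))"
proof (rule Bochner_Integration.integrable_bound)
  note [measurable] = disc_L2_borel[OF f] disc_L2_borel[OF g]
  show "integrable lborel (\<lambda>z. (cmod (f z))\<^sup>2 + (cmod (g z))\<^sup>2)"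
    using f g by (auto simp: disc_L2_def)
  show "(\<lambda>z. f z * cnj (g z)) \<in> borel_measurable lborel" by measurable
  show "AE z in lborel. norm (f z * cnj (g z)) \<le> norm ((cmod (f z))\<^sup>2 + (cmod (g z))\<^sup>2)"
  proof (rule AE_I2)
    fix z
    have "2 * (cmod (f z) * cmod (g z)) \<le> (cmod (f z))\<^sup>2 + (cmod (g z))\<^sup>2"
      using sum_squares_bound[of "cmod (f z)" "cmod (g z)"] by simp
    moreover have "0 \<le> cmod (f z) * cmod (g z)" by simp
    ultimately have "cmod (f z) * cmod (g z) \<le> (cmod (f z))\<^sup>2 + (cmod (g z))\<^sup>2" by linarith
    then show "norm (f z * cnj (g z)) \<le> norm ((cmod (f z))\<^sup>2 + (cmod (g z))\<^sup>2)"
      by (simp add: norm_mult)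
  qed
qed

lemma disc_L2_0: "disc_L2 (\<lambda>_. 0)" by (simp add: disc_L2_def)

lemma disc_L2_add:
  assumes f: "disc_L2 f" and g: "disc_L2 g"
  shows "disc_L2 (\<lambda>z. f z + g z)"
  unfolding disc_L2_def
proof (intro conjI)
  note [measurable] = disc_L2_borel[OF f] disc_L2_borel[OF g]
  show "continuous_on polydisc (\<lambda>z. f z + g z)"
    using f g by (auto simp: disc_L2_def intro: continuous_intros)
  show "\<forall>z. z \<notin> polydisc \<longrightarrow> f z + g z = 0" using f g by (auto simp: disc_L2_def)
  show "integrable lborel (\<lambda>z. (cmod (f z + g z))\<^sup>2)"
  proof (rule Bochner_Integration.integrable_bound)
    show "integrable lborel (\<lambda>z. 2 * (cmod (f z))\<^sup>2 + 2 * (cmod (g z))\<^sup>2)"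
      using f g by (auto simp: disc_L2_def)
    show "(\<lambda>z. (cmod (f z + g z))\<^sup>2) \<in> borel_measurable lborel" by measurable
    show "AE z in lborel. norm ((cmod (f z + g z))\<^sup>2) \<le> norm (2 * (cmod (f z))\<^sup>2 + 2 * (cmod (g z))\<^sup>2)"
    proof (rule AE_I2)
      fix z
      have "(cmod (f z + g z))\<^sup>2 \<le> (cmod (f z) + cmod (g z))\<^sup>2"
        by (intro power_mono norm_triangle_ineq) auto
      also have "\<dots> \<le> 2 * (cmod (f z))\<^sup>2 + 2 * (cmod (g z))\<^sup>2"
        using sum_squares_bound[of "cmod (f z)" "cmod (g z)"] by (simp add: power2_sum)
      finally show "norm ((cmod (f z + g z))\<^sup>2) \<le> norm (2 * (cmod (f z))\<^sup>2 + 2 * (cmod (g z))\<^sup>2)"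
        by simp
    qed
  qed
qed

lemma disc_L2_mult:
  assumes f: "disc_L2 f" and a: "continuous_on polydisc a" "\<And>z. z \<in> polydisc \<Longrightarrow> cmod (a z) \<le> K"
  shows "disc_L2 (\<lambda>z. a z * f z)"
  unfolding disc_L2_def
proof (intro conjI)
  show cont: "continuous_on polydisc (\<lambda>z. a z * f z)"
    using f a by (auto simp: disc_L2_def intro: continuous_intros)
  show zero: "\<forall>z. z \<notin> polydisc \<longrightarrow> a z * f z = 0" using f by (auto simp: disc_L2_def)
  have [measurable]: "(\<lambda>z. a z * f z) \<in> borel_measurable borel"
    using zero_outside_borel_measurable[OF cont] zero by blast
  show "integrable lborel (\<lambda>z. (cmod (a z * f z))\<^sup>2)"
  proof (rule Bochner_Integration.integrable_bound)
    show "integrable lborel (\<lambda>z. K\<^sup>2 * (cmod (f z))\<^sup>2)"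
      using f by (auto simp: disc_L2_def)
    show "(\<lambda>z. (cmod (a z * f z))\<^sup>2) \<in> borel_measurable lborel" by measurable
    show "AE z in lborel. norm ((cmod (a z * f z))\<^sup>2) \<le> norm (K\<^sup>2 * (cmod (f z))\<^sup>2)"
    proof (rule AE_I2)
      fix z
      show "norm ((cmod (a z * f z))\<^sup>2) \<le> norm (K\<^sup>2 * (cmod (f z))\<^sup>2)"
      proof (cases "z \<in> polydisc")
        case True
        then have "(cmod (a z))\<^sup>2 \<le> K\<^sup>2" by (intro power_mono a) auto
        then show ?thesis by (simp add: norm_mult power_mult_distrib mult_right_mono)
      qed (use f in \<open>simp add: disc_L2_def\<close>)
    qed
  qed
qed

lemma disc_L2_cmult: "disc_L2 f \<Longrightarrow> disc_L2 (\<lambda>z. c * f z)"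
  by (rule disc_L2_mult[where K = "cmod c"]) auto

text \<open>Continuity makes the \<open>L\<^sup>2\<close> seminorm a norm without passing to classes modulo null sets, and the value
  \<open>0\<close> outside the polydisc makes equality of elements equality on the polydisc.\<close>

typedef (overloaded) ('n :: finite) disc_fun = "{f :: complex ^ 'n \<Rightarrow> complex. disc_L2 f}"
  morphisms fn disc_fun
  using disc_L2_0 by blast

setup_lifting type_definition_disc_fun

lemma disc_L2_fn [simp]: "disc_L2 (fn x)"
  using fn[of x] by simp

lemma fn_borel [measurable]: "fn x \<in> borel_measurable borel"
  by (rule disc_L2_borel) simp

lemma fn_outside: "z \<notin> polydisc \<Longrightarrow> fn x z = 0"
  using disc_L2_fn[of x] by (simp add: disc_L2_def)

lemma fn_continuous_on: "continuous_on polydisc (fn x)"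
  using disc_L2_fn[of x] by (simp add: disc_L2_def)

lemma fn_integrable_square: "integrable lborel (\<lambda>z. (cmod (fn x z))\<^sup>2)"
  using disc_L2_fn[of x] by (simp add: disc_L2_def)

lemma fn_integrable: "integrable lborel (\<lambda>z. fn x z * cnj (fn y z))"
  by (rule disc_L2_integrable_product) auto

lemma disc_fun_eqI: "(\<And>z. z \<in> polydisc \<Longrightarrow> fn x z = fn y z) \<Longrightarrow> x = y"
  by (metis fn_inject fn_outside ext)

text \<open>The inner product of the type is the real part of this one, which makes the type an instance of
  \<open>real_inner\<close>. The imaginary part is recovered by multiplying one argument by \<open>\<i>\<close>, see
  \<open>cinner_eq_inner\<close> below.\<close>

definition cinner :: "'n::finite disc_fun \<Rightarrow> 'n disc_fun \<Rightarrow> complex" where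
  "cinner x y = (LINT z|lborel. fn x z * cnj (fn y z))"

instantiation disc_fun :: (finite) real_vector
begin

lift_definition zero_disc_fun :: "'a disc_fun" is "\<lambda>_. 0" by (rule disc_L2_0)
lift_definition plus_disc_fun :: "'a disc_fun \<Rightarrow> 'a disc_fun \<Rightarrow> 'a disc_fun"
  is "\<lambda>f g z. f z + g z" by (rule disc_L2_add)
lift_definition uminus_disc_fun :: "'a disc_fun \<Rightarrow> 'a disc_fun"
  is "\<lambda>f z. - f z" using disc_L2_cmult[of _ "-1"] by simp
lift_definition minus_disc_fun :: "'a disc_fun \<Rightarrow> 'a disc_fun \<Rightarrow> 'a disc_fun"
  is "\<lambda>f g z. f z - g z" using disc_L2_add disc_L2_cmult[of _ "-1"] by fastforce
lift_definition scaleR_disc_fun :: "real \<Rightarrow> 'a disc_fun \<Rightarrow> 'a disc_fun"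
  is "\<lambda>r f z. of_real r * f z" by (rule disc_L2_cmult)

instance
proof
  fix x y z :: "'a disc_fun" and a b :: real
  show "x + y + z = x + (y + z)" by transfer (simp add: add.assoc)
  show "x + y = y + x" by transfer (simp add: add.commute)
  show "0 + x = x" by transfer simp
  show "- x + x = 0" by transfer simp
  show "x - y = x + - y" by transfer simp
  show "a *\<^sub>R (x + y) = a *\<^sub>R x + a *\<^sub>R y" by transfer (simp add: distrib_left)
  show "(a + b) *\<^sub>R x = a *\<^sub>R x + b *\<^sub>R x" by transfer (simp add: distrib_right)
  show "a *\<^sub>R b *\<^sub>R x = (a * b) *\<^sub>R x" by transfer (simp add: mult.assoc)
  show "1 *\<^sub>R x = x" by transfer simp
qed

end

instantiation disc_fun :: (finite) real_inner
begin

definition inner_disc_fun :: "'a disc_fun \<Rightarrow> 'a disc_fun \<Rightarrow> real" where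
  "inner_disc_fun x y = Re (cinner x y)"
definition norm_disc_fun :: "'a disc_fun \<Rightarrow> real" where
  "norm_disc_fun x = sqrt (inner x x)"
definition dist_disc_fun :: "'a disc_fun \<Rightarrow> 'a disc_fun \<Rightarrow> real" where
  "dist_disc_fun x y = norm (x - y)"
definition sgn_disc_fun :: "'a disc_fun \<Rightarrow> 'a disc_fun" where
  "sgn_disc_fun x = x /\<^sub>R norm x"
definition uniformity_disc_fun :: "('a disc_fun \<times> 'a disc_fun) filter" where
  "uniformity_disc_fun = (INF e\<in>{0<..}. principal {(x, y). dist x y < e})"
definition open_disc_fun :: "'a disc_fun set \<Rightarrow> bool" where
  "open_disc_fun U = (\<forall>x\<in>U. eventually (\<lambda>(x', y). x' = x \<longrightarrow> y \<in> U) uniformity)"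

instance
proof
  fix x y z :: "'a disc_fun" and r :: real
  show "sgn x = x /\<^sub>R norm x" by (rule sgn_disc_fun_def)
  show "dist x y = norm (x - y)" by (rule dist_disc_fun_def)
  show "(uniformity :: ('a disc_fun \<times> 'a disc_fun) filter) = (INF e\<in>{0<..}. principal {(x, y). dist x y < e})"
    by (rule uniformity_disc_fun_def)
  show "open U = (\<forall>x\<in>U. \<forall>\<^sub>F (x', y) in uniformity. x' = x \<longrightarrow> y \<in> U)" for U :: "'a disc_fun set"
    by (rule open_disc_fun_def)
  show "norm x = sqrt (inner x x)" by (rule norm_disc_fun_def)
  have "cinner y x = cnj (cinner x y)"
    unfolding cinner_def using Bochner_Integration.integral_cnj[of lborel "\<lambda>z. fn x z * cnj (fn y z)"]
    by (simp add: mult.commute)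
  then show "inner x y = inner y x" by (simp add: inner_disc_fun_def)
  have "cinner (x + y) z = cinner x z + cinner y z"
    unfolding cinner_def plus_disc_fun.rep_eq distrib_right
    by (intro Bochner_Integration.integral_add fn_integrable)
  then show "inner (x + y) z = inner x z + inner y z" by (simp add: inner_disc_fun_def)
  have "cinner (r *\<^sub>R x) y = of_real r * cinner x y"
    unfolding cinner_def scaleR_disc_fun.rep_eq mult.assoc by simp
  then show "inner (r *\<^sub>R x) y = r * inner x y" by (simp add: inner_disc_fun_def)
  have "cinner x x = of_real (LINT z|lborel. (cmod (fn x z))\<^sup>2)"
    unfolding cinner_def by (simp add: complex_norm_square[symmetric] del: of_real_power)
  then have sq: "inner x x = (LINT z|lborel. (cmod (fn x z))\<^sup>2)" by (simp add: inner_disc_fun_def)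
  show "0 \<le> inner x x" unfolding sq by simp
  show "inner x x = 0 \<longleftrightarrow> x = 0"
  proof
    assume "inner x x = 0"
    then have "AE z in lborel. (cmod (fn x z))\<^sup>2 = 0"
      unfolding sq by (subst (asm) integral_nonneg_eq_0_iff_AE[OF fn_integrable_square]) auto
    then have AE: "AE z in lborel. fn x z = 0" by simp
    define U where "U = {z \<in> polydisc. fn x z \<noteq> 0}"
    have "open U"
    proof -
      have "U = fn x -` (- {0}) \<inter> polydisc" by (auto simp: U_def)
      also have "open \<dots>"
        using fn_continuous_on[of x] open_Compl[OF closed_singleton[of "0 :: complex"]]
        unfolding continuous_on_open_vimage[OF open_polydisc] by blast
      finally show ?thesis .
    qed
    have "U = {}"
    proof (rule ccontr)
      assume "U \<noteq> {}"
      have "U \<in> null_sets lborel"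
      proof (rule AE_iff_null_sets[THEN iffD2])
        show "U \<in> sets lborel" using \<open>open U\<close> by simp
        show "AE z in lborel. z \<notin> U" using AE by eventually_elim (simp add: U_def)
      qed
      then have "negligible U"
        using null_sets_completionI negligible_iff_null_sets by blast
      then show False using open_not_negligible \<open>open U\<close> \<open>U \<noteq> {}\<close> by blast
    qed
    then have "fn x z = 0" for z
      using fn_outside[of z x] by (cases "z \<in> polydisc") (auto simp: U_def)
    then show "x = 0" by (intro disc_fun_eqI) (simp add: zero_disc_fun.rep_eq)
  next
    assume "x = 0"
    then show "inner x x = 0" unfolding sq by (simp add: zero_disc_fun.rep_eq)
  qed
qed

end

lemmas fn_simps = zero_disc_fun.rep_eq plus_disc_fun.rep_eq uminus_disc_fun.rep_eq
  minus_disc_fun.rep_eq scaleR_disc_fun.rep_eq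

lemma norm_square_integral: "(norm x)\<^sup>2 = (LINT z|lborel. (cmod (fn x z))\<^sup>2)"
proof -
  have "cinner x x = of_real (LINT z|lborel. (cmod (fn x z))\<^sup>2)"
    unfolding cinner_def by (simp add: complex_norm_square[symmetric] del: of_real_power)
  then show ?thesis by (simp add: power2_norm_eq_inner inner_disc_fun_def)
qed

lemma norm_square_nn_integral: "ennreal ((norm x)\<^sup>2) = (\<integral>\<^sup>+z. ennreal ((cmod (fn x z))\<^sup>2) \<partial>lborel)"
  unfolding norm_square_integral by (rule nn_integral_eq_integral[symmetric]) (auto intro: fn_integrable_square)

lemma norm_le_of_pointwise:
  assumes "\<And>z. z \<in> polydisc \<Longrightarrow> cmod (fn x z) \<le> K * cmod (fn y z)" "0 \<le> K"
  shows "norm x \<le> K * norm y"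
proof -
  have "(norm x)\<^sup>2 \<le> (LINT z|lborel. K\<^sup>2 * (cmod (fn y z))\<^sup>2)"
    unfolding norm_square_integral
  proof (rule integral_mono)
    show "integrable lborel (\<lambda>z. K\<^sup>2 * (cmod (fn y z))\<^sup>2)"
      by (intro integrable_mult_right fn_integrable_square)
    fix z
    show "(cmod (fn x z))\<^sup>2 \<le> K\<^sup>2 * (cmod (fn y z))\<^sup>2"
      using power_mono[OF assms(1), of z 2] fn_outside[of z x]
      by (cases "z \<in> polydisc") (auto simp: power_mult_distrib)
  qed (rule fn_integrable_square)
  also have "\<dots> = (K * norm y)\<^sup>2" by (simp add: norm_square_integral power_mult_distrib)
  finally show ?thesis by (rule power2_le_imp_le) (use assms(2) in simp)
qed

section \<open>Multiplication operators\<close>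

definition multiplier :: "(complex ^ 'n \<Rightarrow> complex) \<Rightarrow> bool" where
  "multiplier a \<longleftrightarrow> continuous_on polydisc a \<and> (\<exists>K\<ge>0. \<forall>z\<in>polydisc. cmod (a z) \<le> K)"

definition mul :: "(complex ^ 'n \<Rightarrow> complex) \<Rightarrow> 'n::finite disc_fun \<Rightarrow> 'n disc_fun" where
  "mul a x = disc_fun (\<lambda>z. a z * fn x z)"

lemma fn_mul: "multiplier a \<Longrightarrow> fn (mul a x) = (\<lambda>z. a z * fn x z)"
  unfolding mul_def multiplier_def
  by (rule disc_fun_inverse) (auto intro: disc_L2_mult)

lemma multiplier_const [simp]: "multiplier (\<lambda>_. c)"
  unfolding multiplier_def by (auto intro!: exI[of _ "cmod c"])

lemma multiplier_cnj: "multiplier a \<Longrightarrow> multiplier (\<lambda>z. cnj (a z))"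
  unfolding multiplier_def by (auto intro: continuous_intros)

lemma norm_mul_le:
  assumes "multiplier a" "\<And>z. z \<in> polydisc \<Longrightarrow> cmod (a z) \<le> K" "0 \<le> K"
  shows "norm (mul a x) \<le> K * norm x"
  by (rule norm_le_of_pointwise) (auto simp: fn_mul assms norm_mult intro!: mult_right_mono)

lemma bounded_linear_mul:
  assumes "multiplier a"
  shows "bounded_linear (mul a)"
proof -
  obtain K where K: "K \<ge> 0" "\<And>z. z \<in> polydisc \<Longrightarrow> cmod (a z) \<le> K"
    using assms unfolding multiplier_def by blast
  show ?thesis
  proof (rule bounded_linear_intro)
    show "mul a (x + y) = mul a x + mul a y" for x y
      by (rule disc_fun_eqI) (simp add: fn_mul[OF assms] fn_simps distrib_left)
    show "mul a (r *\<^sub>R x) = r *\<^sub>R mul a x" for r x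
      by (rule disc_fun_eqI) (simp add: fn_mul[OF assms] fn_simps)
    show "norm (mul a x) \<le> norm x * K" for x
      using norm_mul_le[OF assms K(2) K(1)] by (simp add: mult.commute)
  qed
qed

lemma cinner_mul: "multiplier a \<Longrightarrow> cinner (mul a x) y = cinner x (mul (\<lambda>z. cnj (a z)) y)"
  by (simp add: cinner_def fn_mul multiplier_cnj mult_ac)

lemma inner_mul: "multiplier a \<Longrightarrow> inner (mul a x) y = inner x (mul (\<lambda>z. cnj (a z)) y)"
  by (simp add: inner_disc_fun_def cinner_mul)

lemma mul_mul_commute: "multiplier a \<Longrightarrow> multiplier b \<Longrightarrow> mul a (mul b x) = mul b (mul a x)"
  by (rule disc_fun_eqI) (simp add: fn_mul)

lemma cinner_eq_inner: "cinner x y = Complex (inner x y) (inner x (mul (\<lambda>_. \<i>) y))"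
proof -
  have "cinner x (mul (\<lambda>_. \<i>) y) = (LINT z|lborel. - \<i> * (fn x z * cnj (fn y z)))"
    by (simp add: cinner_def fn_mul mult_ac)
  also have "\<dots> = - \<i> * cinner x y" unfolding cinner_def by (rule integral_mult_right_zero)
  finally have "cinner x (mul (\<lambda>_. \<i>) y) = - \<i> * cinner x y" .
  then show ?thesis by (simp add: complex_eq_iff inner_disc_fun_def)
qed

section \<open>The Bergman space is complete\<close>

definition hol :: "'n::finite disc_fun set" where
  "hol = {x. holomorphic_several (fn x) polydisc}"

lemma subspace_hol: "subspace hol"
proof -
  have lin: "holomorphic_several (\<lambda>z. a * f z + b * g z) polydisc"
    if fg: "holomorphic_several f polydisc" "holomorphic_several g polydisc" for f g :: "complex ^ 'a \<Rightarrow> complex" and a b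
    unfolding holomorphic_several_def
  proof
    fix z :: "complex ^ 'a" assume "z \<in> polydisc"
    then obtain D E where "(f has_derivative D) (at z)" "\<forall>c h. D (c *s h) = c * D h"
      "(g has_derivative E) (at z)" "\<forall>c h. E (c *s h) = c * E h"
      using fg unfolding holomorphic_several_def by meson
    then show "\<exists>D. ((\<lambda>z. a * f z + b * g z) has_derivative D) (at z) \<and> (\<forall>c h. D (c *s h) = c * D h)"
      by (intro exI[of _ "\<lambda>h. a * D h + b * E h"])
        (auto intro!: has_derivative_add has_derivative_mult_right simp: algebra_simps)
  qed
  show ?thesis
  proof (rule subspaceI)
    show "0 \<in> hol"
      unfolding hol_def holomorphic_several_def by (auto simp: fn_simps intro!: exI[of _ "\<lambda>_. 0"])
    show "x + y \<in> hol" if "x \<in> hol" "y \<in> hol" for x y :: "'a disc_fun"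
      using lin[of "fn x" "fn y" 1 1] that by (simp add: hol_def fn_simps)
    show "c *\<^sub>R x \<in> hol" if "x \<in> hol" for c and x :: "'a disc_fun"
      using lin[of "fn x" "fn x" "of_real c" 0] that by (simp add: hol_def fn_simps)
  qed
qed

lemma mul_const_hol:
  assumes "x \<in> hol"
  shows "mul (\<lambda>_. c) x \<in> hol"
  unfolding hol_def holomorphic_several_def mem_Collect_eq
proof
  fix z :: "complex ^ 'a" assume "z \<in> polydisc"
  then obtain D where "(fn x has_derivative D) (at z)" "\<forall>c h. D (c *s h) = c * D h"
    using assms unfolding hol_def holomorphic_several_def by blast
  then show "\<exists>D. (fn (mul (\<lambda>_. c) x) has_derivative D) (at z) \<and> (\<forall>c h. D (c *s h) = c * D h)"
    by (intro exI[of _ "\<lambda>h. c * D h"]) (auto simp: fn_mul intro!: has_derivative_mult_right)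
qed

lemma cinner_eq_0_hol:
  assumes "\<And>h. h \<in> hol \<Longrightarrow> inner x h = 0" "h \<in> hol"
  shows "cinner x h = 0"
  using assms(1)[OF assms(2)] assms(1)[OF mul_const_hol[OF assms(2)]]
  by (simp add: cinner_eq_inner complex_eq_iff)

text \<open>Used twice below: to see that the pointwise limit of an \<open>L\<^sup>2\<close> Cauchy sequence is square integrable, and
  that it is also the limit in norm.\<close>

lemma fatou_square:
  fixes F :: "nat \<Rightarrow> 'a \<Rightarrow> complex"
  assumes [measurable]: "\<And>k. F k \<in> borel_measurable M"
    and lim: "\<And>z. (\<lambda>k. F k z) \<longlonglongrightarrow> f z"
    and le: "\<And>k. k \<ge> N \<Longrightarrow> (\<integral>\<^sup>+z. ennreal ((cmod (F k z))\<^sup>2) \<partial>M) \<le> C"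
  shows "(\<integral>\<^sup>+z. ennreal ((cmod (f z))\<^sup>2) \<partial>M) \<le> C"
proof -
  have "ennreal ((cmod (f z))\<^sup>2) = liminf (\<lambda>k. ennreal ((cmod (F k z))\<^sup>2))" for z
    by (rule lim_imp_Liminf[symmetric]) (auto intro!: tendsto_intros lim tendsto_ennrealI)
  then have "(\<integral>\<^sup>+z. ennreal ((cmod (f z))\<^sup>2) \<partial>M) \<le> liminf (\<lambda>k. \<integral>\<^sup>+z. ennreal ((cmod (F k z))\<^sup>2) \<partial>M)"
    using nn_integral_liminf[of "\<lambda>k z. ennreal ((cmod (F k z))\<^sup>2)" M] by simp
  also have "\<dots> \<le> liminf (\<lambda>k::nat. C)"
    by (rule Liminf_mono) (use le in \<open>auto simp: eventually_sequentially\<close>)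
  also have "\<dots> = C" by (simp add: Liminf_const)
  finally show ?thesis .
qed

lemma evaluation_bound:
  assumes z: "z \<in> polydisc"
  shows "\<exists>r>0. ball z r \<subseteq> polydisc \<and> (\<exists>C. \<forall>x\<in>hol. \<forall>y\<in>ball z r. cmod (fn x y) \<le> C * norm x)"
proof -
  obtain s where s: "s > 0" "ball z s \<subseteq> polydisc" using open_polydisc z open_contains_ball by blast
  define v where "v = measure lborel (ball (0 :: complex ^ 'a) (s/2))"
  have v: "v > 0" unfolding v_def using s by (simp add: content_ball)
  have "cmod (fn x y) \<le> 1 / sqrt v * norm x" if x: "x \<in> hol" and y: "y \<in> ball z (s/2)" for x y
  proof -
    have "ball y (s/2) \<subseteq> ball z s"
    proof
      fix w assume "w \<in> ball y (s/2)"
      then show "w \<in> ball z s" using y dist_triangle[of z w y] by (simp add: dist_commute)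
    qed
    then have "holomorphic_several (fn x) (ball y (s/2))"
      using x s holomorphic_several_subset unfolding hol_def by blast
    moreover have "emeasure lborel (ball (0 :: complex ^ 'a) (s/2)) = ennreal v"
      unfolding v_def by (rule emeasure_eq_ennreal_measure) (use s in \<open>simp add: emeasure_ball\<close>)
    ultimately have "ennreal ((cmod (fn x y))\<^sup>2) * ennreal v \<le> ennreal ((norm x)\<^sup>2)"
      using point_evaluation_bound[of "fn x" y "s/2"] by (simp add: norm_square_nn_integral)
    then have "(cmod (fn x y))\<^sup>2 * v \<le> (norm x)\<^sup>2"
      using v by (simp flip: ennreal_mult)
    then have "(cmod (fn x y))\<^sup>2 \<le> (1 / sqrt v * norm x)\<^sup>2"
      using v by (simp add: power_mult_distrib power_divide field_simps)
    then show ?thesis by (rule power2_le_imp_le) (use v in simp)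
  qed
  moreover have "ball z (s/2) \<subseteq> polydisc" using s subset_ball[of "s/2" s z] by force
  ultimately show ?thesis
    using s(1) by (intro exI[of _ "s/2"] conjI exI[of _ "1 / sqrt v"]) auto
qed

lemma complete_hol: "complete (hol :: 'n::finite disc_fun set)"
  unfolding complete_def
proof (intro allI impI)
  fix X :: "nat \<Rightarrow> 'n disc_fun" assume "(\<forall>n. X n \<in> hol) \<and> Cauchy X"
  then have X: "\<And>n. X n \<in> hol" and cau: "Cauchy X" by auto
  have "\<exists>f. holomorphic_several f polydisc \<and> (\<forall>z\<in>polydisc. (\<lambda>k. fn (X k) z) \<longlonglongrightarrow> f z)"
  proof (rule holomorphic_limit)
    show "holomorphic_several (fn (X k)) polydisc" for k using X by (simp add: hol_def)
    fix z :: "complex ^ 'n" assume "z \<in> polydisc"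
    then obtain r C where r: "r > 0" "ball z r \<subseteq> polydisc"
      and C: "\<And>x y. x \<in> hol \<Longrightarrow> y \<in> ball z r \<Longrightarrow> cmod (fn x y) \<le> C * norm x"
      using evaluation_bound by blast
    have "\<exists>N. \<forall>m\<ge>N. \<forall>n\<ge>N. \<forall>y\<in>ball z r. cmod (fn (X m) y - fn (X n) y) \<le> e" if e: "e > 0" for e
    proof -
      obtain N where N: "\<And>m n. m \<ge> N \<Longrightarrow> n \<ge> N \<Longrightarrow> norm (X m - X n) < e / (\<bar>C\<bar> + 1)"
        using CauchyD[OF cau, of "e / (\<bar>C\<bar> + 1)"] e by auto
      have "cmod (fn (X m) y - fn (X n) y) \<le> e" if "m \<ge> N" "n \<ge> N" "y \<in> ball z r" for m n y
      proof -
        have "cmod (fn (X m - X n) y) \<le> C * norm (X m - X n)"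
          by (rule C) (use X subspace_hol that in \<open>auto intro: subspace_diff\<close>)
        also have "\<dots> \<le> (\<bar>C\<bar> + 1) * norm (X m - X n)" by (intro mult_right_mono) auto
        also have "\<dots> \<le> (\<bar>C\<bar> + 1) * (e / (\<bar>C\<bar> + 1))"
          using N[OF that(1,2)] by (intro mult_left_mono) auto
        also have "\<dots> = e" by (simp add: add_nonneg_eq_0_iff)
        finally show ?thesis by (simp add: fn_simps)
      qed
      then show ?thesis by blast
    qed
    with r show "\<exists>r>0. ball z r \<subseteq> polydisc \<and>
      (\<forall>e>0. \<exists>N. \<forall>m\<ge>N. \<forall>n\<ge>N. \<forall>y\<in>ball z r. cmod (fn (X m) y - fn (X n) y) \<le> e)" by blast
  qed
  then obtain f0 where f0: "holomorphic_several f0 polydisc" "\<And>z. z \<in> polydisc \<Longrightarrow> (\<lambda>k. fn (X k) z) \<longlonglongrightarrow> f0 z"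
    by blast
  define f where "f z = (if z \<in> polydisc then f0 z else 0)" for z
  have lim: "(\<lambda>k. fn (X k) z) \<longlonglongrightarrow> f z" for z
    using f0(2) by (cases "z \<in> polydisc") (auto simp: f_def fn_outside)
  have hol: "holomorphic_several f polydisc"
    unfolding holomorphic_several_def
  proof
    fix z :: "complex ^ 'n" assume z: "z \<in> polydisc"
    then obtain D where "(f0 has_derivative D) (at z)" "\<forall>c h. D (c *s h) = c * D h"
      using f0(1) unfolding holomorphic_several_def by blast
    moreover from this(1) have "(f has_derivative D) (at z)"
      by (rule has_derivative_transform_within_open[OF _ open_polydisc z]) (simp add: f_def)
    ultimately show "\<exists>D. (f has_derivative D) (at z) \<and> (\<forall>c h. D (c *s h) = c * D h)" by blast
  qed
  have cont: "continuous_on polydisc f" by (rule holomorphic_several_continuous_on[OF hol])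
  have [measurable]: "f \<in> borel_measurable borel"
    by (rule zero_outside_borel_measurable[OF cont]) (simp add: f_def)
  obtain B where B: "\<And>n. norm (X n) \<le> B" using Cauchy_Bseq[OF cau] Bseq_def by blast
  have "(\<integral>\<^sup>+z. ennreal ((cmod (f z))\<^sup>2) \<partial>lborel) \<le> ennreal (B\<^sup>2)"
  proof (rule fatou_square[OF _ lim])
    show "(\<integral>\<^sup>+z. ennreal ((cmod (fn (X k) z))\<^sup>2) \<partial>lborel) \<le> ennreal (B\<^sup>2)" for k
      unfolding norm_square_nn_integral[symmetric] using B[of k] by (intro ennreal_leI power_mono) auto
  qed simp
  then have "integrable lborel (\<lambda>z. (cmod (f z))\<^sup>2)"
    by (intro integrableI_bounded) (auto intro: order.strict_trans1)
  then have "disc_L2 f" using cont by (simp add: disc_L2_def f_def)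
  define x where "x = disc_fun f"
  have fx: "fn x = f" unfolding x_def using \<open>disc_L2 f\<close> by (simp add: disc_fun_inverse)
  have "X \<longlonglongrightarrow> x"
  proof (rule LIMSEQ_I)
    fix e :: real assume "0 < e"
    then obtain N where N: "\<And>m n. m \<ge> N \<Longrightarrow> n \<ge> N \<Longrightarrow> norm (X m - X n) < e/2"
      using CauchyD[OF cau, of "e/2"] by auto
    have "norm (X n - x) < e" if n: "n \<ge> N" for n
    proof -
      have "(\<integral>\<^sup>+z. ennreal ((cmod (fn (X n) z - f z))\<^sup>2) \<partial>lborel) \<le> ennreal ((e/2)\<^sup>2)"
      proof (rule fatou_square[where N = N])
        show "(\<lambda>k. fn (X n) z - fn (X k) z) \<longlonglongrightarrow> fn (X n) z - f z" for z
          by (intro tendsto_intros lim)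
        fix k assume "k \<ge> N"
        have "(\<integral>\<^sup>+z. ennreal ((cmod (fn (X n) z - fn (X k) z))\<^sup>2) \<partial>lborel) = ennreal ((norm (X n - X k))\<^sup>2)"
          by (simp add: norm_square_nn_integral fn_simps)
        also have "\<dots> \<le> ennreal ((e/2)\<^sup>2)" using N[OF n \<open>k \<ge> N\<close>] by (intro ennreal_leI power_mono) auto
        finally show "(\<integral>\<^sup>+z. ennreal ((cmod (fn (X n) z - fn (X k) z))\<^sup>2) \<partial>lborel) \<le> ennreal ((e/2)\<^sup>2)" .
      qed simp
      then have "ennreal ((norm (X n - x))\<^sup>2) \<le> ennreal ((e/2)\<^sup>2)"
        by (simp add: norm_square_nn_integral fn_simps fx)
      then have "(norm (X n - x))\<^sup>2 \<le> (e/2)\<^sup>2" by simp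
      then have "norm (X n - x) \<le> e/2"
        by (rule power2_le_imp_le) (use \<open>0 < e\<close> in simp)
      then show ?thesis using \<open>0 < e\<close> by simp
    qed
    then show "\<exists>no. \<forall>n\<ge>no. norm (X n - x) < e" by blast
  qed
  moreover have "x \<in> hol" using hol by (simp add: hol_def fx)
  ultimately show "\<exists>l\<in>hol. X \<longlonglongrightarrow> l" by blast
qed

section \<open>Relation to the integrals over the polydisc\<close>

lemma lebesgue_on_polydisc:
  fixes g :: "complex ^ 'n \<Rightarrow> 'b::{banach, second_countable_topology}"
  assumes "\<And>z. z \<notin> polydisc \<Longrightarrow> g z = 0" and [measurable]: "g \<in> borel_measurable borel"
  shows "integrable (lebesgue_on polydisc) g \<longleftrightarrow> integrable lborel g"
    and "(LINT z|lebesgue_on polydisc. g z) = (LINT z|lborel. g z)"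
proof -
  have eq: "(\<lambda>z. indicator polydisc z *\<^sub>R g z) = g" using assms(1) by (auto simp: indicator_def)
  have [simp]: "polydisc \<inter> space lebesgue \<in> sets (lebesgue :: (complex ^ 'n) measure)"
    using open_polydisc by auto
  show "integrable (lebesgue_on polydisc) g \<longleftrightarrow> integrable lborel g"
    by (simp add: integrable_restrict_space eq integrable_completion)
  show "(LINT z|lebesgue_on polydisc. g z) = (LINT z|lborel. g z)"
    by (simp add: integral_restrict_space eq integral_completion)
qed

lemma L2_inner_fn: "L2_inner polydisc (fn x) (fn y) = cinner x y"
  unfolding L2_inner_def cinner_def
  by (rule lebesgue_on_polydisc) (simp_all add: fn_outside)

lemma L2_norm_fn: "L2_norm polydisc (fn x) = norm x"
proof -
  have "L2_norm polydisc (fn x) = sqrt (LINT z|lborel. (cmod (fn x z))\<^sup>2)"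
    unfolding L2_norm_def by (subst lebesgue_on_polydisc) (simp_all add: fn_outside)
  then show ?thesis by (simp flip: norm_square_integral)
qed

lemma bergman_space_polydisc: "bergman_space (polydisc :: (complex ^ 'n) set) = fn ` hol"
proof (intro equalityI subsetI)
  fix f :: "complex ^ 'n \<Rightarrow> complex" assume "f \<in> bergman_space polydisc"
  then have f: "holomorphic_several f polydisc" "f \<in> L2_space polydisc" "\<And>z. z \<notin> polydisc \<Longrightarrow> f z = 0"
    by (auto simp: bergman_space_def)
  have cont: "continuous_on polydisc f" by (rule holomorphic_several_continuous_on[OF f(1)])
  have [measurable]: "f \<in> borel_measurable borel" by (rule zero_outside_borel_measurable[OF cont f(3)])
  have "integrable lborel (\<lambda>z. (cmod (f z))\<^sup>2)"
    using f(2) lebesgue_on_polydisc(1)[of "\<lambda>z. (cmod (f z))\<^sup>2"] f(3) by (simp add: L2_space_def)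
  then have "disc_L2 f" using cont f(3) by (simp add: disc_L2_def)
  then have "fn (disc_fun f) = f" by (simp add: disc_fun_inverse)
  then show "f \<in> fn ` hol" using f(1) by (metis hol_def image_eqI mem_Collect_eq)
next
  fix f :: "complex ^ 'n \<Rightarrow> complex" assume "f \<in> fn ` hol"
  then obtain x where x: "x \<in> hol" "f = fn x" by blast
  have "integrable (lebesgue_on polydisc) (\<lambda>z. (cmod (fn x z))\<^sup>2)"
    using fn_integrable_square[of x] lebesgue_on_polydisc(1)[of "\<lambda>z. (cmod (fn x z))\<^sup>2"]
    by (simp add: fn_outside)
  moreover have "fn x \<in> borel_measurable (lebesgue_on polydisc)"
    by (intro measurable_restrict_space1 measurable_completion) simp
  ultimately show "f \<in> bergman_space polydisc"
    using x by (simp add: bergman_space_def L2_space_def hol_def fn_outside)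
qed


section \<open>Splitting off the last coordinate\<close>

definition vec_init :: "complex ^ ('m option) \<Rightarrow> complex ^ 'm" where
  "vec_init v = (\<chi> j. v $ Some j)"

lemma vec_init_snoc [simp]: "vec_init (vec_snoc z w) = z"
  by (simp add: vec_init_def vec_snoc_def vec_eq_iff)

lemma vec_snoc_None [simp]: "vec_snoc z w $ None = w"
  by (simp add: vec_snoc_def)

lemma vec_snoc_init [simp]: "vec_snoc (vec_init v) (v $ None) = v"
  by (auto simp: vec_init_def vec_snoc_def vec_eq_iff split: option.split)

lemma polydisc_snoc_iff: "vec_snoc z w \<in> polydisc \<longleftrightarrow> z \<in> polydisc \<and> w \<in> ball 0 1"
  unfolding polydisc_def vec_snoc_def by (auto split: option.split)

lemma polydisc_init_iff: "v \<in> polydisc \<longleftrightarrow> vec_init v \<in> polydisc \<and> v $ None \<in> ball 0 1"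
  by (metis polydisc_snoc_iff vec_snoc_init)

lemma linear_vec_init: "linear vec_init"
  by (rule linearI) (simp_all add: vec_init_def vec_eq_iff)

lemma continuous_on_vec_init: "continuous_on S vec_init"
  by (rule linear_continuous_on) (simp add: linear_conv_bounded_linear[symmetric] linear_vec_init)

lemma linear_vec_snoc: "linear (\<lambda>p. vec_snoc (snd p) (fst p))"
  by (rule linearI) (auto simp: vec_snoc_def vec_eq_iff split: option.split)

lemma borel_measurable_vec_snoc [measurable]:
  fixes f :: "'b \<Rightarrow> complex ^ ('a::finite)"
  assumes [measurable]: "f \<in> M \<rightarrow>\<^sub>M borel" "g \<in> M \<rightarrow>\<^sub>M borel"
  shows "(\<lambda>x. vec_snoc (f x) (g x)) \<in> M \<rightarrow>\<^sub>M borel"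
proof -
  have "continuous_on UNIV (\<lambda>p. vec_snoc (snd p) (fst p) :: complex ^ ('a option))"
    by (rule linear_continuous_on) (simp add: linear_conv_bounded_linear[symmetric] linear_vec_snoc)
  then have "(\<lambda>p. vec_snoc (snd p) (fst p) :: complex ^ ('a option)) \<in> borel \<Otimes>\<^sub>M borel \<rightarrow>\<^sub>M borel"
    by (simp add: borel_prod borel_measurable_continuous_onI)
  then have "(\<lambda>x. vec_snoc (snd (g x, f x)) (fst (g x, f x)) :: complex ^ ('a option)) \<in> M \<rightarrow>\<^sub>M borel"
    by (rule measurable_compose[rotated]) measurable
  then show ?thesis by simp
qed

text \<open>Listing the last coordinate first in the pair makes the integral over it the outer one, which is how
  the slices are used below.\<close>

lemma distr_vec_snoc:
  "distr (lborel \<Otimes>\<^sub>M lborel) borel (\<lambda>p. vec_snoc (snd p) (fst p)) = (lborel :: (complex ^ ('m::finite option)) measure)"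
  unfolding lborel_prod
proof (rule distr_lborel_isometry[OF linear_vec_snoc])
  fix p :: "complex \<times> (complex ^ 'm)"
  have "(\<Sum>i\<in>UNIV. (cmod (vec_snoc (snd p) (fst p) $ i))\<^sup>2) = (cmod (fst p))\<^sup>2 + (\<Sum>i\<in>UNIV. (cmod (snd p $ i))\<^sup>2)"
    unfolding UNIV_option_conv
    by (subst sum.insert) (auto simp: sum.reindex vec_snoc_def)
  then show "norm (vec_snoc (snd p) (fst p)) = norm p"
    by (simp add: norm_vec_def L2_set_def norm_prod_def real_sqrt_pow2 sum_nonneg)
next
  show "surj (\<lambda>p. vec_snoc (snd p) (fst p) :: complex ^ ('m option))"
    by (rule surjI[of _ "\<lambda>v. (v $ None, vec_init v)"]) simp
  show "DIM(complex \<times> (complex ^ 'm)) = DIM(complex ^ ('m option))"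
    by (simp add: card_UNIV_option)
qed

lemma nn_integral_vec_snoc:
  assumes [measurable]: "F \<in> borel_measurable borel"
  shows "(\<integral>\<^sup>+v. F v \<partial>lborel) = (\<integral>\<^sup>+w. \<integral>\<^sup>+z. F (vec_snoc z w) \<partial>lborel \<partial>lborel)"
  by (subst distr_vec_snoc[symmetric])
    (simp add: nn_integral_distr lborel.nn_integral_fst[symmetric])

lemma
  fixes F :: "complex ^ ('m::finite option) \<Rightarrow> 'b::{banach, second_countable_topology}"
  assumes F: "integrable lborel F"
  shows integral_vec_snoc: "(LINT v|lborel. F v) = (LINT w|lborel. LINT z|lborel. F (vec_snoc z w))"
    and AE_integrable_vec_snoc: "AE w in lborel. integrable lborel (\<lambda>z. F (vec_snoc z w))"
proof -
  have [measurable]: "F \<in> borel_measurable borel" using F borel_measurable_integrable by fastforce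
  have "integrable (distr (lborel \<Otimes>\<^sub>M lborel) borel (\<lambda>p. vec_snoc (snd p) (fst p))) F"
    using F by (simp only: distr_vec_snoc)
  then have int: "integrable (lborel \<Otimes>\<^sub>M lborel) (\<lambda>p. F (vec_snoc (snd p) (fst p)))"
    by (subst (asm) integrable_distr_eq) simp_all
  have "(LINT v|lborel. F v) = (LINT p|(lborel \<Otimes>\<^sub>M lborel). F (vec_snoc (snd p) (fst p)))"
    by (subst distr_vec_snoc[symmetric]) (simp add: integral_distr)
  then show "(LINT v|lborel. F v) = (LINT w|lborel. LINT z|lborel. F (vec_snoc z w))"
    using lborel_pair.integral_fst'[OF int] by simp
  show "AE w in lborel. integrable lborel (\<lambda>z. F (vec_snoc z w))"
    using lborel_pair.AE_integrable_fst'[OF int] by simp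
qed

section \<open>Products of a function of the first coordinates and a function of the last\<close>

definition disc_function :: "(complex \<Rightarrow> complex) \<Rightarrow> bool" where
  "disc_function g \<longleftrightarrow> continuous_on (ball 0 1) g \<and> (\<exists>K. \<forall>w\<in>ball 0 1. cmod (g w) \<le> K)"

definition zero_ext :: "(complex \<Rightarrow> complex) \<Rightarrow> complex \<Rightarrow> complex" where
  "zero_ext g w = (if w \<in> ball 0 1 then g w else 0)"

definition disc_energy :: "(complex \<Rightarrow> complex) \<Rightarrow> real" where
  "disc_energy g = (LINT w|lborel. (cmod (zero_ext g w))\<^sup>2)"

lemma disc_function_mult:
  assumes "disc_function f" "disc_function g"
  shows "disc_function (\<lambda>w. f w * g w)"
proof -
  obtain K L where K: "\<forall>w\<in>ball 0 1. cmod (f w) \<le> K" and L: "\<forall>w\<in>ball 0 1. cmod (g w) \<le> L"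
    using assms unfolding disc_function_def by blast
  have "cmod (f w * g w) \<le> K * L" if "w \<in> ball 0 1" for w
    unfolding norm_mult by (intro mult_mono) (use K L that in \<open>auto intro: order_trans[OF norm_ge_zero]\<close>)
  then show ?thesis using assms unfolding disc_function_def
    by (blast intro: continuous_on_mult)
qed

lemma disc_function_continuous:
  assumes "continuous_on (cball 0 1) g"
  shows "disc_function g"
proof -
  have "bounded (g ` cball 0 1)"
    using compact_continuous_image[OF assms compact_cball] compact_imp_bounded by blast
  then obtain K where "\<forall>w\<in>cball 0 1. cmod (g w) \<le> K" unfolding bounded_iff by auto
  then have "\<forall>w\<in>ball 0 1. cmod (g w) \<le> K" by auto
  then show ?thesis using continuous_on_subset[OF assms ball_subset_cball] unfolding disc_function_def by blast
qed

lemma disc_function_const: "disc_function (\<lambda>_. c)"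
  by (rule disc_function_continuous) simp

context
  fixes g :: "complex \<Rightarrow> complex"
  assumes g: "disc_function g"
begin

lemma zero_ext_borel: "zero_ext g \<in> borel_measurable borel"
proof -
  have "(\<lambda>w. indicator (ball 0 1) w *\<^sub>R g w) \<in> borel_measurable borel"
    using g by (intro borel_measurable_continuous_on_indicator) (auto simp: disc_function_def)
  moreover have "(\<lambda>w. indicator (ball 0 1) w *\<^sub>R g w) = zero_ext g"
    by (auto simp: zero_ext_def indicator_def)
  ultimately show ?thesis by simp
qed

lemma zero_ext_integrable: "integrable lborel (\<lambda>w. (cmod (zero_ext g w))\<^sup>2)"
proof -
  obtain K where K: "\<forall>w\<in>ball 0 1. cmod (g w) \<le> K" using g unfolding disc_function_def by blast
  note [measurable] = zero_ext_borel
  show ?thesis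
  proof (rule Bochner_Integration.integrable_bound)
    show "integrable lborel (\<lambda>w::complex. K\<^sup>2 * indicator (ball 0 1) w)"
      by (intro integrable_mult_right integrable_real_indicator) (auto simp: emeasure_ball)
    show "(\<lambda>w. (cmod (zero_ext g w))\<^sup>2) \<in> borel_measurable lborel" by measurable
    show "AE w in lborel. norm ((cmod (zero_ext g w))\<^sup>2) \<le> norm (K\<^sup>2 * indicator (ball 0 1) w)"
      using K by (intro AE_I2) (auto simp: zero_ext_def indicator_def intro: power_mono)
  qed
qed

lemma disc_energy_nn: "ennreal (disc_energy g) = (\<integral>\<^sup>+w. ennreal ((cmod (zero_ext g w))\<^sup>2) \<partial>lborel)"
  unfolding disc_energy_def by (rule nn_integral_eq_integral[symmetric]) (auto intro: zero_ext_integrable)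

lemma disc_energy_nonneg: "0 \<le> disc_energy g"
  unfolding disc_energy_def by simp

lemma disc_energy_cmult: "disc_energy (\<lambda>w. c * g w) = (cmod c)\<^sup>2 * disc_energy g"
proof -
  have "(cmod (zero_ext (\<lambda>w. c * g w) w))\<^sup>2 = (cmod c)\<^sup>2 * (cmod (zero_ext g w))\<^sup>2" for w
    by (simp add: zero_ext_def norm_mult power_mult_distrib)
  then show ?thesis unfolding disc_energy_def by simp
qed

end

definition tensor :: "'m::finite disc_fun \<Rightarrow> (complex \<Rightarrow> complex) \<Rightarrow> 'm option disc_fun" where
  "tensor x g = disc_fun (\<lambda>v. fn x (vec_init v) * zero_ext g (v $ None))"

lemma nn_integral_tensor_square:
  fixes x :: "'m::finite disc_fun"
  assumes g: "disc_function g"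
  shows "(\<integral>\<^sup>+v. ennreal ((cmod (fn x (vec_init v) * zero_ext g (v $ None)))\<^sup>2) \<partial>lborel)
    = ennreal ((norm x)\<^sup>2 * disc_energy g)"
proof -
  note [measurable] = zero_ext_borel[OF g]
  have [measurable]: "vec_init \<in> borel \<rightarrow>\<^sub>M borel"
    by (intro borel_measurable_continuous_onI continuous_on_vec_init)
  have [measurable]: "(\<lambda>v :: complex ^ ('m option). v $ None) \<in> borel \<rightarrow>\<^sub>M borel"
    by (intro borel_measurable_continuous_onI continuous_intros)
  have "(\<integral>\<^sup>+v. ennreal ((cmod (fn x (vec_init v) * zero_ext g (v $ None)))\<^sup>2) \<partial>lborel)
    = (\<integral>\<^sup>+w. \<integral>\<^sup>+z. ennreal ((cmod (fn x z))\<^sup>2) * ennreal ((cmod (zero_ext g w))\<^sup>2) \<partial>lborel \<partial>lborel)"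
    by (subst nn_integral_vec_snoc)
      (simp_all add: norm_mult power_mult_distrib ennreal_mult)
  also have "\<dots> = (\<integral>\<^sup>+w. ennreal ((norm x)\<^sup>2) * ennreal ((cmod (zero_ext g w))\<^sup>2) \<partial>lborel)"
    by (intro nn_integral_cong) (simp add: nn_integral_multc norm_square_nn_integral)
  also have "\<dots> = ennreal ((norm x)\<^sup>2) * ennreal (disc_energy g)"
    by (simp add: nn_integral_cmult disc_energy_nn[OF g])
  finally show ?thesis using disc_energy_nonneg[OF g] by (simp add: ennreal_mult)
qed

lemma fn_tensor:
  fixes x :: "'m::finite disc_fun"
  assumes g: "disc_function g"
  shows "fn (tensor x g) v = fn x (vec_init v) * zero_ext g (v $ None)"
proof -
  define F where "F v = fn x (vec_init v) * zero_ext g (v $ None)" for v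
  have zero: "F v = 0" if "v \<notin> polydisc" for v
    using that unfolding polydisc_init_iff F_def by (auto simp: fn_outside zero_ext_def)
  have cont: "continuous_on polydisc F"
  proof -
    have "continuous_on polydisc (\<lambda>v. fn x (vec_init v) * g (v $ None))"
    proof (intro continuous_on_mult)
      show "continuous_on polydisc (\<lambda>v. fn x (vec_init v))"
        by (rule continuous_on_compose2[OF fn_continuous_on continuous_on_vec_init])
          (auto simp: polydisc_init_iff)
      show "continuous_on polydisc (\<lambda>v :: complex ^ ('m option). g (v $ None))"
        by (rule continuous_on_compose2[where t = "ball 0 1"])
          (use g in \<open>auto simp: polydisc_init_iff disc_function_def intro: continuous_intros\<close>)
    qed
    then show ?thesis
      by (rule continuous_on_eq) (auto simp: F_def zero_ext_def polydisc_init_iff)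
  qed
  have [measurable]: "F \<in> borel_measurable borel" by (rule zero_outside_borel_measurable[OF cont zero])
  have "integrable lborel (\<lambda>v. (cmod (F v))\<^sup>2)"
    by (rule integrableI_nonneg) (simp, simp, simp add: F_def nn_integral_tensor_square[OF g])
  then have "disc_L2 F" using cont zero by (simp add: disc_L2_def)
  then show ?thesis unfolding tensor_def F_def by (simp add: disc_fun_inverse)
qed

lemma norm_tensor:
  assumes g: "disc_function g"
  shows "norm (tensor x g) = norm x * sqrt (disc_energy g)"
proof -
  have "ennreal ((norm (tensor x g))\<^sup>2) = ennreal ((norm x)\<^sup>2 * disc_energy g)"
    unfolding norm_square_nn_integral fn_tensor[OF g] by (rule nn_integral_tensor_square[OF g])
  then have "(norm (tensor x g))\<^sup>2 = (norm x)\<^sup>2 * disc_energy g"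
    using disc_energy_nonneg[OF g] by simp
  then have "sqrt ((norm (tensor x g))\<^sup>2) = sqrt ((norm x)\<^sup>2 * disc_energy g)" by simp
  then show ?thesis by (simp add: real_sqrt_mult)
qed

lemma tensor_diff_left: "disc_function g \<Longrightarrow> tensor (x - y) g = tensor x g - tensor y g"
  by (rule disc_fun_eqI) (simp add: fn_tensor fn_simps algebra_simps)

lemma tensor_scaleR_left: "disc_function g \<Longrightarrow> tensor (r *\<^sub>R x) g = r *\<^sub>R tensor x g"
  by (rule disc_fun_eqI) (simp add: fn_tensor fn_simps algebra_simps)

lemma mul_tensor:
  assumes "\<And>z w. z \<in> polydisc \<Longrightarrow> w \<in> ball 0 1 \<Longrightarrow> \<psi> (vec_snoc z w) = \<phi> z * chi w"
    and "multiplier \<phi>" "multiplier \<psi>" "disc_function chi" "disc_function g"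
  shows "mul \<psi> (tensor x g) = tensor (mul \<phi> x) (\<lambda>w. chi w * g w)"
proof (rule disc_fun_eqI)
  fix v :: "complex ^ ('a option)" assume "v \<in> polydisc"
  then have "\<psi> v = \<phi> (vec_init v) * chi (v $ None)" "v $ None \<in> ball 0 1"
    using assms(1)[of "vec_init v" "v $ None"] by (auto simp: polydisc_init_iff)
  then show "fn (mul \<psi> (tensor x g)) v = fn (tensor (mul \<phi> x) (\<lambda>w. chi w * g w)) v"
    by (simp add: fn_mul assms fn_tensor disc_function_mult zero_ext_def)
qed

text \<open>By Fubini's theorem almost every slice of \<open>k\<close> in the first variables is square integrable, hence an
  element of \<open>hol\<close> and orthogonal to \<open>x\<close>.\<close>

lemma tensor_orthogonal:
  fixes x :: "'m::finite disc_fun"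
  assumes g: "disc_function g" and x: "\<And>h. h \<in> hol \<Longrightarrow> inner x h = 0" and k: "k \<in> hol"
  shows "inner (tensor x g) k = 0"
proof -
  have cx: "cinner x h = 0" if "h \<in> hol" for h
    by (rule cinner_eq_0_hol) (use x that in auto)
  define s where "s w z = fn k (vec_snoc z w)" for w z
  have AE: "AE w in lborel. integrable lborel (\<lambda>z. (cmod (s w z))\<^sup>2)"
    using AE_integrable_vec_snoc[OF fn_integrable_square[of k]] by (simp only: s_def)
  have zero: "(LINT z|lborel. fn (tensor x g) (vec_snoc z w) * cnj (fn k (vec_snoc z w))) = 0"
    if int: "integrable lborel (\<lambda>z. (cmod (s w z))\<^sup>2)" for w
  proof (cases "w \<in> ball 0 1")
    case False
    then show ?thesis by (simp add: fn_tensor[OF g] zero_ext_def)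
  next
    case w: True
    have hol: "holomorphic_several (s w) polydisc"
      unfolding holomorphic_several_def
    proof
      fix z :: "complex ^ 'm" assume "z \<in> polydisc"
      then have "vec_snoc z w \<in> polydisc" using w by (simp add: polydisc_snoc_iff)
      then obtain D where D: "(fn k has_derivative D) (at (vec_snoc z w))" "\<forall>c h. D (c *s h) = c * D h"
        using k unfolding hol_def holomorphic_several_def by blast
      have lin: "linear (\<lambda>h. vec_snoc h 0 :: complex ^ ('m option))"
        by (rule linearI) (auto simp: vec_snoc_def vec_eq_iff split: option.split)
      have eq: "vec_snoc z w = vec_snoc z 0 + vec_snoc 0 w" for z :: "complex ^ 'm"
        by (auto simp: vec_snoc_def vec_eq_iff split: option.split)
      have "((\<lambda>z. vec_snoc z 0 + vec_snoc 0 w) has_derivative (\<lambda>h. vec_snoc h 0 + 0)) (at z)"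
        by (intro has_derivative_add has_derivative_const linear_imp_has_derivative lin)
      then have "((\<lambda>z. vec_snoc z w) has_derivative (\<lambda>h. vec_snoc h 0)) (at z)"
        by (subst eq) simp
      from has_derivative_compose[OF this D(1)]
      have "(s w has_derivative (\<lambda>h. D (vec_snoc h 0))) (at z)" by (simp add: s_def[abs_def])
      moreover have "vec_snoc (c *s h) 0 = c *s (vec_snoc h 0 :: complex ^ ('m option))" for c h
        by (auto simp: vec_snoc_def vec_eq_iff split: option.split)
      ultimately show "\<exists>D. (s w has_derivative D) (at z) \<and> (\<forall>c h. D (c *s h) = c * D h)"
        using D(2) by (intro exI[of _ "\<lambda>h. D (vec_snoc h 0)"]) auto
    qed
    have "disc_L2 (s w)"
      unfolding disc_L2_def using int holomorphic_several_continuous_on[OF hol]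
      by (auto simp: s_def polydisc_snoc_iff intro: fn_outside)
    then have f: "fn (disc_fun (s w)) = s w" by (simp add: disc_fun_inverse)
    then have "cinner x (disc_fun (s w)) = 0" using hol by (intro cx) (simp add: hol_def)
    then have 0: "(LINT z|lborel. fn x z * cnj (s w z)) = 0" by (simp add: cinner_def f)
    have "(LINT z|lborel. fn (tensor x g) (vec_snoc z w) * cnj (fn k (vec_snoc z w)))
      = (LINT z|lborel. zero_ext g w * (fn x z * cnj (s w z)))"
      by (simp add: fn_tensor[OF g] s_def mult_ac)
    also have "\<dots> = 0" using 0 by (simp only: integral_mult_right_zero mult_zero_right)
    finally show ?thesis .
  qed
  have "cinner (tensor x g) k = (LINT w|lborel. LINT z|lborel. fn (tensor x g) (vec_snoc z w) * cnj (fn k (vec_snoc z w)))"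
    unfolding cinner_def by (rule integral_vec_snoc[OF fn_integrable])
  also have "\<dots> = 0"
    by (rule integral_eq_zero_AE) (use AE in eventually_elim, rule zero)
  finally show ?thesis by (simp add: inner_disc_fun_def)
qed

lemma tensor_hol:
  fixes y :: "'m::finite disc_fun"
  assumes y: "y \<in> hol" and g: "disc_function g" "g holomorphic_on ball 0 1"
  shows "tensor y g \<in> hol"
  unfolding hol_def holomorphic_several_def mem_Collect_eq
proof
  fix v :: "complex ^ ('m option)" assume v: "v \<in> polydisc"
  then have v': "vec_init v \<in> polydisc" "v $ None \<in> ball 0 1" by (auto simp: polydisc_init_iff)
  obtain D where D: "(fn y has_derivative D) (at (vec_init v))" "\<forall>c h. D (c *s h) = c * D h"
    using y v' unfolding hol_def holomorphic_several_def by blast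
  obtain d where "(g has_field_derivative d) (at (v $ None))"
    using g(2) v'(2) by (meson holomorphic_on_open open_ball)
  then have d: "(g has_derivative (\<lambda>t. d * t)) (at (v $ None))"
    by (simp add: has_field_derivative_def)
  have 1: "((\<lambda>v. fn y (vec_init v)) has_derivative (\<lambda>h. D (vec_init h))) (at v)"
    by (rule has_derivative_compose[OF linear_imp_has_derivative[OF linear_vec_init] D(1)])
  have 2: "((\<lambda>v. g (v $ None)) has_derivative (\<lambda>h. d * (h $ None))) (at v)"
    by (rule has_derivative_compose[where f = "\<lambda>v. v $ None", OF _ d])
      (intro linear_imp_has_derivative linearI, auto)
  define E where "E h = fn y (vec_init v) * (d * (h $ None)) + D (vec_init h) * g (v $ None)" for h
  have "((\<lambda>v. fn y (vec_init v) * g (v $ None)) has_derivative E) (at v)"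
    unfolding E_def by (rule has_derivative_mult[OF 1 2])
  then have "(fn (tensor y g) has_derivative E) (at v)"
    by (rule has_derivative_transform_within_open[OF _ open_polydisc v])
      (simp add: fn_tensor[OF g(1)] zero_ext_def polydisc_init_iff)
  moreover have "vec_init (c *s h) = c *s vec_init h" for c and h :: "complex ^ ('m option)"
    by (simp add: vec_init_def vec_eq_iff)
  ultimately show "\<exists>D. (fn (tensor y g) has_derivative D) (at v) \<and> (\<forall>c h. D (c *s h) = c * D h)"
    using D(2) by (intro exI[of _ E]) (simp add: E_def algebra_simps)
qed

text \<open>The operator \<open>I - P\<close> acts on the first factor only, because the holomorphy of \<open>g\<close> keeps
  \<open>tensor (proj hol x) g\<close> in \<open>hol\<close>.\<close>

lemma proj_tensor:
  assumes g: "disc_function g" "g holomorphic_on ball 0 1"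
  shows "proj hol (tensor x g) = tensor (proj hol x) g"
proof (rule proj_eqI[OF subspace_hol complete_hol])
  show "tensor (proj hol x) g \<in> hol"
    by (rule tensor_hol[OF proj_in[OF subspace_hol complete_hol] g])
  show "inner (tensor x g - tensor (proj hol x) g) h = 0" if "h \<in> hol" for h
    unfolding tensor_diff_left[OF g(1), symmetric]
    by (rule tensor_orthogonal[OF g(1) proj_orthogonal[OF subspace_hol complete_hol] that])
qed


section \<open>Peak functions on the disc\<close>

definition peak_base :: "complex \<Rightarrow> complex \<Rightarrow> complex" where
  "peak_base q w = (1 + cnj q * w) / 2"

definition peak :: "complex \<Rightarrow> nat \<Rightarrow> complex \<Rightarrow> complex" where
  "peak q j w = of_real (1 / sqrt (disc_energy (\<lambda>w. peak_base q w ^ j))) * peak_base q w ^ j"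

lemma disc_function_peak_base_power: "disc_function (\<lambda>w. peak_base q w ^ j)"
  by (intro disc_function_continuous) (auto simp: peak_base_def intro!: continuous_intros)

lemma disc_function_peak: "disc_function (peak q j)"
  unfolding peak_def by (intro disc_function_mult disc_function_const disc_function_peak_base_power)

lemma peak_holomorphic: "peak q j holomorphic_on S"
  unfolding peak_def peak_base_def by (intro holomorphic_intros) auto

text \<open>With \<open>u = cnj q * w\<close> this is the parallelogram identity \<open>\<bar>1 + u\<bar>\<^sup>2 + \<bar>1 - u\<bar>\<^sup>2 = 2 + 2 \<bar>u\<bar>\<^sup>2\<close>.\<close>

lemma peak_base_bound:
  assumes "cmod q = 1" "cmod w \<le> 1"
  shows "(cmod (peak_base q w))\<^sup>2 \<le> 1 - (cmod (w - q))\<^sup>2 / 4"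
proof -
  have par: "(cmod (1 + u))\<^sup>2 + (cmod (1 - u))\<^sup>2 = 2 + 2 * (cmod u)\<^sup>2" for u
    unfolding cmod_power2 by (simp add: power2_eq_square algebra_simps)
  have "cmod (1 - cnj q * w) = cmod (w - q)"
  proof -
    have "q * cnj q = 1" using assms(1) by (simp add: complex_norm_square[symmetric])
    moreover have "q * (1 - cnj q * w) = q - (q * cnj q) * w" by (simp add: right_diff_distrib mult.assoc)
    ultimately have "q * (1 - cnj q * w) = q - w" by simp
    then have "cmod q * cmod (1 - cnj q * w) = cmod (q - w)" by (metis norm_mult)
    then show ?thesis using assms(1) by (simp add: norm_minus_commute)
  qed
  moreover have "(cmod (cnj q * w))\<^sup>2 \<le> 1"
    using assms by (simp add: norm_mult power_le_one)
  ultimately have "(cmod (1 + cnj q * w))\<^sup>2 + (cmod (w - q))\<^sup>2 \<le> 4"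
    using par[of "cnj q * w"] by simp
  then show ?thesis by (simp add: peak_base_def norm_divide power_divide)
qed

lemma disc_energy_one: "disc_energy (\<lambda>_. 1) = measure lborel (ball (0::complex) 1)"
proof -
  have "(cmod (zero_ext (\<lambda>_. 1) w))\<^sup>2 = indicator (ball 0 1) w" for w
    by (simp add: zero_ext_def indicator_def)
  then show ?thesis unfolding disc_energy_def by simp
qed

lemma disc_energy_ball_lower:
  assumes g: "disc_function g" and c: "ball c s \<subseteq> ball 0 1" "\<And>w. w \<in> ball c s \<Longrightarrow> t \<le> (cmod (g w))\<^sup>2"
  shows "t * measure lborel (ball c s) \<le> disc_energy g"
proof -
  have "t * measure lborel (ball c s) = (LINT w|lborel. t * indicator (ball c s) w)" by simp
  also have "\<dots> \<le> disc_energy g"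
    unfolding disc_energy_def
  proof (rule integral_mono[OF _ zero_ext_integrable[OF g]])
    show "integrable lborel (\<lambda>w. t * indicator (ball c s) w)"
      using emeasure_bounded_finite[of "ball c s"]
      by (intro integrable_mult_right integrable_real_indicator) auto
    show "t * indicator (ball c s) w \<le> (cmod (zero_ext g w))\<^sup>2" for w
      using c by (auto simp: indicator_def zero_ext_def)
  qed
  finally show ?thesis .
qed

lemma cmod_power_square: "(cmod (z ^ j))\<^sup>2 = ((cmod z)\<^sup>2) ^ j"
  by (simp add: norm_power mult.commute flip: power_mult)

text \<open>The square of the base is at most \<open>a = 1 - \<delta>\<^sup>2 / 4\<close> away from \<open>q\<close>, while it exceeds the larger number
  \<open>b = 1 - \<delta>\<^sup>2 / 8\<close> on a ball around the point \<open>(1 - \<delta>\<^sup>2 / 16) q\<close> near \<open>q\<close>. So the share of the mass that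
  the \<open>j\<close>-th power has away from \<open>q\<close> is of order \<open>(a / b)\<^sup>j\<close>.\<close>

lemma peak_base_power_concentrates:
  assumes q: "cmod q = 1" and \<delta>: "0 < \<delta>" "\<delta> \<le> 1"
  obtains a b m where "0 \<le> a" "a < b" "0 < m"
    "\<And>w. w \<in> ball 0 1 \<Longrightarrow> \<delta> \<le> cmod (w - q) \<Longrightarrow> (cmod (peak_base q w))\<^sup>2 \<le> a"
    "\<And>j. m * b ^ j \<le> disc_energy (\<lambda>w. peak_base q w ^ j)"
proof -
  define a b where "a = 1 - \<delta>\<^sup>2 / 4" and "b = 1 - \<delta>\<^sup>2 / 8"
  have d2: "0 < \<delta>\<^sup>2" "\<delta>\<^sup>2 \<le> 1" using \<delta> by (auto simp: power_le_one)
  then have ab: "0 \<le> a" "a < b" "0 \<le> b" by (auto simp: a_def b_def)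
  have far: "(cmod (peak_base q w))\<^sup>2 \<le> a" if "w \<in> ball 0 1" "\<delta> \<le> cmod (w - q)" for w
  proof -
    have "\<delta>\<^sup>2 \<le> (cmod (w - q))\<^sup>2" using that \<delta> by (intro power_mono) auto
    then show ?thesis using peak_base_bound[OF q, of w] that by (simp add: a_def)
  qed
  define U where "U = ball 0 1 \<inter> {w. b < (cmod (peak_base q w))\<^sup>2}"
  have "open U" unfolding U_def peak_base_def
    by (intro open_Int open_ball open_Collect_less continuous_intros) auto
  moreover have "of_real (1 - \<delta>\<^sup>2 / 16) * q \<in> U"
  proof -
    have "cnj q * q = 1" using q by (simp add: complex_norm_square[symmetric] mult.commute)
    then have "cnj q * (of_real c * q) = of_real c" for c by (simp add: mult.left_commute)
    then have "peak_base q (of_real c * q) = of_real ((1 + c) / 2)" for c by (simp add: peak_base_def)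
    then have "peak_base q (of_real (1 - \<delta>\<^sup>2 / 16) * q) = of_real ((1 + (1 - \<delta>\<^sup>2 / 16)) / 2)" .
    also have "(1 + (1 - \<delta>\<^sup>2 / 16)) / 2 = 1 - \<delta>\<^sup>2 / 32" by simp
    finally have "peak_base q (of_real (1 - \<delta>\<^sup>2 / 16) * q) = of_real (1 - \<delta>\<^sup>2 / 32)" .
    then have "(cmod (peak_base q (of_real (1 - \<delta>\<^sup>2 / 16) * q)))\<^sup>2 = (1 - \<delta>\<^sup>2 / 32)\<^sup>2"
      by (simp only: norm_of_real power2_abs)
    also have "\<dots> = 1 - \<delta>\<^sup>2 / 16 + (\<delta>\<^sup>2 / 32)\<^sup>2" by (simp add: power2_diff)
    also have "\<dots> > b"
      using d2(1) zero_le_power2[of "\<delta>\<^sup>2 / 32"] unfolding b_def by linarith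
    finally show ?thesis using d2 q by (simp add: U_def norm_mult flip: of_real_diff)
  qed
  ultimately obtain s where s: "s > 0" "ball (of_real (1 - \<delta>\<^sup>2 / 16) * q) s \<subseteq> U"
    using open_contains_ball by blast
  define m where "m = measure lborel (ball (of_real (1 - \<delta>\<^sup>2 / 16) * q) s)"
  have m: "0 < m" using s(1) by (simp add: m_def content_ball)
  have low: "m * b ^ j \<le> disc_energy (\<lambda>w. peak_base q w ^ j)" for j
  proof -
    have "b ^ j * m \<le> disc_energy (\<lambda>w. peak_base q w ^ j)"
      unfolding m_def
    proof (rule disc_energy_ball_lower[OF disc_function_peak_base_power])
      show "b ^ j \<le> (cmod (peak_base q w ^ j))\<^sup>2" if "w \<in> ball (of_real (1 - \<delta>\<^sup>2 / 16) * q) s" for w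
      proof -
        have "w \<in> U" using that s(2) by blast
        then show ?thesis unfolding cmod_power_square using ab(3) by (intro power_mono) (auto simp: U_def)
      qed
    qed (use s(2) in \<open>auto simp: U_def\<close>)
    then show ?thesis by (simp add: mult.commute)
  qed
  show thesis using that[OF ab(1,2) m far low] by blast
qed

lemma peak_base_energy_pos:
  assumes "cmod q = 1"
  shows "0 < disc_energy (\<lambda>w. peak_base q w ^ j)"
proof -
  show ?thesis
  proof (rule peak_base_power_concentrates[OF assms, of 1])
    fix a b m :: real
    assume "0 \<le> a" "a < b" "0 < m" and low: "\<And>j. m * b ^ j \<le> disc_energy (\<lambda>w. peak_base q w ^ j)"
    then have "0 < m * b ^ j" by simp
    also have "\<dots> \<le> disc_energy (\<lambda>w. peak_base q w ^ j)" by (rule low)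
    finally show ?thesis .
  qed auto
qed

lemma disc_energy_peak:
  assumes "cmod q = 1"
  shows "disc_energy (peak q j) = 1"
proof -
  have "disc_energy (peak q j) = (cmod (of_real (1 / sqrt (disc_energy (\<lambda>w. peak_base q w ^ j)))))\<^sup>2
      * disc_energy (\<lambda>w. peak_base q w ^ j)"
    unfolding peak_def by (rule disc_energy_cmult[OF disc_function_peak_base_power])
  then show ?thesis using peak_base_energy_pos[OF assms, of j]
    by (simp add: norm_divide power_divide)
qed

text \<open>Near \<open>q\<close> the factor \<open>chi w - chi q\<close> is small, elsewhere it is bounded and the peaks carry almost no
  mass.\<close>

lemma peak_approximate_evaluation:
  fixes chi :: "complex \<Rightarrow> complex"
  assumes q: "cmod q = 1" and chi: "continuous_on (cball 0 1) chi"
  shows "(\<lambda>j. disc_energy (\<lambda>w. (chi w - chi q) * peak q j w)) \<longlonglongrightarrow> 0"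
proof (rule LIMSEQ_I)
  fix \<epsilon> :: real assume \<epsilon>: "0 < \<epsilon>"
  define k where "k w = chi w - chi q" for w
  have kcont: "continuous_on (cball 0 1) k" unfolding k_def by (intro continuous_intros chi)
  have kdisc: "disc_function k" by (rule disc_function_continuous[OF kcont])
  obtain M where M: "\<And>w. w \<in> ball 0 1 \<Longrightarrow> cmod (k w) \<le> M"
    using kdisc unfolding disc_function_def by blast
  have "q \<in> cball 0 1" using q by simp
  from kcont[unfolded continuous_on_iff, rule_format, OF this, of "sqrt (\<epsilon>/2)"]
  obtain \<delta>0 where \<delta>0: "\<delta>0 > 0" "\<And>w. w \<in> cball 0 1 \<Longrightarrow> dist w q < \<delta>0 \<Longrightarrow> dist (k w) (k q) < sqrt (\<epsilon>/2)"
    using \<epsilon> by auto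
  define \<delta> where "\<delta> = min 1 \<delta>0"
  have \<delta>: "0 < \<delta>" "\<delta> \<le> 1" using \<delta>0 by (auto simp: \<delta>_def)
  have near: "(cmod (k w))\<^sup>2 \<le> \<epsilon>/2" if "w \<in> ball 0 1" "cmod (w - q) < \<delta>" for w
  proof -
    have "cmod (k w) < sqrt (\<epsilon>/2)"
      using \<delta>0(2)[of w] that by (simp add: \<delta>_def dist_norm k_def)
    then have "(cmod (k w))\<^sup>2 \<le> (sqrt (\<epsilon>/2))\<^sup>2" by (intro power_mono) auto
    then show ?thesis using \<epsilon> by simp
  qed
  obtain a b m where ab: "0 \<le> a" "a < b" "0 < m"
    and far: "\<And>w. w \<in> ball 0 1 \<Longrightarrow> \<delta> \<le> cmod (w - q) \<Longrightarrow> (cmod (peak_base q w))\<^sup>2 \<le> a"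
    and low: "\<And>j. m * b ^ j \<le> disc_energy (\<lambda>w. peak_base q w ^ j)"
    using peak_base_power_concentrates[OF q \<delta>] by blast
  define N where "N j = disc_energy (\<lambda>w. peak_base q w ^ j)" for j
  define A where "A = M\<^sup>2 * measure lborel (ball (0::complex) 1)"
  have N: "0 < N j" for j unfolding N_def by (rule peak_base_energy_pos[OF q])
  have A0: "0 \<le> A" by (simp add: A_def)
  have est: "disc_energy (\<lambda>w. k w * peak_base q w ^ j) \<le> \<epsilon>/2 * N j + A * a ^ j" for j
  proof -
    have "disc_energy (\<lambda>w. k w * peak_base q w ^ j) \<le>
      (LINT w|lborel. \<epsilon>/2 * (cmod (zero_ext (\<lambda>w. peak_base q w ^ j) w))\<^sup>2 + M\<^sup>2 * a ^ j * (cmod (zero_ext (\<lambda>_. 1) w))\<^sup>2)"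
      unfolding disc_energy_def
    proof (rule integral_mono)
      show "integrable lborel (\<lambda>w. (cmod (zero_ext (\<lambda>w. k w * peak_base q w ^ j) w))\<^sup>2)"
        by (intro zero_ext_integrable disc_function_mult kdisc disc_function_peak_base_power)
      show "integrable lborel (\<lambda>w. \<epsilon>/2 * (cmod (zero_ext (\<lambda>w. peak_base q w ^ j) w))\<^sup>2 + M\<^sup>2 * a ^ j * (cmod (zero_ext (\<lambda>_. 1) w))\<^sup>2)"
        by (intro Bochner_Integration.integrable_add integrable_mult_right zero_ext_integrable
            disc_function_peak_base_power disc_function_const)
      fix w :: complex
      show "(cmod (zero_ext (\<lambda>w. k w * peak_base q w ^ j) w))\<^sup>2 \<le>
        \<epsilon>/2 * (cmod (zero_ext (\<lambda>w. peak_base q w ^ j) w))\<^sup>2 + M\<^sup>2 * a ^ j * (cmod (zero_ext (\<lambda>_. 1) w))\<^sup>2"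
      proof (cases "w \<in> ball 0 1")
        case w: True
        define p where "p = (cmod (peak_base q w ^ j))\<^sup>2"
        have p0: "0 \<le> p" by (simp add: p_def)
        have "(cmod (k w))\<^sup>2 * p \<le> \<epsilon>/2 * p + M\<^sup>2 * a ^ j"
        proof (cases "cmod (w - q) < \<delta>")
          case True
          then have "(cmod (k w))\<^sup>2 * p \<le> \<epsilon>/2 * p" by (intro mult_right_mono near w p0)
          then show ?thesis using ab(1) by (simp add: add_increasing2)
        next
          case False
          have "p \<le> a ^ j" unfolding p_def cmod_power_square
            by (intro power_mono far w) (use False in auto)
          then have "(cmod (k w))\<^sup>2 * p \<le> M\<^sup>2 * a ^ j"
            using M[OF w] p0 by (intro mult_mono power_mono) auto
          then show ?thesis using \<epsilon> p0 by (simp add: add_increasing)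
        qed
        then show ?thesis using w by (simp add: zero_ext_def norm_mult power_mult_distrib p_def)
      qed (simp add: zero_ext_def)
    qed
    also have "\<dots> = \<epsilon>/2 * N j + M\<^sup>2 * a ^ j * disc_energy (\<lambda>_. 1)"
      unfolding N_def disc_energy_def
      by (subst Bochner_Integration.integral_add)
        (auto intro!: zero_ext_integrable disc_function_peak_base_power disc_function_const)
    finally show ?thesis by (simp add: A_def disc_energy_one mult_ac)
  qed
  have "(\<lambda>j. A / m * (a / b) ^ j) \<longlonglongrightarrow> A / m * 0"
    by (intro tendsto_mult tendsto_const LIMSEQ_power_zero) (use ab in auto)
  then have "\<forall>\<^sub>F j in sequentially. A / m * (a / b) ^ j < \<epsilon>/2"
    using \<epsilon> by (intro order_tendstoD(2)) auto
  then obtain J where J: "\<And>j. j \<ge> J \<Longrightarrow> A / m * (a / b) ^ j < \<epsilon>/2"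
    by (auto simp: eventually_sequentially)
  have "norm (disc_energy (\<lambda>w. (chi w - chi q) * peak q j w) - 0) < \<epsilon>" if j: "j \<ge> J" for j
  proof -
    have dk: "disc_function (\<lambda>w. k w * peak_base q w ^ j)"
      by (intro disc_function_mult kdisc disc_function_peak_base_power)
    have "(\<lambda>w. (chi w - chi q) * peak q j w) = (\<lambda>w. of_real (1 / sqrt (N j)) * (k w * peak_base q w ^ j))"
      by (simp add: peak_def N_def k_def mult_ac)
    then have "disc_energy (\<lambda>w. (chi w - chi q) * peak q j w) =
        (cmod (of_real (1 / sqrt (N j))))\<^sup>2 * disc_energy (\<lambda>w. k w * peak_base q w ^ j)"
      by (simp only: disc_energy_cmult[OF dk])
    also have "\<dots> = disc_energy (\<lambda>w. k w * peak_base q w ^ j) / N j"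
      using N[of j] by (simp add: norm_divide power_divide)
    also have "\<dots> \<le> (\<epsilon>/2 * N j + A * a ^ j) / N j"
      using est N[of j] by (intro divide_right_mono) auto
    also have "\<dots> = \<epsilon>/2 + A * a ^ j / N j" using N[of j] by (simp add: add_divide_distrib)
    also have "A * a ^ j / N j \<le> A * a ^ j / (m * b ^ j)"
      using low[of j] ab A0 by (intro divide_left_mono) (auto simp: N_def[symmetric] N)
    also have "A * a ^ j / (m * b ^ j) = A / m * (a / b) ^ j" by (simp add: power_divide)
    also have "\<epsilon>/2 + A / m * (a / b) ^ j < \<epsilon>" using J[OF j] by linarith
    finally have "disc_energy (\<lambda>w. (chi w - chi q) * peak q j w) < \<epsilon>" by simp
    moreover have "0 \<le> disc_energy (\<lambda>w. (chi w - chi q) * peak q j w)" by (simp add: disc_energy_def)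
    ultimately show ?thesis by simp
  qed
  then show "\<exists>J. \<forall>j\<ge>J. norm (disc_energy (\<lambda>w. (chi w - chi q) * peak q j w) - 0) < \<epsilon>" by blast
qed

lemma norm_tensor_peak: "cmod q = 1 \<Longrightarrow> norm (tensor x (peak q j)) = norm x"
  by (simp add: norm_tensor disc_function_peak disc_energy_peak)

lemma norm_tensor_peak_error:
  fixes chi :: "complex \<Rightarrow> complex"
  assumes q: "cmod q = 1" and chi: "continuous_on (cball 0 1) chi"
  shows "(\<lambda>j. norm (tensor x (\<lambda>w. (chi w - chi q) * peak q j w))) \<longlonglongrightarrow> 0"
proof -
  have d: "disc_function (\<lambda>w. (chi w - chi q) * peak q j w)" for j
    by (intro disc_function_mult disc_function_peak disc_function_continuous continuous_intros chi)
  have "(\<lambda>j. norm x * sqrt (disc_energy (\<lambda>w. (chi w - chi q) * peak q j w))) \<longlonglongrightarrow> norm x * sqrt 0"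
    by (intro tendsto_intros peak_approximate_evaluation assms)
  then show ?thesis by (simp add: norm_tensor[OF d])
qed

text \<open>Split \<open>k\<close> by a cut-off \<open>E l\<close> that vanishes where the last coordinate is \<open>q\<close>. The part \<open>E l k\<close> does not
  see the peaks by the previous estimate applied to the cut-off, and \<open>k - E l k\<close> tends to zero in norm
  by dominated convergence, as the last coordinate of a point of the polydisc is never \<open>q\<close>. The bound
  depends on \<open>x\<close> through its norm only, so that \<open>j\<close> can be chosen after \<open>k\<close> and independently of \<open>x\<close>.\<close>

lemma peak_weakly_null:
  fixes k :: "'m::finite option disc_fun"
  assumes q: "cmod q = 1" and e: "0 < e"
  shows "\<exists>J. \<forall>j\<ge>J. \<forall>x. \<bar>inner (tensor x (peak q j)) k\<bar> \<le> e * norm x"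
proof -
  \<comment> \<open>\<open>\<eta> l\<close> vanishes at \<open>q\<close> and equals \<open>1\<close> outside the ball of radius \<open>1 / l\<close> about \<open>q\<close>\<close>
  define \<eta> where "\<eta> l w = complex_of_real (min 1 (real l * cmod (w - q)))" for l :: nat and w
  define E where "E l v = \<eta> l (v $ None)" for l and v :: "complex ^ ('m option)"
  have \<eta>c: "continuous_on S (\<eta> l)" for l S unfolding \<eta>_def by (intro continuous_intros)
  have \<eta>d: "disc_function (\<eta> l)" for l by (intro disc_function_continuous \<eta>c)
  have \<eta>1: "cmod (1 - \<eta> l w) \<le> 1" "cmod (\<eta> l w) \<le> 1" for l w
  proof -
    define t where "t = min 1 (real l * cmod (w - q))"
    have t: "0 \<le> t" "t \<le> 1" by (auto simp: t_def)
    have "\<eta> l w = of_real t" "1 - \<eta> l w = of_real (1 - t)" by (simp_all add: \<eta>_def t_def)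
    then show "cmod (1 - \<eta> l w) \<le> 1" "cmod (\<eta> l w) \<le> 1" using t by (simp_all only: norm_of_real)
  qed
  have Em: "multiplier (E l)" for l
    unfolding multiplier_def E_def
    by (intro conjI exI[of _ 1] ballI continuous_on_compose2[OF \<eta>c[of UNIV]] continuous_intros)
      (auto simp: \<eta>1)
  have small: "(\<lambda>l. (norm (k - mul (E l) k))\<^sup>2) \<longlonglongrightarrow> 0"
  proof -
    have "(\<lambda>l. LINT v|lborel. (cmod (fn (k - mul (E l) k) v))\<^sup>2) \<longlonglongrightarrow> (LINT v|(lborel :: (complex ^ ('m option)) measure). 0)"
    proof (rule integral_dominated_convergence)
      show "integrable lborel (\<lambda>v. (cmod (fn k v))\<^sup>2)" by (rule fn_integrable_square)
      show "AE v in lborel. (\<lambda>l. (cmod (fn (k - mul (E l) k) v))\<^sup>2) \<longlonglongrightarrow> 0"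
      proof (rule AE_I2)
        fix v :: "complex ^ ('m option)"
        show "(\<lambda>l. (cmod (fn (k - mul (E l) k) v))\<^sup>2) \<longlonglongrightarrow> 0"
        proof (cases "v \<in> polydisc")
          case True
          then have "v $ None \<noteq> q" using q by (auto simp: polydisc_init_iff)
          then have pos: "0 < cmod (v $ None - q)" by simp
          obtain L where L: "1 < real L * cmod (v $ None - q)" using reals_Archimedean3[OF pos] by blast
          have "fn (k - mul (E l) k) v = 0" if "l \<ge> L" for l
          proof -
            have "real L * cmod (v $ None - q) \<le> real l * cmod (v $ None - q)"
              using that by (intro mult_right_mono) auto
            then have "min 1 (real l * cmod (v $ None - q)) = 1" using L by simp
            then have "E l v = 1" unfolding E_def \<eta>_def by (simp only: of_real_1)
            then show ?thesis by (simp add: fn_simps fn_mul[OF Em])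
          qed
          then have "\<forall>\<^sub>F l in sequentially. (cmod (fn (k - mul (E l) k) v))\<^sup>2 = 0"
            unfolding eventually_sequentially by (intro exI[of _ L]) simp
          then show ?thesis by (rule tendsto_eventually)
        qed (simp add: fn_outside)
      qed
      show "AE v in lborel. norm ((cmod (fn (k - mul (E l) k) v))\<^sup>2) \<le> (cmod (fn k v))\<^sup>2" for l
      proof (rule AE_I2)
        fix v :: "complex ^ ('m option)"
        have "fn (k - mul (E l) k) v = (1 - E l v) * fn k v"
          by (simp add: fn_simps fn_mul[OF Em] algebra_simps)
        then have "cmod (fn (k - mul (E l) k) v) \<le> 1 * cmod (fn k v)"
          unfolding E_def by (simp only: norm_mult) (intro mult_right_mono \<eta>1, simp)
        then show "norm ((cmod (fn (k - mul (E l) k) v))\<^sup>2) \<le> (cmod (fn k v))\<^sup>2" by simp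
      qed
    qed simp_all
    then show ?thesis by (simp add: norm_square_integral)
  qed
  have "\<forall>\<^sub>F l in sequentially. (norm (k - mul (E l) k))\<^sup>2 < (e/2)\<^sup>2"
    using e by (intro order_tendstoD(2)[OF small]) auto
  then obtain l where "(norm (k - mul (E l) k))\<^sup>2 < (e/2)\<^sup>2" by (auto simp: eventually_sequentially)
  then have l: "norm (k - mul (E l) k) < e/2" by (rule power2_less_imp_less) (use e in simp)
  have "\<eta> l q = 0" by (simp add: \<eta>_def)
  then have "(\<lambda>j. sqrt (disc_energy (\<lambda>w. \<eta> l w * peak q j w)) * norm k) \<longlonglongrightarrow> sqrt 0 * norm k"
    using peak_approximate_evaluation[OF q \<eta>c, of l] by (intro tendsto_intros) simp
  then have "\<forall>\<^sub>F j in sequentially. sqrt (disc_energy (\<lambda>w. \<eta> l w * peak q j w)) * norm k < e/2"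
    using e by (intro order_tendstoD(2)) auto
  then obtain J where J: "\<And>j. j \<ge> J \<Longrightarrow> sqrt (disc_energy (\<lambda>w. \<eta> l w * peak q j w)) * norm k < e/2"
    by (auto simp: eventually_sequentially)
  have "\<bar>inner (tensor x (peak q j)) k\<bar> \<le> e * norm x" if j: "j \<ge> J" for j x
  proof -
    have "(\<lambda>v. cnj (E l v)) = E l" by (simp add: E_def \<eta>_def fun_eq_iff)
    then have adj: "inner (tensor x (peak q j)) (mul (E l) k) = inner (mul (E l) (tensor x (peak q j))) k"
      using inner_mul[OF Em, of l "tensor x (peak q j)" k] by simp
    have "mul (E l) (tensor x (peak q j)) = tensor (mul (\<lambda>_. 1) x) (\<lambda>w. \<eta> l w * peak q j w)"
      by (rule mul_tensor) (auto simp: E_def Em \<eta>d disc_function_peak)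
    also have "mul (\<lambda>_. 1) x = x" by (rule disc_fun_eqI) (simp add: fn_mul)
    finally have n: "norm (mul (E l) (tensor x (peak q j))) = norm x * sqrt (disc_energy (\<lambda>w. \<eta> l w * peak q j w))"
      by (simp add: norm_tensor disc_function_mult \<eta>d disc_function_peak)
    have "\<bar>inner (tensor x (peak q j)) k\<bar> =
        \<bar>inner (mul (E l) (tensor x (peak q j))) k + inner (tensor x (peak q j)) (k - mul (E l) k)\<bar>"
      unfolding adj[symmetric] by (simp add: inner_diff_right)
    also have "\<dots> \<le> norm (mul (E l) (tensor x (peak q j))) * norm k
        + norm (tensor x (peak q j)) * norm (k - mul (E l) k)"
      by (intro order_trans[OF abs_triangle_ineq] add_mono Cauchy_Schwarz_ineq2)
    also have "\<dots> = norm x * (sqrt (disc_energy (\<lambda>w. \<eta> l w * peak q j w)) * norm k) + norm x * norm (k - mul (E l) k)"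
      by (simp add: n norm_tensor_peak[OF q])
    also have "\<dots> \<le> norm x * (e/2) + norm x * (e/2)"
      using J[OF j] l by (intro add_mono mult_left_mono) auto
    finally show ?thesis by (simp add: mult.commute)
  qed
  then show ?thesis by blast
qed


section \<open>The Hankel operator on the Bergman space of the polydisc\<close>

lemmas hol_space = subspace_hol complete_hol

text \<open>These are \<open>H\<^sub>\<psi>\<close> and \<open>H\<^sub>\<psi>\<^sup>* H\<^sub>\<psi>\<close> on the type \<open>disc_fun\<close>. The adjoint is \<open>u \<mapsto> P (cnj \<psi> (u - P u))\<close>, and
  \<open>P u = 0\<close> for \<open>u\<close> in the range of \<open>H\<^sub>\<psi>\<close>.\<close>

definition hank :: "(complex ^ 'n \<Rightarrow> complex) \<Rightarrow> 'n::finite disc_fun \<Rightarrow> 'n disc_fun" where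
  "hank \<psi> x = mul \<psi> x - proj hol (mul \<psi> x)"

definition hank_sq :: "(complex ^ 'n \<Rightarrow> complex) \<Rightarrow> 'n::finite disc_fun \<Rightarrow> 'n disc_fun" where
  "hank_sq \<psi> x = proj hol (mul (\<lambda>z. cnj (\<psi> z)) (hank \<psi> x))"

lemma inner_hank:
  assumes "multiplier \<psi>" "y \<in> hol"
  shows "inner (hank_sq \<psi> x) y = inner (hank \<psi> x) (hank \<psi> y)"
proof -
  have "inner (hank_sq \<psi> x) y = inner (hank \<psi> x) (mul \<psi> y)"
    using inner_mul[OF multiplier_cnj[OF assms(1)]]
    by (simp add: hank_sq_def inner_proj[OF hol_space assms(2)])
  also have "inner (hank \<psi> x) (proj hol (mul \<psi> y)) = 0"
    unfolding hank_def by (rule proj_orthogonal[OF hol_space proj_in[OF hol_space]])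
  then have "inner (hank \<psi> x) (mul \<psi> y) = inner (hank \<psi> x) (hank \<psi> y)"
    by (simp add: hank_def[of \<psi> y] inner_diff_right)
  finally show ?thesis .
qed

lemma bounded_linear_hank_sq:
  assumes "multiplier \<psi>"
  shows "bounded_linear (hank_sq \<psi>)"
proof -
  have "bounded_linear (hank \<psi>)"
    unfolding hank_def
    by (intro bounded_linear_sub bounded_linear_mul assms
        bounded_linear_compose[OF bounded_linear_proj[OF hol_space]])
  then show ?thesis
    unfolding hank_sq_def
    by (intro bounded_linear_compose[OF bounded_linear_proj[OF hol_space]]
        bounded_linear_compose[OF bounded_linear_mul[OF multiplier_cnj[OF assms]]])
qed

lemma symmetric_operator_hank_sq:
  assumes "multiplier \<psi>"
  shows "symmetric_operator hol (hank_sq \<psi>)"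
proof (rule symmetric_operator.intro)
  show "hank_sq \<psi> x \<in> hol" for x unfolding hank_sq_def by (rule proj_in[OF hol_space])
  show "inner (hank_sq \<psi> x) y = inner x (hank_sq \<psi> y)" if "x \<in> hol" "y \<in> hol" for x y
    using inner_hank[OF assms that(2), of x] inner_hank[OF assms that(1), of y]
    by (simp add: inner_commute)
qed (use subspace_hol complete_hol bounded_linear_hank_sq[OF assms] in auto)

lemma proj_mul_const: "proj hol (mul (\<lambda>_. c) x) = mul (\<lambda>_. c) (proj hol x)"
proof (rule proj_eqI[OF hol_space])
  show "mul (\<lambda>_. c) (proj hol x) \<in> hol" by (intro mul_const_hol proj_in[OF hol_space])
  fix h :: "'a disc_fun" assume "h \<in> hol"
  then have "inner (x - proj hol x) (mul (\<lambda>_. cnj c) h) = 0"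
    by (intro proj_orthogonal[OF hol_space] mul_const_hol)
  then show "inner (mul (\<lambda>_. c) x - mul (\<lambda>_. c) (proj hol x)) h = 0"
    by (simp add: inner_diff_left inner_mul)
qed

lemma hank_sq_mul_const:
  assumes "multiplier \<psi>"
  shows "hank_sq \<psi> (mul (\<lambda>_. c) x) = mul (\<lambda>_. c) (hank_sq \<psi> x)"
proof -
  interpret C: bounded_linear "mul (\<lambda>_. c)" by (rule bounded_linear_mul) simp
  have "hank \<psi> (mul (\<lambda>_. c) x) = mul (\<lambda>_. c) (hank \<psi> x)"
    unfolding hank_def by (simp add: mul_mul_commute[OF assms] proj_mul_const C.diff)
  then show ?thesis
    unfolding hank_sq_def by (simp add: mul_mul_commute[OF multiplier_cnj[OF assms]] proj_mul_const)
qed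

lemma bergman_projection_fn: "bergman_projection polydisc (fn x) = fn (proj hol x)"
  unfolding bergman_projection_def
proof (rule the_equality)
  have eq: "L2_inner polydisc (\<lambda>z. fn x z - fn g z) (fn h) = cinner (x - g) h" for g h
    by (simp flip: L2_inner_fn add: fn_simps)
  show "fn (proj hol x) \<in> bergman_space polydisc \<and>
    (\<forall>h\<in>bergman_space polydisc. L2_inner polydisc (\<lambda>z. fn x z - fn (proj hol x) z) h = 0)"
    unfolding bergman_space_polydisc
    by (auto simp: eq proj_in[OF hol_space] intro!: cinner_eq_0_hol proj_orthogonal[OF hol_space])
  fix g assume "g \<in> bergman_space polydisc \<and>
    (\<forall>h\<in>bergman_space polydisc. L2_inner polydisc (\<lambda>z. fn x z - g z) h = 0)"
  then obtain g' where g': "g' \<in> hol" "g = fn g'" "\<And>h. h \<in> hol \<Longrightarrow> cinner (x - g') h = 0"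
    unfolding bergman_space_polydisc by (auto simp: eq)
  have "proj hol x = g'"
    by (rule proj_eqI[OF hol_space g'(1)]) (simp add: inner_disc_fun_def g'(3))
  then show "g = fn (proj hol x)" using g' by simp
qed

lemma hankel_fn: "multiplier \<psi> \<Longrightarrow> hankel polydisc \<psi> (fn x) = fn (hank \<psi> x)"
  using bergman_projection_fn[of "mul \<psi> x"]
  by (simp add: hankel_def hank_def fn_simps fn_mul)

lemma hankel_star_hankel_fn:
  fixes x :: "'n::finite disc_fun"
  assumes \<psi>: "multiplier \<psi>"
  shows "hankel_star_hankel polydisc \<psi> (fn x) = fn (hank_sq \<psi> x)"
  unfolding hankel_star_hankel_def comp_def hankel_fn[OF \<psi>] bergman_adjoint_def
proof (rule the_equality)
  have adj: "cinner (hank \<psi> f) (hank \<psi> x) = cinner f (hank_sq \<psi> x)" if f: "f \<in> hol" for f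
  proof -
    have re: "inner (hank \<psi> f) (hank \<psi> y) = inner f (hank_sq \<psi> y)" for y
      using inner_hank[OF \<psi> f, of y] by (simp add: inner_commute)
    interpret C: bounded_linear "mul (\<lambda>_. \<i>) :: 'n disc_fun \<Rightarrow> _" by (rule bounded_linear_mul) simp
    have "mul (\<lambda>_. \<i>) (hank \<psi> x) = hank \<psi> (mul (\<lambda>_. \<i>) x)"
      unfolding hank_def by (simp add: mul_mul_commute[OF \<psi>] proj_mul_const C.diff)
    then show ?thesis
      by (simp add: cinner_eq_inner re flip: hank_sq_mul_const[OF \<psi>])
  qed
  have inV: "hank_sq \<psi> x \<in> hol" by (simp add: hank_sq_def proj_in[OF hol_space])
  show "fn (hank_sq \<psi> x) \<in> bergman_space polydisc \<and> (\<forall>f\<in>bergman_space polydisc.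
    L2_inner polydisc (hankel polydisc \<psi> f) (fn (hank \<psi> x)) = L2_inner polydisc f (fn (hank_sq \<psi> x)))"
    unfolding bergman_space_polydisc
    by (auto simp: hankel_fn[OF \<psi>] L2_inner_fn adj inV)
  fix g assume "g \<in> bergman_space polydisc \<and> (\<forall>f\<in>bergman_space polydisc.
    L2_inner polydisc (hankel polydisc \<psi> f) (fn (hank \<psi> x)) = L2_inner polydisc f g)"
  then obtain g' where g': "g' \<in> hol" "g = fn g'"
    "\<And>f. f \<in> hol \<Longrightarrow> cinner (hank \<psi> f) (hank \<psi> x) = cinner f g'"
    unfolding bergman_space_polydisc by (auto simp: hankel_fn[OF \<psi>] L2_inner_fn)
  define d where "d = g' - hank_sq \<psi> x"
  have d: "d \<in> hol" unfolding d_def by (rule subspace_diff[OF subspace_hol g'(1) inV])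
  have "inner d g' = inner d (hank_sq \<psi> x)"
    using g'(3)[OF d] adj[OF d] by (simp add: inner_disc_fun_def)
  then have "inner d d = 0" by (subst (2) d_def) (simp add: inner_diff_right)
  then show "g = fn (hank_sq \<psi> x)" using g'(2) by (simp add: d_def)
qed

section \<open>Spectra in terms of lower bounds\<close>

abbreviation shifted :: "(complex ^ 'n \<Rightarrow> complex) \<Rightarrow> complex \<Rightarrow> 'n::finite disc_fun \<Rightarrow> 'n disc_fun" where
  "shifted \<psi> \<zeta> x \<equiv> hank_sq \<psi> x - mul (\<lambda>_. \<zeta>) x"

abbreviation hankel_spectrum :: "(complex ^ 'n \<Rightarrow> complex) \<Rightarrow> complex set" where
  "hankel_spectrum \<psi> \<equiv> spectrum_on (bergman_space polydisc) (L2_norm polydisc) (hankel_star_hankel polydisc \<psi>)"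

lemma shifted_operator_fn:
  "multiplier \<psi> \<Longrightarrow> shifted_operator (hankel_star_hankel polydisc \<psi>) \<zeta> (fn x) = fn (shifted \<psi> \<zeta> x)"
  by (simp add: shifted_operator_def hankel_star_hankel_fn fn_simps fn_mul)

lemma mul_of_real: "mul (\<lambda>_. of_real r) x = r *\<^sub>R x"
  by (rule disc_fun_eqI) (simp add: fn_mul fn_simps)

lemma shifted_real: "shifted \<psi> (of_real t) x = hank_sq \<psi> x - t *\<^sub>R x"
  by (simp add: mul_of_real)

lemma bounded_linear_shifted: "multiplier \<psi> \<Longrightarrow> bounded_linear (shifted \<psi> \<zeta>)"
  by (intro bounded_linear_sub bounded_linear_hank_sq bounded_linear_mul) auto

lemma shifted_in_hol: "x \<in> hol \<Longrightarrow> shifted \<psi> \<zeta> x \<in> hol"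
  by (intro subspace_diff[OF subspace_hol] mul_const_hol) (simp_all add: hank_sq_def proj_in[OF hol_space])

lemma bounded_below_of_not_in_spectrum:
  assumes \<psi>: "multiplier \<psi>" and \<zeta>: "\<zeta> \<notin> hankel_spectrum \<psi>"
  shows "\<exists>c>0. \<forall>x\<in>hol. c * norm x \<le> norm (shifted \<psi> \<zeta> x)"
proof -
  obtain S where S: "bounded_operator_on (bergman_space polydisc) (L2_norm polydisc) S"
    "\<And>f. f \<in> bergman_space polydisc \<Longrightarrow> S (shifted_operator (hankel_star_hankel polydisc \<psi>) \<zeta> f) = f"
    using \<zeta> unfolding spectrum_on_def by blast
  obtain K where K: "\<And>f. f \<in> bergman_space polydisc \<Longrightarrow> L2_norm polydisc (S f) \<le> K * L2_norm polydisc f"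
    using S(1) unfolding bounded_operator_on_def by blast
  have "1 / (\<bar>K\<bar> + 1) * norm x \<le> norm (shifted \<psi> \<zeta> x)" if x: "x \<in> hol" for x
  proof -
    have "norm x = L2_norm polydisc (S (fn (shifted \<psi> \<zeta> x)))"
      using S(2)[of "fn x"] x by (simp add: bergman_space_polydisc shifted_operator_fn[OF \<psi>] L2_norm_fn)
    also have "\<dots> \<le> K * norm (shifted \<psi> \<zeta> x)"
      using K[of "fn (shifted \<psi> \<zeta> x)"] shifted_in_hol[OF x] by (simp add: bergman_space_polydisc L2_norm_fn)
    also have "\<dots> \<le> (\<bar>K\<bar> + 1) * norm (shifted \<psi> \<zeta> x)" by (intro mult_right_mono) auto
    finally show ?thesis by (simp add: field_simps add_nonneg_pos)
  qed
  then show ?thesis by (intro exI[of _ "1 / (\<bar>K\<bar> + 1)"]) (auto simp: add_nonneg_pos)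
qed

text \<open>The operators \<open>T - \<zeta>\<close> and \<open>T - cnj \<zeta>\<close> are adjoint to each other, so lower bounds for both make
  \<open>T - \<zeta>\<close> bijective; its inverse is bounded by the reciprocal of the lower bound.\<close>

lemma not_in_spectrum_of_bounded_below:
  fixes \<psi> :: "complex ^ 'n::finite \<Rightarrow> complex"
  assumes \<psi>: "multiplier \<psi>"
    and c: "0 < c" "\<And>x. x \<in> hol \<Longrightarrow> c * norm x \<le> norm (shifted \<psi> \<zeta> x)"
    and c': "0 < c'" "\<And>x. x \<in> hol \<Longrightarrow> c' * norm x \<le> norm (shifted \<psi> (cnj \<zeta>) x)"
  shows "\<zeta> \<notin> hankel_spectrum \<psi>"
proof -
  let ?A = "shifted \<psi> \<zeta>"
  interpret L: bounded_linear ?A by (rule bounded_linear_shifted[OF \<psi>])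
  interpret H: symmetric_operator hol "hank_sq \<psi>" by (rule symmetric_operator_hank_sq[OF \<psi>])
  have "\<exists>x\<in>hol. ?A x = y" if y: "y \<in> hol" for y
  proof (rule surjective_of_bounded_below[OF hol_space bounded_linear_shifted[OF \<psi>] _ _ c _ _ y])
    show "inner (?A x) y = inner x (shifted \<psi> (cnj \<zeta>) y)" if "x \<in> hol" "y \<in> hol" for x y
      using H.symmetric[OF that] by (simp add: inner_diff_left inner_diff_right inner_mul)
    show "y = 0" if "y \<in> hol" "shifted \<psi> (cnj \<zeta>) y = 0" for y
      using c'(2)[OF that(1)] that(2) c'(1) by (simp add: mult_le_0_iff)
  qed (auto intro: shifted_in_hol)
  then have "\<exists>R. \<forall>y\<in>hol. R y \<in> hol \<and> ?A (R y) = y" by (intro bchoice) blast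
  then obtain R where R: "\<And>y. y \<in> hol \<Longrightarrow> R y \<in> hol" "\<And>y. y \<in> hol \<Longrightarrow> ?A (R y) = y" by blast
  have inj: "x = y" if "x \<in> hol" "y \<in> hol" "?A x = ?A y" for x y
  proof -
    have "?A (x - y) = 0" using that(3) by (simp only: L.diff diff_self)
    moreover have "x - y \<in> hol" using that by (intro subspace_diff[OF subspace_hol])
    ultimately have "c * norm (x - y) \<le> 0" using c(2)[of "x - y"] by (simp only: norm_zero)
    then show ?thesis using c(1) by (simp add: mult_le_0_iff)
  qed
  define S where "S f = fn (R (disc_fun f))" for f
  have Sfn: "S (fn y) = fn (R y)" for y by (simp add: S_def fn_inverse)
  have "bounded_operator_on (bergman_space polydisc) (L2_norm polydisc) S"
    unfolding bounded_operator_on_def bergman_space_polydisc ball_simps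
  proof (intro conjI ballI allI)
    fix y :: "'n disc_fun" assume y: "y \<in> hol"
    show "S (fn y) \<in> fn ` hol" using R(1)[OF y] by (simp add: Sfn)
    show "S (\<lambda>z. fn y z + fn u z) = (\<lambda>z. S (fn y) z + S (fn u) z)" if u: "u \<in> hol" for u
    proof -
      have "R (y + u) = R y + R u"
      proof (rule inj)
        show "R (y + u) \<in> hol" "R y + R u \<in> hol"
          using R(1) y u by (auto intro: subspace_add[OF subspace_hol])
        have "y + u \<in> hol" using y u by (rule subspace_add[OF subspace_hol])
        then show "?A (R (y + u)) = ?A (R y + R u)" by (simp only: L.add R(2)[OF y] R(2)[OF u] R(2))
      qed
      then have "fn (R (y + u)) = (\<lambda>z. fn (R y) z + fn (R u) z)" by (simp add: fn_simps)
      moreover have "(\<lambda>z. fn y z + fn u z) = fn (y + u)" by (simp add: fn_simps)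
      ultimately show ?thesis by (simp only: Sfn)
    qed
    show "S (\<lambda>z. a * fn y z) = (\<lambda>z. a * S (fn y) z)" for a
    proof -
      interpret C: bounded_linear "mul (\<lambda>_. a) :: 'n disc_fun \<Rightarrow> _" by (rule bounded_linear_mul) simp
      have "?A (mul (\<lambda>_. a) (R y)) = mul (\<lambda>_. a) (?A (R y))"
        by (simp add: C.diff hank_sq_mul_const[OF \<psi>] mul_mul_commute[of "\<lambda>_. a"])
      then have "R (mul (\<lambda>_. a) y) = mul (\<lambda>_. a) (R y)"
        by (intro inj[OF R(1)[OF mul_const_hol[OF y]] mul_const_hol[OF R(1)[OF y]]])
          (simp only: R(2)[OF y] R(2)[OF mul_const_hol[OF y]])
      then have "fn (R (mul (\<lambda>_. a) y)) = (\<lambda>z. a * fn (R y) z)" by (simp add: fn_mul)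
      moreover have "(\<lambda>z. a * fn y z) = fn (mul (\<lambda>_. a) y)" by (simp add: fn_mul)
      ultimately show ?thesis by (simp only: Sfn)
    qed
  next
    show "\<exists>K. \<forall>y\<in>hol. L2_norm polydisc (S (fn y)) \<le> K * L2_norm polydisc (fn y)"
    proof (intro exI ballI)
      fix y :: "'n disc_fun" assume "y \<in> hol"
      then have "c * norm (R y) \<le> norm y" using c(2)[of "R y"] R by simp
      then show "L2_norm polydisc (S (fn y)) \<le> 1 / c * L2_norm polydisc (fn y)"
        using c(1) by (simp add: Sfn L2_norm_fn field_simps)
    qed
  qed
  moreover have "S (shifted_operator (hankel_star_hankel polydisc \<psi>) \<zeta> (fn x)) = fn x" if "x \<in> hol" for x
  proof -
    have "R (?A x) = x" 
      by (rule inj[OF R(1)[OF shifted_in_hol[OF that]] that R(2)[OF shifted_in_hol[OF that]]])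
    then show ?thesis by (simp only: shifted_operator_fn[OF \<psi>] Sfn)
  qed
  moreover have "shifted_operator (hankel_star_hankel polydisc \<psi>) \<zeta> (S (fn x)) = fn x" if "x \<in> hol" for x
    using R(2)[OF that] by (simp only: shifted_operator_fn[OF \<psi>] Sfn)
  ultimately have "\<exists>S. bounded_operator_on (bergman_space polydisc) (L2_norm polydisc) S \<and>
     (\<forall>f\<in>bergman_space polydisc. S (shifted_operator (hankel_star_hankel polydisc \<psi>) \<zeta> f) = f \<and>
        shifted_operator (hankel_star_hankel polydisc \<psi>) \<zeta> (S f) = f)"
    by (intro exI[of _ S]) (simp add: bergman_space_polydisc)
  then show ?thesis by (simp add: spectrum_on_def)
qed

text \<open>The real part of \<open>T - \<zeta>\<close> contributes nothing to the inner product of \<open>(T - \<zeta>) x\<close> with \<open>\<i> x\<close>, since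
  \<open>\<langle>T x, x\<rangle>\<close> is real for a symmetric \<open>T\<close>.\<close>

lemma shifted_nonreal_bounded_below:
  assumes \<psi>: "multiplier \<psi>" and x: "x \<in> hol"
  shows "\<bar>Im \<zeta>\<bar> * norm x \<le> norm (shifted \<psi> \<zeta> x)"
proof -
  interpret H: symmetric_operator hol "hank_sq \<psi>" by (rule symmetric_operator_hank_sq[OF \<psi>])
  define J where "J = mul (\<lambda>_. \<i>) x"
  have J: "J \<in> hol" unfolding J_def by (rule mul_const_hol[OF x])
  have skew: "inner (mul (\<lambda>_. \<i>) u) v = - inner u (mul (\<lambda>_. \<i>) v)" for u v :: "'a disc_fun"
  proof -
    have "mul (\<lambda>_. - \<i>) v = - mul (\<lambda>_. \<i>) v" by (rule disc_fun_eqI) (simp add: fn_mul fn_simps)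
    then show ?thesis by (simp add: inner_mul)
  qed
  have normJ: "norm J = norm x"
  proof -
    have "norm J \<le> 1 * norm x" unfolding J_def by (rule norm_mul_le) auto
    moreover have "x = mul (\<lambda>_. - \<i>) J" unfolding J_def by (rule disc_fun_eqI) (simp add: fn_mul)
    then have "norm x \<le> 1 * norm J" using norm_mul_le[of "\<lambda>_. - \<i>" 1 J] by simp
    ultimately show ?thesis by simp
  qed
  have "inner (hank_sq \<psi> x) J = 0"
  proof -
    have "inner (hank_sq \<psi> x) J = inner x (mul (\<lambda>_. \<i>) (hank_sq \<psi> x))"
      using H.symmetric[OF x J] by (simp add: J_def hank_sq_mul_const[OF \<psi>])
    also have "\<dots> = - inner J (hank_sq \<psi> x)" using skew[of x "hank_sq \<psi> x"] by (simp add: J_def)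
    finally show ?thesis by (simp add: inner_commute)
  qed
  moreover have "inner (mul (\<lambda>_. \<zeta>) x) J = Im \<zeta> * (norm x)\<^sup>2"
  proof -
    have "mul (\<lambda>_. \<zeta>) x = Re \<zeta> *\<^sub>R x + Im \<zeta> *\<^sub>R J"
      unfolding J_def
    proof (rule disc_fun_eqI)
      fix z :: "complex ^ 'a"
      have "\<zeta> = of_real (Re \<zeta>) + of_real (Im \<zeta>) * \<i>" by (simp add: complex_eq_iff)
      then show "fn (mul (\<lambda>_. \<zeta>) x) z = fn (Re \<zeta> *\<^sub>R x + Im \<zeta> *\<^sub>R mul (\<lambda>_. \<i>) x) z"
        by (simp add: fn_mul fn_simps) (metis distrib_right mult.assoc)
    qed
    moreover have "inner x J = 0" using skew[of x x] by (simp add: J_def inner_commute)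
    moreover have "inner J J = (norm x)\<^sup>2" by (simp add: normJ flip: power2_norm_eq_inner)
    ultimately show ?thesis by (simp add: inner_add_left)
  qed
  ultimately have "inner (shifted \<psi> \<zeta> x) J = - (Im \<zeta> * (norm x)\<^sup>2)" by (simp add: inner_diff_left)
  then have "\<bar>Im \<zeta>\<bar> * (norm x)\<^sup>2 = \<bar>inner (shifted \<psi> \<zeta> x) J\<bar>" by (simp add: abs_mult)
  also have "\<dots> \<le> norm (shifted \<psi> \<zeta> x) * norm x"
    using Cauchy_Schwarz_ineq2[of "shifted \<psi> \<zeta> x" J] by (simp add: normJ)
  finally have "(\<bar>Im \<zeta>\<bar> * norm x) * norm x \<le> norm (shifted \<psi> \<zeta> x) * norm x"
    by (simp add: power2_eq_square mult_ac)
  then show ?thesis by (cases "norm x = 0") (simp, simp only: mult_le_cancel_right_pos zero_less_norm_iff norm_eq_zero not_False_eq_True)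
qed

lemma spectrum_real:
  assumes \<psi>: "multiplier \<psi>" and \<zeta>: "\<zeta> \<in> hankel_spectrum \<psi>"
  shows "\<zeta> = of_real (Re \<zeta>)"
proof (rule ccontr)
  assume "\<zeta> \<noteq> of_real (Re \<zeta>)"
  then have pos: "0 < \<bar>Im \<zeta>\<bar>" by (auto simp: complex_eq_iff)
  have "\<zeta> \<notin> hankel_spectrum \<psi>"
    by (rule not_in_spectrum_of_bounded_below[OF \<psi> pos _ pos])
      (use shifted_nonreal_bounded_below[OF \<psi>, of _ \<zeta>] shifted_nonreal_bounded_below[OF \<psi>, of _ "cnj \<zeta>"] in auto)
  with \<zeta> show False by simp
qed

lemma approximate_eigenvector:
  assumes \<psi>: "multiplier \<psi>" and t: "of_real t \<in> hankel_spectrum \<psi>" and e: "0 < e"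
  shows "\<exists>x\<in>hol. norm x = 1 \<and> norm (hank_sq \<psi> x - t *\<^sub>R x) < e"
proof (rule ccontr)
  assume no: "\<not> ?thesis"
  interpret L: bounded_linear "\<lambda>x. hank_sq \<psi> x - t *\<^sub>R x"
    by (intro bounded_linear_sub bounded_linear_hank_sq \<psi> bounded_linear_scaleR_right)
  have bb: "e * norm x \<le> norm (hank_sq \<psi> x - t *\<^sub>R x)" if x: "x \<in> hol" for x
  proof (cases "x = 0")
    case False
    define u where "u = x /\<^sub>R norm x"
    have "u \<in> hol" "norm u = 1"
      using False x subspace_scale[OF subspace_hol] by (auto simp: u_def)
    then have "e \<le> norm (hank_sq \<psi> u - t *\<^sub>R u)" using no by force
    also have "hank_sq \<psi> u - t *\<^sub>R u = (hank_sq \<psi> x - t *\<^sub>R x) /\<^sub>R norm x"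
      unfolding u_def by (rule L.scaleR)
    finally have "e \<le> norm (hank_sq \<psi> x - t *\<^sub>R x) / norm x"
      by (simp only: norm_scaleR abs_inverse abs_norm_cancel divide_inverse mult.commute)
    then show ?thesis using False by (simp add: pos_le_divide_eq)
  qed simp
  have "of_real t \<notin> hankel_spectrum \<psi>"
    by (rule not_in_spectrum_of_bounded_below[OF \<psi> e _ e]) (use bb in \<open>simp_all add: mul_of_real\<close>)
  with t show False by simp
qed

section \<open>Approximate eigenvectors concentrating at the boundary\<close>

lemma multiplier_continuous:
  assumes "continuous_on (closure polydisc) \<phi>"
  shows "multiplier \<phi>"
proof -
  have "polydisc \<subseteq> (cball 0 (real CARD('a)) :: (complex ^ 'a) set)"
  proof
    fix z :: "complex ^ 'a" assume "z \<in> polydisc"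
    have "norm z \<le> (\<Sum>i\<in>UNIV. cmod (z $ i))"
      unfolding norm_vec_def by (rule L2_set_le_sum) simp
    also have "\<dots> \<le> (\<Sum>i\<in>(UNIV :: 'a set). 1)"
      by (rule sum_mono) (use \<open>z \<in> polydisc\<close> in \<open>auto simp: polydisc_def intro: less_imp_le\<close>)
    finally show "z \<in> cball 0 (real CARD('a))" by simp
  qed
  then have "bounded (polydisc :: (complex ^ 'a) set)" using bounded_cball bounded_subset by blast
  then have "compact (closure (polydisc :: (complex ^ 'a) set))" by (simp add: compact_closure)
  then have "bounded (\<phi> ` closure polydisc)"
    using assms compact_continuous_image compact_imp_bounded by blast
  then obtain K where K: "\<And>z. z \<in> closure polydisc \<Longrightarrow> cmod (\<phi> z) \<le> K" unfolding bounded_iff by auto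
  have "\<forall>z\<in>polydisc. cmod (\<phi> z) \<le> \<bar>K\<bar>"
    using K closure_subset by (meson abs_ge_self order_trans subsetD)
  then show ?thesis
    using continuous_on_subset[OF assms closure_subset] unfolding multiplier_def by (meson abs_ge_zero)
qed

lemma multiplier_product:
  fixes \<phi> :: "complex ^ 'm::finite \<Rightarrow> complex"
  assumes \<phi>: "multiplier \<phi>" and chi: "continuous_on (cball 0 1) chi"
    and \<psi>: "\<And>z w. z \<in> polydisc \<Longrightarrow> w \<in> ball 0 1 \<Longrightarrow> \<psi> (vec_snoc z w) = \<phi> z * chi w"
  shows "multiplier \<psi>"
proof -
  obtain K where K: "K \<ge> 0" "\<And>z. z \<in> polydisc \<Longrightarrow> cmod (\<phi> z) \<le> K"
    using \<phi> unfolding multiplier_def by blast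
  obtain L where L: "\<And>w. w \<in> ball 0 1 \<Longrightarrow> cmod (chi w) \<le> L"
    using disc_function_continuous[OF chi] unfolding disc_function_def by blast
  have eq: "\<psi> v = \<phi> (vec_init v) * chi (v $ None)" if "v \<in> polydisc" for v
    using \<psi>[of "vec_init v" "v $ None"] that by (simp add: polydisc_init_iff)
  have "cmod (chi 0) \<le> L" by (rule L) simp
  then have L0: "0 \<le> L" using norm_ge_zero[of "chi 0"] by linarith
  have bnd: "cmod (\<psi> v) \<le> K * L" if "v \<in> polydisc" for v
    unfolding eq[OF that] norm_mult
    using that K L L0 by (intro mult_mono) (auto simp: polydisc_init_iff)
  have "continuous_on polydisc (\<lambda>v. \<phi> (vec_init v) * chi (v $ None))"
  proof (intro continuous_on_mult)
    show "continuous_on polydisc (\<lambda>v. \<phi> (vec_init v))"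
      by (rule continuous_on_compose2[OF _ continuous_on_vec_init, of polydisc])
        (use \<phi> in \<open>auto simp: polydisc_init_iff multiplier_def\<close>)
    show "continuous_on polydisc (\<lambda>v :: complex ^ ('m option). chi (v $ None))"
      by (rule continuous_on_compose2[OF chi]) (auto simp: polydisc_init_iff intro: continuous_intros)
  qed
  then have "continuous_on polydisc \<psi>"
    by (rule continuous_on_eq) (simp add: eq)
  then show ?thesis using bnd K L0 unfolding multiplier_def by (intro conjI exI[of _ "K * L"]) auto
qed

lemma tensor_mult_eq:
  assumes "disc_function f" "disc_function g"
  shows "tensor x (\<lambda>w. f w * g w) = mul (\<lambda>_. c) (tensor x g) + tensor x (\<lambda>w. (f w - c) * g w)"
proof -
  have d: "disc_function (\<lambda>w. f w - c)"
    using assms(1) unfolding disc_function_def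
    by (auto intro!: continuous_intros) (metis add_mono norm_triangle_ineq4 order_refl order_trans)
  show ?thesis
  proof (rule disc_fun_eqI)
    fix v
    have "zero_ext (\<lambda>w. f w * g w) w = c * zero_ext g w + zero_ext (\<lambda>w. (f w - c) * g w) w" for w
      by (simp add: zero_ext_def left_diff_distrib)
    then show "fn (tensor x (\<lambda>w. f w * g w)) v = fn (mul (\<lambda>_. c) (tensor x g) + tensor x (\<lambda>w. (f w - c) * g w)) v"
      by (simp only: fn_tensor[OF disc_function_mult[OF assms]] fn_tensor[OF disc_function_mult[OF d assms(2)]]
          fn_tensor[OF assms(2)] fn_mul[OF multiplier_const] fn_simps distrib_left mult.left_commute)
  qed
qed

text \<open>Each of the two multiplications, by \<open>\<psi>\<close> and by its conjugate, replaces \<open>chi\<close> or its conjugate by the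
  value at \<open>q\<close> up to an error (\<open>e1\<close> and \<open>e2\<close>) that tends to zero; projections pass to the first
  factor.\<close>

lemma hank_sq_tensor_peak:
  fixes \<phi> :: "complex ^ 'm::finite \<Rightarrow> complex"
  assumes \<phi>: "multiplier \<phi>" and chi: "continuous_on (cball 0 1) chi"
    and \<psi>: "\<And>z w. z \<in> polydisc \<Longrightarrow> w \<in> ball 0 1 \<Longrightarrow> \<psi> (vec_snoc z w) = \<phi> z * chi w"
    and q: "cmod q = 1"
  shows "(\<lambda>j. hank_sq \<psi> (tensor x (peak q j)) - (cmod (chi q))\<^sup>2 *\<^sub>R tensor (hank_sq \<phi> x) (peak q j)) \<longlonglongrightarrow> 0"
proof -
  have \<psi>m: "multiplier \<psi>" by (rule multiplier_product[OF \<phi> chi \<psi>])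
  have chid: "disc_function chi" by (rule disc_function_continuous[OF chi])
  have cchi: "continuous_on (cball 0 1) (\<lambda>w. cnj (chi w))" by (intro continuous_intros chi)
  have cchid: "disc_function (\<lambda>w. cnj (chi w))" by (rule disc_function_continuous[OF cchi])
  define P where "P = (proj hol :: 'm option disc_fun \<Rightarrow> _)"
  define Q where "Q = (\<lambda>u. u - P u)"
  interpret P: bounded_linear P unfolding P_def by (rule bounded_linear_proj[OF hol_space])
  have QL: "bounded_linear Q" unfolding Q_def
    by (intro bounded_linear_sub bounded_linear_ident P.bounded_linear_axioms)
  interpret Q: bounded_linear Q by (rule QL)
  define M where "M = mul (\<lambda>v. cnj (\<psi> v))"
  interpret M: bounded_linear M unfolding M_def by (rule bounded_linear_mul[OF multiplier_cnj[OF \<psi>m]])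
  define c where "c = chi q"
  interpret C: bounded_linear "mul (\<lambda>_. c) :: 'm option disc_fun \<Rightarrow> _" by (rule bounded_linear_mul) simp
  define g where "g = peak q"
  have g: "disc_function (g j)" "g j holomorphic_on ball 0 1" for j
    unfolding g_def by (rule disc_function_peak peak_holomorphic)+
  define e1 where "e1 j = tensor (mul \<phi> x) (\<lambda>w. (chi w - c) * g j w)" for j
  define e2 where "e2 j = tensor (mul (\<lambda>z. cnj (\<phi> z)) (hank \<phi> x)) (\<lambda>w. (cnj (chi w) - cnj c) * g j w)" for j
  have e1: "e1 \<longlonglongrightarrow> 0"
    unfolding e1_def c_def g_def
    by (rule tendsto_norm_zero_cancel) (rule norm_tensor_peak_error[OF q chi])
  have e2: "e2 \<longlonglongrightarrow> 0"
    unfolding e2_def c_def g_def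
    by (rule tendsto_norm_zero_cancel) (rule norm_tensor_peak_error[OF q cchi])
  have 1: "mul \<psi> (tensor x (g j)) = mul (\<lambda>_. c) (tensor (mul \<phi> x) (g j)) + e1 j" for j
    unfolding e1_def
    by (simp only: mul_tensor[OF \<psi> \<phi> \<psi>m chid g(1)] tensor_mult_eq[OF chid g(1), of _ _ c])
  have Pc: "Q (mul (\<lambda>_. c) u) = mul (\<lambda>_. c) (Q u)" for u
    by (simp add: Q_def P_def proj_mul_const C.diff)
  have Qt: "Q (tensor u (g j)) = tensor (u - proj hol u) (g j)" for u j
    by (simp add: Q_def P_def proj_tensor[OF g] tensor_diff_left[OF g(1)])
  have 2: "Q (mul \<psi> (tensor x (g j))) = mul (\<lambda>_. c) (tensor (hank \<phi> x) (g j)) + Q (e1 j)" for j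
    by (simp only: 1 Q.add Pc Qt hank_def)
  have 3: "M (tensor (hank \<phi> x) (g j)) =
      mul (\<lambda>_. cnj c) (tensor (mul (\<lambda>z. cnj (\<phi> z)) (hank \<phi> x)) (g j)) + e2 j" for j
  proof -
    have "M (tensor (hank \<phi> x) (g j)) = tensor (mul (\<lambda>z. cnj (\<phi> z)) (hank \<phi> x)) (\<lambda>w. cnj (chi w) * g j w)"
      unfolding M_def
      by (rule mul_tensor) (use \<psi> multiplier_cnj \<phi> \<psi>m cchid g in auto)
    then show ?thesis unfolding e2_def by (simp only: tensor_mult_eq[OF cchid g(1), of _ _ "cnj c"])
  qed
  have cc: "mul (\<lambda>_. c) (mul (\<lambda>_. cnj c) u) = (cmod c)\<^sup>2 *\<^sub>R u" for u :: "'m option disc_fun"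
  proof (rule disc_fun_eqI)
    fix z :: "complex ^ ('m option)"
    have "c * (cnj c * fn u z) = of_real ((cmod c)\<^sup>2) * fn u z"
      by (simp only: complex_norm_square mult.assoc)
    then show "fn (mul (\<lambda>_. c) (mul (\<lambda>_. cnj c) u)) z = fn ((cmod c)\<^sup>2 *\<^sub>R u) z"
      by (simp add: fn_mul fn_simps)
  qed
  have Mc: "M (mul (\<lambda>_. c) u) = mul (\<lambda>_. c) (M u)" for u
    unfolding M_def by (rule mul_mul_commute) (simp_all add: multiplier_cnj[OF \<psi>m])
  have "hank_sq \<psi> (tensor x (g j)) = (cmod c)\<^sup>2 *\<^sub>R tensor (hank_sq \<phi> x) (g j)
      + (P (mul (\<lambda>_. c) (e2 j)) + P (M (Q (e1 j))))" for j
  proof -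
    have "hank_sq \<psi> (tensor x (g j)) = P (M (Q (mul \<psi> (tensor x (g j)))))"
      by (simp add: hank_sq_def hank_def P_def M_def Q_def)
    also have "\<dots> = P ((cmod c)\<^sup>2 *\<^sub>R tensor (mul (\<lambda>z. cnj (\<phi> z)) (hank \<phi> x)) (g j) + mul (\<lambda>_. c) (e2 j) + M (Q (e1 j)))"
      by (simp only: 2 M.add Mc 3 C.add cc)
    also have "\<dots> = (cmod c)\<^sup>2 *\<^sub>R P (tensor (mul (\<lambda>z. cnj (\<phi> z)) (hank \<phi> x)) (g j))
      + (P (mul (\<lambda>_. c) (e2 j)) + P (M (Q (e1 j))))"
      by (simp only: P.add P.scaleR add.assoc)
    also have "P (tensor (mul (\<lambda>z. cnj (\<phi> z)) (hank \<phi> x)) (g j)) = tensor (hank_sq \<phi> x) (g j)"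
      by (simp add: P_def proj_tensor[OF g] hank_sq_def)
    finally show ?thesis .
  qed
  then have "hank_sq \<psi> (tensor x (peak q j)) - (cmod (chi q))\<^sup>2 *\<^sub>R tensor (hank_sq \<phi> x) (peak q j) =
      P (mul (\<lambda>_. c) (e2 j)) + P (M (Q (e1 j)))" for j
    by (simp add: g_def c_def)
  moreover have "(\<lambda>j. P (mul (\<lambda>_. c) (e2 j)) + P (M (Q (e1 j)))) \<longlonglongrightarrow> 0 + 0"
    by (intro tendsto_add P.tendsto_zero C.tendsto_zero M.tendsto_zero Q.tendsto_zero e1 e2)
  ultimately show ?thesis by simp
qed

text \<open>First an approximate eigenvector \<open>f\<close> of the operator in the first variables is fixed, then the peak is
  chosen sharp enough for this \<open>f\<close> and for the finite set \<open>C\<close>.\<close>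

lemma concentrating_eigenvectors:
  fixes \<phi> :: "complex ^ 'm::finite \<Rightarrow> complex" and C :: "'m option disc_fun set"
  assumes \<phi>: "multiplier \<phi>" and chi: "continuous_on (cball 0 1) chi"
    and \<psi>: "\<And>z w. z \<in> polydisc \<Longrightarrow> w \<in> ball 0 1 \<Longrightarrow> \<psi> (vec_snoc z w) = \<phi> z * chi w"
    and q: "cmod q = 1" and t: "of_real t \<in> hankel_spectrum \<phi>" and e: "0 < e" and C: "finite C"
  shows "\<exists>x\<in>hol. norm x = 1 \<and> norm (hank_sq \<psi> x - ((cmod (chi q))\<^sup>2 * t) *\<^sub>R x) < e \<and>
    (\<forall>c\<in>C. \<bar>inner x c\<bar> \<le> e)"
proof -
  define s where "s = (cmod (chi q))\<^sup>2"
  have s0: "0 \<le> s" by (simp add: s_def)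
  have "0 < e / (2 * (s + 1))" using e s0 by simp
  from approximate_eigenvector[OF \<phi> t this]
  obtain f where f: "f \<in> hol" "norm f = 1" "norm (hank_sq \<phi> f - t *\<^sub>R f) < e / (2 * (s + 1))" by blast
  have fs: "s * norm (hank_sq \<phi> f - t *\<^sub>R f) < e/2"
  proof -
    have "s * norm (hank_sq \<phi> f - t *\<^sub>R f) \<le> s * (e / (2 * (s + 1)))"
      using f(3) s0 by (intro mult_left_mono) auto
    also have "\<dots> < (s + 1) * (e / (2 * (s + 1)))"
      using e s0 by (intro mult_strict_right_mono) auto
    also have "\<dots> = e/2" using s0 by (simp add: field_simps)
    finally show ?thesis .
  qed
  define X where "X j = tensor f (peak q j)" for j
  have "\<forall>\<^sub>F j in sequentially. norm (hank_sq \<psi> (X j) - s *\<^sub>R tensor (hank_sq \<phi> f) (peak q j)) < e/2"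
    using tendstoD[OF hank_sq_tensor_peak[OF \<phi> chi \<psi> q, of f], of "e/2"] e
    by (simp add: X_def s_def dist_norm)
  moreover have "\<forall>\<^sub>F j in sequentially. \<forall>c\<in>C. \<bar>inner (X j) c\<bar> \<le> e"
  proof (rule eventually_ball_finite[OF C], rule ballI)
    fix c :: "'m option disc_fun"
    obtain J where "\<forall>j\<ge>J. \<forall>x. \<bar>inner (tensor x (peak q j)) c\<bar> \<le> e * norm x"
      using peak_weakly_null[OF q e] by blast
    then show "\<forall>\<^sub>F j in sequentially. \<bar>inner (X j) c\<bar> \<le> e"
      unfolding eventually_sequentially X_def using f(2) by (metis mult.right_neutral)
  qed
  ultimately have "\<forall>\<^sub>F j in sequentially.
      norm (hank_sq \<psi> (X j) - s *\<^sub>R tensor (hank_sq \<phi> f) (peak q j)) < e/2 \<and> (\<forall>c\<in>C. \<bar>inner (X j) c\<bar> \<le> e)"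
    by (rule eventually_conj)
  then obtain j where j: "norm (hank_sq \<psi> (X j) - s *\<^sub>R tensor (hank_sq \<phi> f) (peak q j)) < e/2"
    "\<forall>c\<in>C. \<bar>inner (X j) c\<bar> \<le> e"
    by (auto simp: eventually_sequentially)
  have "X j \<in> hol" unfolding X_def by (rule tensor_hol[OF f(1) disc_function_peak peak_holomorphic])
  moreover have "norm (X j) = 1" by (simp add: X_def norm_tensor_peak[OF q] f(2))
  moreover have "norm (hank_sq \<psi> (X j) - (s * t) *\<^sub>R X j) < e"
  proof -
    have "hank_sq \<psi> (X j) - (s * t) *\<^sub>R X j =
      (hank_sq \<psi> (X j) - s *\<^sub>R tensor (hank_sq \<phi> f) (peak q j)) + s *\<^sub>R tensor (hank_sq \<phi> f - t *\<^sub>R f) (peak q j)"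
      by (simp add: X_def tensor_diff_left tensor_scaleR_left disc_function_peak scaleR_diff_right)
    then have "norm (hank_sq \<psi> (X j) - (s * t) *\<^sub>R X j) \<le>
      norm (hank_sq \<psi> (X j) - s *\<^sub>R tensor (hank_sq \<phi> f) (peak q j)) + norm (s *\<^sub>R tensor (hank_sq \<phi> f - t *\<^sub>R f) (peak q j))"
      by (metis norm_triangle_ineq)
    also have "norm (s *\<^sub>R tensor (hank_sq \<phi> f - t *\<^sub>R f) (peak q j)) = s * norm (hank_sq \<phi> f - t *\<^sub>R f)"
      using s0 by (simp add: norm_tensor_peak[OF q])
    finally show ?thesis using j(1) fs by linarith
  qed
  ultimately show ?thesis using j(2) unfolding s_def by blast
qed

section \<open>The essential spectrum\<close>

text \<open>The kernel of \<open>T - t\<close> is contained in the generalised eigenspace, which is spanned over the complex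
  numbers by a finite set \<open>B\<close>; over the reals it is spanned by \<open>B\<close> together with \<open>\<i> B\<close>.\<close>

lemma discrete_spectrum_fredholm:
  fixes \<psi> :: "complex ^ 'n::finite \<Rightarrow> complex"
  assumes \<psi>: "multiplier \<psi>"
    and t: "complex_of_real t \<in> discrete_spectrum_on (bergman_space polydisc) (L2_norm polydisc) (hankel_star_hankel polydisc \<psi>)"
  shows "\<exists>C K. finite C \<and>
    (\<forall>x\<in>hol. (norm x)\<^sup>2 \<le> K * (norm (hank_sq \<psi> x - t *\<^sub>R x))\<^sup>2 + (\<Sum>c\<in>C. K * (inner x c)\<^sup>2))"
proof -
  let ?T = "hankel_star_hankel polydisc \<psi>"
  let ?E = "generalized_eigenspace_on (bergman_space polydisc) ?T (complex_of_real t)"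
  interpret H: symmetric_operator hol "hank_sq \<psi>" by (rule symmetric_operator_hank_sq[OF \<psi>])
  interpret S: symmetric_operator hol "\<lambda>x. hank_sq \<psi> x - t *\<^sub>R x" by (rule H.shift)
  have fin: "finite_dimensional_functions ?E" and iso: "complex_of_real t isolated_in hankel_spectrum \<psi>"
    using t by (auto simp: discrete_spectrum_on_def)
  obtain U where U: "open U" "U \<inter> hankel_spectrum \<psi> = {complex_of_real t}"
    using iso unfolding isolated_in_def by (auto simp: Int_commute)
  then have "complex_of_real t \<in> U" by blast
  then obtain \<delta> where \<delta>: "\<delta> > 0" "ball (complex_of_real t) \<delta> \<subseteq> U"
    by (rule openE[OF U(1)])
  have bb: "S.bounded_below s" if "s \<noteq> 0" "\<bar>s\<bar> < \<delta>" for s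
  proof -
    have "dist (complex_of_real t) (of_real (t + s)) = \<bar>s\<bar>" by (simp add: dist_norm)
    then have "complex_of_real (t + s) \<in> U" using \<delta>(2) that(2) by (metis mem_ball subsetD)
    moreover have "complex_of_real (t + s) \<noteq> of_real t" using that(1) by simp
    ultimately have "complex_of_real (t + s) \<notin> hankel_spectrum \<psi>" using U(2) by blast
    from bounded_below_of_not_in_spectrum[OF \<psi> this] show ?thesis
      unfolding S.bounded_below_def shifted_real by (simp add: scaleR_add_left diff_diff_eq)
  qed
  obtain B where B: "finite B" "B \<subseteq> ?E" "\<And>f. f \<in> ?E \<Longrightarrow> \<exists>c. f = (\<lambda>z. \<Sum>b\<in>B. c b * b z)"
    using fin unfolding finite_dimensional_functions_def by blast
  define B' where "B' = disc_fun ` B \<union> (mul (\<lambda>_. \<i>) \<circ> disc_fun) ` B"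
  have Bfn: "fn (disc_fun b) = b" if "b \<in> B" for b
  proof -
    have "b \<in> fn ` hol" using B(2) that by (auto simp: generalized_eigenspace_on_def bergman_space_polydisc)
    then show ?thesis by (auto simp: fn_inverse)
  qed
  have ker: "x \<in> span B'" if x: "x \<in> hol" "hank_sq \<psi> x - t *\<^sub>R x = 0" for x
  proof -
    have "shifted_operator ?T (complex_of_real t) (fn x) = (\<lambda>_. 0)"
      by (simp only: shifted_operator_fn[OF \<psi>] shifted_real x(2) zero_disc_fun.rep_eq)
    then have "fn x \<in> ?E"
      using x(1) unfolding generalized_eigenspace_on_def bergman_space_polydisc
      by (auto intro!: exI[of _ 1])
    then obtain c where c: "fn x = (\<lambda>z. \<Sum>b\<in>B. c b * b z)" using B(3) by blast
    have fnsum: "fn (\<Sum>b\<in>B. h b) z = (\<Sum>b\<in>B. fn (h b) z)" for h :: "_ \<Rightarrow> 'n disc_fun" and z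
      using B(1) by induction (simp_all add: fn_simps)
    have "x = (\<Sum>b\<in>B. Re (c b) *\<^sub>R disc_fun b + Im (c b) *\<^sub>R mul (\<lambda>_. \<i>) (disc_fun b))"
    proof (rule disc_fun_eqI)
      fix z :: "complex ^ 'n"
      have "c b * b z = fn (Re (c b) *\<^sub>R disc_fun b + Im (c b) *\<^sub>R mul (\<lambda>_. \<i>) (disc_fun b)) z" if "b \<in> B" for b
      proof -
        have "c b = of_real (Re (c b)) + of_real (Im (c b)) * \<i>" by (simp add: complex_eq_iff)
        then have "c b * b z = of_real (Re (c b)) * b z + of_real (Im (c b)) * (\<i> * b z)"
          by (metis distrib_right mult.assoc)
        then show ?thesis by (simp add: fn_simps fn_mul Bfn[OF that])
      qed
      then show "fn x z = fn (\<Sum>b\<in>B. Re (c b) *\<^sub>R disc_fun b + Im (c b) *\<^sub>R mul (\<lambda>_. \<i>) (disc_fun b)) z"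
        unfolding c fnsum by (rule sum.cong[OF refl])
    qed
    also have "\<dots> \<in> span B'"
      by (intro span_sum span_add span_scale span_base) (auto simp: B'_def)
    finally show ?thesis .
  qed
  obtain B0 where B0: "finite B0" "B0 \<subseteq> {x \<in> hol. hank_sq \<psi> x - t *\<^sub>R x = 0}"
    "{x \<in> hol. hank_sq \<psi> x - t *\<^sub>R x = 0} \<subseteq> span B0"
  proof -
    obtain B0 where b: "B0 \<subseteq> {x \<in> hol. hank_sq \<psi> x - t *\<^sub>R x = 0}" "independent B0"
      "{x \<in> hol. hank_sq \<psi> x - t *\<^sub>R x = 0} \<subseteq> span B0"
      using maximal_independent_subset by blast
    have "finite B'" using B(1) by (simp add: B'_def)
    moreover have "B0 \<subseteq> span B'" using b(1) ker by blast
    ultimately have "finite B0" using b(2) independent_span_bound by blast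
    with b show thesis using that by blast
  qed
  have "\<exists>C K. finite C \<and> C \<subseteq> hol \<and>
    (\<forall>x\<in>hol. (norm x)\<^sup>2 \<le> K * (norm (hank_sq \<psi> x - t *\<^sub>R x))\<^sup>2 + (\<Sum>c\<in>C. K * (inner x c)\<^sup>2))"
    by (rule S.fredholm_estimate[OF bb \<delta>(1) B0(1)]) (use B0 in auto)
  then show ?thesis by blast
qed

theorem theorem1:
  fixes \<phi> :: "complex ^ 'm \<Rightarrow> complex"
    and chi :: "complex \<Rightarrow> complex"
    and \<psi> :: "complex ^ ('m option) \<Rightarrow> complex"
  assumes "continuous_on (closure polydisc) \<phi>"
    and "continuous_on (cball 0 1) chi"
    and "\<And>z w. z \<in> closure polydisc \<Longrightarrow> w \<in> cball 0 1 \<Longrightarrow> \<psi> (vec_snoc z w) = \<phi> z * chi w"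
  shows "{complex_of_real ((cmod (chi q))\<^sup>2) * \<mu> | q \<mu>.
            q \<in> sphere 0 1 \<and>
            \<mu> \<in> spectrum_on (bergman_space polydisc) (L2_norm polydisc)
                  (hankel_star_hankel (polydisc :: (complex ^ 'm) set) \<phi>)}
         \<subseteq> essential_spectrum_on (bergman_space polydisc) (L2_norm polydisc)
             (hankel_star_hankel (polydisc :: (complex ^ ('m option)) set) \<psi>)"
proof
  fix lam
  assume "lam \<in> {complex_of_real ((cmod (chi q))\<^sup>2) * \<mu> | q \<mu>. q \<in> sphere 0 1 \<and> \<mu> \<in> hankel_spectrum \<phi>}"
  then obtain q \<mu> where q: "cmod q = 1" and \<mu>: "\<mu> \<in> hankel_spectrum \<phi>"
    and lam: "lam = complex_of_real ((cmod (chi q))\<^sup>2) * \<mu>" by auto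
  have \<phi>: "multiplier \<phi>" by (rule multiplier_continuous[OF assms(1)])
  have \<psi>: "\<psi> (vec_snoc z w) = \<phi> z * chi w" if "z \<in> polydisc" "w \<in> ball 0 1" for z w
    using assms(3) that closure_subset ball_subset_cball by blast
  have \<psi>m: "multiplier \<psi>" by (rule multiplier_product[OF \<phi> assms(2) \<psi>])
  define t where "t = (cmod (chi q))\<^sup>2 * Re \<mu>"
  have \<mu>r: "of_real (Re \<mu>) \<in> hankel_spectrum \<phi>" using spectrum_real[OF \<phi> \<mu>] \<mu> by simp
  have lam_t: "lam = of_real t" unfolding lam t_def by (subst spectrum_real[OF \<phi> \<mu>]) simp
  have approx: "\<exists>x\<in>hol. norm x = 1 \<and> norm (hank_sq \<psi> x - t *\<^sub>R x) < e \<and> (\<forall>c\<in>C. \<bar>inner x c\<bar> \<le> e)"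
    if "0 < e" "finite C" for e and C :: "'m option disc_fun set"
    unfolding t_def by (rule concentrating_eigenvectors[OF \<phi> assms(2) \<psi> q \<mu>r that])
  have "lam \<in> hankel_spectrum \<psi>"
  proof (rule ccontr)
    assume "lam \<notin> hankel_spectrum \<psi>"
    then obtain c where c: "0 < c" "\<And>x. x \<in> hol \<Longrightarrow> c * norm x \<le> norm (hank_sq \<psi> x - t *\<^sub>R x)"
      using bounded_below_of_not_in_spectrum[OF \<psi>m, of lam] unfolding lam_t shifted_real by blast
    obtain x where "x \<in> hol" "norm x = 1" "norm (hank_sq \<psi> x - t *\<^sub>R x) < c"
      using approx[OF c(1) finite.emptyI] by blast
    then show False using c(2)[of x] by simp
  qed
  moreover have "lam \<notin> discrete_spectrum_on (bergman_space polydisc) (L2_norm polydisc) (hankel_star_hankel polydisc \<psi>)"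
  proof
    assume "lam \<in> discrete_spectrum_on (bergman_space polydisc) (L2_norm polydisc) (hankel_star_hankel polydisc \<psi>)"
    from discrete_spectrum_fredholm[OF \<psi>m this[unfolded lam_t]]
    obtain C K where C: "finite C" and est: "\<And>x. x \<in> hol \<Longrightarrow>
        (norm x)\<^sup>2 \<le> K * (norm (hank_sq \<psi> x - t *\<^sub>R x))\<^sup>2 + (\<Sum>c\<in>C. K * (inner x c)\<^sup>2)" by blast
    \<comment> \<open>For \<open>e\<^sup>2 = 1 / L\<close> and a unit vector \<open>x\<close> the right-hand side of \<open>est\<close> is below \<open>1\<close>.\<close>
    define L where "L = \<bar>K\<bar> * (1 + real (card C)) + 1"
    have L: "0 < L" by (simp add: L_def add_nonneg_pos)
    define e where "e = sqrt (1 / L)"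
    have e: "0 < e" "e\<^sup>2 = 1 / L" using L by (auto simp: e_def)
    obtain x where x: "x \<in> hol" "norm x = 1" "norm (hank_sq \<psi> x - t *\<^sub>R x) < e"
      "\<And>c. c \<in> C \<Longrightarrow> \<bar>inner x c\<bar> \<le> e" using approx[OF e(1) C] by blast
    have "K * (norm (hank_sq \<psi> x - t *\<^sub>R x))\<^sup>2 \<le> \<bar>K\<bar> * e\<^sup>2"
      using x(3) by (intro mult_mono power_mono) auto
    moreover have "(\<Sum>c\<in>C. K * (inner x c)\<^sup>2) \<le> (\<Sum>c\<in>C. \<bar>K\<bar> * e\<^sup>2)"
    proof (rule sum_mono)
      fix c assume "c \<in> C"
      then have "(inner x c)\<^sup>2 \<le> e\<^sup>2" using power_mono[OF x(4), of c 2] by simp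
      then show "K * (inner x c)\<^sup>2 \<le> \<bar>K\<bar> * e\<^sup>2" by (intro mult_mono) auto
    qed
    ultimately have "1 \<le> \<bar>K\<bar> * e\<^sup>2 + real (card C) * (\<bar>K\<bar> * e\<^sup>2)"
      using est[OF x(1)] x(2) by simp
    also have "\<dots> = (\<bar>K\<bar> * (1 + real (card C))) / L" by (simp add: e(2) algebra_simps add_divide_distrib)
    also have "\<dots> < 1" using L by (simp add: L_def)
    finally show False by simp
  qed
  ultimately show "lam \<in> essential_spectrum_on (bergman_space polydisc) (L2_norm polydisc)
      (hankel_star_hankel (polydisc :: (complex ^ ('m option)) set) \<psi>)"
    by (simp add: essential_spectrum_on_def)
qed

end
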